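(* Let $\mathcal N$ be a separable complex Hilbert space and let $\mathcal N_0(\mathcal N)$, $\mathcal N_{0,F}(\mathcal N)$, $\mathcal N_{0,K}(\mathcal N)$, $\mathcal N_{0,F,K}(\mathcal N)$ be the classes of $\mathcal B(\mathcal N)$-valued Herglotz functions defined in the context. (i) Any $M\in\mathcal N_0(\mathcal N)$ can be realized in the form $$M(z)=V^*\bigl(zI_{\mathcal N_+}+(1+z^2)P_{\mathcal N_+}(H-z)^{-1}P_{\mathcal N_+}\big|_{\mathcal N_+}\bigr)V,\quad z\in\mathbb C\setminus\mathbb R,$$ where $H$ denotes a self-adjoint extension of some densely defined closed symmetric operator $\dot H$ with deficiency subspaces $\mathcal N_\pm$ in some separable complex Hilbert space $\mathcal H$. (ii) Any $M\in\mathcal N_{0,F}(\mathcal N)$ (respectively, $M\in\mathcal N_{0,K}(\mathcal N)$) can be realized in the form $$M(z)=V^*\bigl(zI_{\mathcal N_+}+(1+z^2)P_{\mathcal N_+}(H_{F}-z)^{-1}P_{\mathcal N_+}\big|_{\mathcal N_+}\bigr)V,\quad z\in\mathbb C\setminus\mathbb R$$ (respectively, with $H_F$ replaced by $H_K$), where $H_F\ge0$ (respectively, $H_K\ge0$) denotes the Friedrichs (respectively, Krein) extension of some densely defined closed symmetric operator $\dot H$ with deficiency subspaces $\mathcal N_\pm$ in some separable complex Hilbert space $\mathcal H$. (iii) Any $M\in\mathcal N_{0,F,K}(\mathcal N)$ can be realized in the form $$M(z)=V^*\bigl(zI_{\mathcal N_+}+(1+z^2)P_{\mathcal N_+}(H_{F,K}-z)^{-1}P_{\mathcal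 N_+}\big|_{\mathcal N_+}\bigr)V,\quad z\in\mathbb C\setminus\mathbb R,$$ where $H_{F,K}\ge0$ denotes the unique nonnegative self-adjoint extension of some densely defined closed symmetric operator $\dot H$ with deficiency subspaces $\mathcal N_\pm$ in some separable complex Hilbert space $\mathcal H$. In all cases (i)-(iii), $V$ denotes a unitary operator from $\mathcal N$ to $\mathcal N_+$.
   Context: A $\mathcal B(\mathcal N)$-valued Herglotz function is an analytic $M:\mathbb C_+\to\mathcal B(\mathcal N)$ with $\mathrm{Im}(M(z))\ge0$, extended by $M(\bar z)=M(z)^*$. Deficiency subspaces: $\mathcal N_\pm=\ker(\dot H^*\mp i)$; $P_{\mathcal N_+}$ is the orthogonal projection in $\mathcal H$ onto $\mathcal N_+$. Classes. $\mathcal N_0(\mathcal N)$ is the set of $\mathcal B(\mathcal N)$-valued Herglotz functions of the form $M(z)=\int_{\mathbb R}d\Omega(\lambda)\bigl((\lambda-z)^{-1}-\lambda(1+\lambda^2)^{-1}\bigr)$ (integral in the strong operator topology), where $\Omega$ is a positive operator-valued measure such that $\widetilde\Omega$, defined by $d\widetilde\Omega(\lambda)=(1+\lambda^2)^{-1}d\Omega(\lambda)$, satisfies $\widetilde\Omega(\mathbb R)=I_{\mathcal N}$, and $\int_{\mathbb R}d(\xi,\Omega(\lambda)\xi)_{\mathcal N}=\infty$ for all $\xi\in\mathcal N\setminus\{0\}$. $\mathcal N_{0,F}(\mathcal N)$: all $M\in\mathcal N_0(\mathcal N)$ with $\mathrm{supp}(\Omega)\subseteq[0,\infty)$ and, for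 all $\xi\in\mathcal N\setminus\{0\}$, $\int_R^\infty\lambda^{-1}d(\xi,\Omega(\lambda)\xi)_{\mathcal N}=\infty$ for some $R>0$. $\mathcal N_{0,K}(\mathcal N)$: all $M\in\mathcal N_0(\mathcal N)$ with $\mathrm{supp}(\Omega)\subseteq[0,\infty)$ and, for all $\xi\in\mathcal N\setminus\{0\}$, $\int_0^R\lambda^{-1}d(\xi,\Omega(\lambda)\xi)_{\mathcal N}=\infty$ for some $R>0$ (integral over $[0,R]$, with $\lambda^{-1}=+\infty$ at $\lambda=0$). $\mathcal N_{0,F,K}(\mathcal N)=\mathcal N_{0,F}(\mathcal N)\cap\mathcal N_{0,K}(\mathcal N)$. Friedrichs and Krein extensions of a densely defined closed $\dot H\ge0$: $\mathrm{dom}(H_F^{1/2})$ is the set of $f\in\mathcal H$ for which there is $\{f_n\}\subset\mathrm{dom}(\dot H)$ with $f_n\to f$ and $(f_n-f_m,\dot H(f_n-f_m))\to0$ as $m,n\to\infty$, and $H_F=\dot H^*|_{\mathrm{dom}(\dot H^* )\cap\mathrm{dom}(H_F^{1/2})}$; $\mathrm{dom}(H_K)$ is the set of $f\in\mathrm{dom}(\dot H^* )$ for which there is $\{f_n\}\subset\mathrm{dom}(\dot H)$ with $\dot Hf_n\to\dot H^*f$ and $(f_n-f_m,\dot H(f_n-f_m))\to0$ as $m,n\to\infty$, and $H_K=\dot H^*|_{\mathrm{dom}(H_K)}$. (In (ii) and (iii), $\dot H$ is thus nonnegative.) *)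

theory Defs
  imports "HOL-Analysis.Analysis" "HOL-Library.Nonpos_Ints"
begin

section \<open>Complex Hilbert spaces\<close>

text \<open>The inner product is antilinear in the first and linear in the second argument.\<close>

class chilbert_space = banach +
  fixes scaleC :: "complex \<Rightarrow> 'a \<Rightarrow> 'a" (infixr "*\<^sub>C" 75)
    and cinner :: "'a \<Rightarrow> 'a \<Rightarrow> complex"
  assumes scaleC_add_right: "a *\<^sub>C (x + y) = a *\<^sub>C x + a *\<^sub>C y"
    and scaleC_add_left: "(a + b) *\<^sub>C x = a *\<^sub>C x + b *\<^sub>C x"
    and scaleC_scaleC: "a *\<^sub>C b *\<^sub>C x = (a * b) *\<^sub>C x"
    and scaleC_of_real: "complex_of_real r *\<^sub>C x = r *\<^sub>R x"
    and cinner_commute: "cinner x y = cnj (cinner y x)"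
    and cinner_add_right: "cinner x (y + z) = cinner x y + cinner x z"
    and cinner_scaleC_right: "cinner x (a *\<^sub>C y) = a * cinner x y"
    and cinner_self: "cinner x x = complex_of_real ((norm x)\<^sup>2)"

definition clinear :: "('a::chilbert_space \<Rightarrow> 'b::chilbert_space) \<Rightarrow> bool" where
  "clinear A \<longleftrightarrow> (\<forall>x y. A (x + y) = A x + A y) \<and> (\<forall>c x. A (c *\<^sub>C x) = c *\<^sub>C A x)"

definition bounded_clinear :: "('a::chilbert_space \<Rightarrow> 'b::chilbert_space) \<Rightarrow> bool" where
  "bounded_clinear A \<longleftrightarrow> clinear A \<and> (\<exists>K. \<forall>x. norm (A x) \<le> K * norm x)"

definition csubspace :: "'a::chilbert_space set \<Rightarrow> bool" where
  "csubspace S \<longleftrightarrow> 0 \<in> S \<and> (\<forall>x\<in>S. \<forall>y\<in>S. x + y \<in> S) \<and> (\<forall>c. \<forall>x\<in>S. c *\<^sub>C x \<in> S)"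

definition separable_set :: "'a::topological_space set \<Rightarrow> bool" where
  "separable_set S \<longleftrightarrow> (\<exists>D. countable D \<and> D \<subseteq> S \<and> S \<subseteq> closure D)"

text \<open>
  The adjoint of a bounded operator. It exists and is unique by the Riesz representation theorem.
  If the range of \<open>A\<close> lies in a closed subspace, the restriction of \<open>cadjoint A\<close> to that
  subspace is the adjoint of \<open>A\<close> regarded as an operator into the subspace.
\<close>

definition cadjoint :: "('a::chilbert_space \<Rightarrow> 'b::chilbert_space) \<Rightarrow> 'b \<Rightarrow> 'a" where
  "cadjoint A y = (THE x. \<forall>u. cinner (A u) y = cinner u x)"

definition nonneg_operator :: "('a::chilbert_space \<Rightarrow> 'a) \<Rightarrow> bool" where
  "nonneg_operator A \<longleftrightarrow> (\<forall>x. cinner x (A x) \<in> \<real>\<^sub>\<ge>\<^sub>0)"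

definition Im_operator :: "('a::chilbert_space \<Rightarrow> 'a) \<Rightarrow> 'a \<Rightarrow> 'a" where
  "Im_operator A = (\<lambda>x. (1 / (2 * \<i>)) *\<^sub>C (A x - cadjoint A x))"

text \<open>The orthogonal projection onto a closed subspace \<open>K\<close>.\<close>

definition orth_proj :: "'a::chilbert_space set \<Rightarrow> 'a \<Rightarrow> 'a" where
  "orth_proj K x = (THE p. p \<in> K \<and> (\<forall>k\<in>K. cinner k (x - p) = 0))"

definition unitary_onto :: "('a::chilbert_space \<Rightarrow> 'b::chilbert_space) \<Rightarrow> 'b set \<Rightarrow> bool" where
  "unitary_onto V K \<longleftrightarrow> clinear V \<and> range V = K \<and> (\<forall>x y. cinner (V x) (V y) = cinner x y)"


section \<open>The Hilbert space of square-summable complex sequences\<close>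

text \<open>
  HOL cannot quantify existentially over types. A separable complex Hilbert space is therefore
  represented as a closed subspace of \<open>ell2\<close>; up to unitary equivalence these are
  exactly the separable complex Hilbert spaces, the finite-dimensional ones and the zero space included.
\<close>

typedef ell2 = "{x :: nat \<Rightarrow> complex. summable (\<lambda>i. (cmod (x i))\<^sup>2)}"
  morphisms ell2_nth Abs_ell2
  by (intro exI[of _ "\<lambda>_. 0"]) auto

setup_lifting type_definition_ell2

lemma ell2_eqI: "(\<And>i. ell2_nth x i = ell2_nth y i) \<Longrightarrow> x = y"
  by (metis ell2_nth_inject ext)

lemma summable_ell2: "summable (\<lambda>i. (cmod (ell2_nth x i))\<^sup>2)"
  using ell2_nth[of x] by simp

lemma L2_set_power2: "(L2_set f A)\<^sup>2 = (\<Sum>i\<in>A. (f i)\<^sup>2)"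
  by (simp add: L2_set_def sum_nonneg)

lemma sq_summableI:
  assumes "\<And>n. L2_set (\<lambda>i. cmod (f i)) {..<n} \<le> B"
  shows "summable (\<lambda>i. (cmod (f i))\<^sup>2)"
proof (rule summableI_nonneg_bounded)
  fix n show "(\<Sum>i<n. (cmod (f i))\<^sup>2) \<le> B\<^sup>2"
    using power_mono[OF assms L2_set_nonneg, of n 2] by (simp add: L2_set_power2)
qed simp

lemma L2_set_le_sqrt_suminf:
  assumes "summable (\<lambda>i. (cmod (f i))\<^sup>2)" "finite A"
  shows "L2_set (\<lambda>i. cmod (f i)) A \<le> sqrt (\<Sum>i. (cmod (f i))\<^sup>2)"
  unfolding L2_set_def by (intro real_sqrt_le_mono sum_le_suminf assms) auto

lemma L2_set_cmod_add:
  "L2_set (\<lambda>i. cmod (f i + g i)) A \<le> L2_set (\<lambda>i. cmod (f i)) A + L2_set (\<lambda>i. cmod (g i)) A"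
  by (rule order_trans[OF L2_set_mono L2_set_triangle_ineq]) (auto intro: norm_triangle_ineq)

lemma sq_summable_add:
  assumes "summable (\<lambda>i. (cmod (f i))\<^sup>2)" "summable (\<lambda>i. (cmod (g i))\<^sup>2)"
  shows "summable (\<lambda>i. (cmod (f i + g i))\<^sup>2)"
  by (rule sq_summableI, rule order_trans[OF L2_set_cmod_add],
      rule add_mono[OF L2_set_le_sqrt_suminf L2_set_le_sqrt_suminf]) (use assms in auto)

lemma sq_summable_scale:
  "summable (\<lambda>i. (cmod (f i))\<^sup>2) \<Longrightarrow> summable (\<lambda>i. (cmod (c * f i))\<^sup>2)"
  by (simp add: norm_mult power_mult_distrib summable_mult)

instantiation ell2 :: real_vector
begin

lift_definition zero_ell2 :: ell2 is "\<lambda>_. 0" by simp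
lift_definition plus_ell2 :: "ell2 \<Rightarrow> ell2 \<Rightarrow> ell2" is "\<lambda>x y i. x i + y i"
  by (rule sq_summable_add)
lift_definition uminus_ell2 :: "ell2 \<Rightarrow> ell2" is "\<lambda>x i. - x i" by simp
lift_definition minus_ell2 :: "ell2 \<Rightarrow> ell2 \<Rightarrow> ell2" is "\<lambda>x y i. x i - y i"
  using sq_summable_add[where g = "\<lambda>i. - g i" for g] by simp
lift_definition scaleR_ell2 :: "real \<Rightarrow> ell2 \<Rightarrow> ell2" is "\<lambda>r x i. complex_of_real r * x i"
  by (rule sq_summable_scale)

instance
  by standard (transfer; auto simp: algebra_simps)+

end

instantiation ell2 :: real_normed_vector
begin

definition norm_ell2 :: "ell2 \<Rightarrow> real" where
  "norm (x :: ell2) = sqrt (\<Sum>i. (cmod (ell2_nth x i))\<^sup>2)"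
definition sgn_ell2 :: "ell2 \<Rightarrow> ell2" where
  "sgn (x :: ell2) = x /\<^sub>R norm x"
definition dist_ell2 :: "ell2 \<Rightarrow> ell2 \<Rightarrow> real" where
  "dist (x :: ell2) y = norm (x - y)"
definition uniformity_ell2 :: "(ell2 \<times> ell2) filter" where
  "uniformity = (INF e\<in>{0<..}. principal {(x :: ell2, y). dist x y < e})"
definition open_ell2 :: "ell2 set \<Rightarrow> bool" where
  "open (U :: ell2 set) = (\<forall>x\<in>U. \<forall>\<^sub>F (x', y) in uniformity. x' = x \<longrightarrow> y \<in> U)"

lemma L2_set_le_norm_ell2:
  "finite A \<Longrightarrow> L2_set (\<lambda>i. cmod (ell2_nth x i)) A \<le> norm x"
  unfolding norm_ell2_def by (rule L2_set_le_sqrt_suminf[OF summable_ell2])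

lemma norm_ell2_leI:
  assumes "\<And>n. L2_set (\<lambda>i. cmod (ell2_nth x i)) {..<n} \<le> B"
  shows "norm x \<le> B"
proof -
  have "0 \<le> B" using assms[of 0] by simp
  have "(\<Sum>i. (cmod (ell2_nth x i))\<^sup>2) \<le> B\<^sup>2"
  proof (rule suminf_le_const[OF summable_ell2])
    fix n show "(\<Sum>i<n. (cmod (ell2_nth x i))\<^sup>2) \<le> B\<^sup>2"
      using power_mono[OF assms L2_set_nonneg, of n 2] by (simp add: L2_set_power2)
  qed
  then show ?thesis
    unfolding norm_ell2_def using \<open>0 \<le> B\<close> by (simp add: real_le_lsqrt)
qed

instance
proof
  fix x y :: ell2 and a :: real
  show "norm x = 0 \<longleftrightarrow> x = 0"
    unfolding norm_ell2_def
    by (auto simp: suminf_eq_zero_iff[OF summable_ell2] zero_ell2.rep_eq intro!: ell2_eqI)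
  show "norm (x + y) \<le> norm x + norm y"
    by (rule norm_ell2_leI, unfold plus_ell2.rep_eq, rule order_trans[OF L2_set_cmod_add])
      (intro add_mono L2_set_le_norm_ell2 finite_lessThan)
  show "norm (a *\<^sub>R x) = \<bar>a\<bar> * norm x"
    unfolding norm_ell2_def
    by (simp add: scaleR_ell2.rep_eq norm_mult power_mult_distrib suminf_mult[OF summable_ell2]
        real_sqrt_mult)
qed (rule dist_ell2_def sgn_ell2_def uniformity_ell2_def open_ell2_def)+

end

lemma cmod_ell2_nth_le: "cmod (ell2_nth x i) \<le> norm x"
  using L2_set_le_norm_ell2[of "{i}" x] by simp

instance ell2 :: banach
proof
  fix X :: "nat \<Rightarrow> ell2"
  assume X: "Cauchy X"
  have "Cauchy (\<lambda>n. ell2_nth (X n) i)" for i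
  proof (rule metric_CauchyI)
    fix e :: real assume "0 < e"
    then obtain N where N: "\<And>m n. m \<ge> N \<Longrightarrow> n \<ge> N \<Longrightarrow> dist (X m) (X n) < e"
      using X by (meson metric_CauchyD)
    show "\<exists>N. \<forall>m\<ge>N. \<forall>n\<ge>N. dist (ell2_nth (X m) i) (ell2_nth (X n) i) < e"
      using N cmod_ell2_nth_le[of "X m - X n" i for m n]
      unfolding dist_norm minus_ell2.rep_eq by (meson le_less_trans)
  qed
  then have "\<exists>l. (\<lambda>n. ell2_nth (X n) i) \<longlonglongrightarrow> l" for i
    by (simp add: Cauchy_convergent_iff convergent_def)
  then obtain l where l: "\<And>i. (\<lambda>n. ell2_nth (X n) i) \<longlonglongrightarrow> l i" by metis
  have bound: "\<exists>N. \<forall>m\<ge>N. \<forall>k. L2_set (\<lambda>i. cmod (ell2_nth (X m) i - l i)) {..<k} \<le> e"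
    if e: "0 < e" for e
  proof -
    obtain N where N: "\<And>m n. m \<ge> N \<Longrightarrow> n \<ge> N \<Longrightarrow> dist (X m) (X n) < e"
      using X e by (meson metric_CauchyD)
    show ?thesis
    proof (intro exI[of _ N] allI impI)
      fix m k assume m: "m \<ge> N"
      have lim: "(\<lambda>n. L2_set (\<lambda>i. cmod (ell2_nth (X m) i - ell2_nth (X n) i)) {..<k})
          \<longlonglongrightarrow> L2_set (\<lambda>i. cmod (ell2_nth (X m) i - l i)) {..<k}"
        unfolding L2_set_def by (intro tendsto_intros l)
      have "L2_set (\<lambda>i. cmod (ell2_nth (X m) i - ell2_nth (X n) i)) {..<k} \<le> e" if "n \<ge> N" for n
        using L2_set_le_norm_ell2[of "{..<k}" "X m - X n"] N[OF m that]
        by (simp add: minus_ell2.rep_eq dist_norm)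
      then show "L2_set (\<lambda>i. cmod (ell2_nth (X m) i - l i)) {..<k} \<le> e"
        by (intro LIMSEQ_le_const2[OF lim]) auto
    qed
  qed
  have "summable (\<lambda>i. (cmod (l i))\<^sup>2)"
  proof -
    obtain N where N: "\<And>k. L2_set (\<lambda>i. cmod (ell2_nth (X N) i - l i)) {..<k} \<le> 1"
      using bound[of 1] by auto
    have "summable (\<lambda>i. (cmod (l i - ell2_nth (X N) i))\<^sup>2)"
      using sq_summableI[OF N] by (simp add: norm_minus_commute)
    from sq_summable_add[OF this summable_ell2[of "X N"]] show ?thesis by simp
  qed
  then have L: "ell2_nth (Abs_ell2 l) = l" by (simp add: Abs_ell2_inverse)
  have "X \<longlonglongrightarrow> Abs_ell2 l"
  proof (rule LIMSEQ_I)
    fix e :: real assume "0 < e"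
    then obtain N where
      N: "\<And>m k. m \<ge> N \<Longrightarrow> L2_set (\<lambda>i. cmod (ell2_nth (X m) i - l i)) {..<k} \<le> e / 2"
      using bound[of "e / 2"] by auto
    have "norm (X m - Abs_ell2 l) \<le> e / 2" if "m \<ge> N" for m
      by (rule norm_ell2_leI) (use N[OF that] in \<open>simp add: minus_ell2.rep_eq L\<close>)
    then show "\<exists>N. \<forall>m\<ge>N. norm (X m - Abs_ell2 l) < e"
      using \<open>0 < e\<close> by (intro exI[of _ N]) (auto intro: le_less_trans[of _ "e / 2"])
  qed
  then show "convergent X" by (rule convergentI)
qed

lemma summable_ell2_inner: "summable (\<lambda>i. cnj (ell2_nth x i) * ell2_nth y i)"
proof (rule summable_comparison_test'[where N = 0])
  show "summable (\<lambda>i. (cmod (ell2_nth x i))\<^sup>2 + (cmod (ell2_nth y i))\<^sup>2)"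
    by (intro summable_add summable_ell2)
  fix i
  have "0 \<le> (cmod (ell2_nth x i) - cmod (ell2_nth y i))\<^sup>2" by simp
  moreover have "0 \<le> cmod (ell2_nth x i) * cmod (ell2_nth y i)" by simp
  ultimately have "cmod (ell2_nth x i) * cmod (ell2_nth y i)
      \<le> (cmod (ell2_nth x i))\<^sup>2 + (cmod (ell2_nth y i))\<^sup>2"
    unfolding power2_diff by linarith
  then show "norm (cnj (ell2_nth x i) * ell2_nth y i)
      \<le> (cmod (ell2_nth x i))\<^sup>2 + (cmod (ell2_nth y i))\<^sup>2"
    by (simp add: norm_mult)
qed

instantiation ell2 :: chilbert_space
begin

lift_definition scaleC_ell2 :: "complex \<Rightarrow> ell2 \<Rightarrow> ell2" is "\<lambda>c x i. c * x i"
  by (rule sq_summable_scale)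

definition cinner_ell2 :: "ell2 \<Rightarrow> ell2 \<Rightarrow> complex" where
  "cinner (x :: ell2) y = (\<Sum>i. cnj (ell2_nth x i) * ell2_nth y i)"

instance
proof
  fix x y z :: ell2 and a b :: complex and r :: real
  show "a *\<^sub>C (x + y) = a *\<^sub>C x + a *\<^sub>C y" "(a + b) *\<^sub>C x = a *\<^sub>C x + b *\<^sub>C x"
    "a *\<^sub>C b *\<^sub>C x = (a * b) *\<^sub>C x" "complex_of_real r *\<^sub>C x = r *\<^sub>R x"
    by (transfer; simp add: algebra_simps)+
  show "cinner x y = cnj (cinner y x)"
    unfolding cinner_ell2_def
    using sums_cnj[THEN iffD2, OF summable_sums[OF summable_ell2_inner[of y x]]]
    by (simp add: sums_iff mult.commute)
  show "cinner x (y + z) = cinner x y + cinner x z"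
    unfolding cinner_ell2_def
    by (simp add: plus_ell2.rep_eq ring_distribs suminf_add[OF summable_ell2_inner summable_ell2_inner])
  show "cinner x (a *\<^sub>C y) = a * cinner x y"
    unfolding cinner_ell2_def
    by (simp add: scaleC_ell2.rep_eq mult.left_commute suminf_mult[OF summable_ell2_inner])
  have "cinner x x = (\<Sum>i. complex_of_real ((cmod (ell2_nth x i))\<^sup>2))"
    unfolding cinner_ell2_def by (simp add: complex_norm_square mult.commute del: of_real_power)
  also have "\<dots> = complex_of_real (\<Sum>i. (cmod (ell2_nth x i))\<^sup>2)"
    by (rule suminf_of_real[OF summable_ell2, symmetric])
  finally show "cinner x x = complex_of_real ((norm x)\<^sup>2)"
    by (simp add: norm_ell2_def suminf_nonneg[OF summable_ell2])
qed

end


section \<open>Operator-valued Herglotz functions\<close>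

text \<open>
  Analyticity on the upper half-plane is with respect to the operator norm \<open>onorm\<close>. Functions
  are total on the complex numbers; their values on the real axis are irrelevant throughout.
\<close>

definition operator_Herglotz :: "(complex \<Rightarrow> 'n::chilbert_space \<Rightarrow> 'n) \<Rightarrow> bool" where
  "operator_Herglotz M \<longleftrightarrow>
    (\<forall>z. Im z > 0 \<longrightarrow> bounded_clinear (M z)) \<and>
    (\<forall>z. Im z > 0 \<longrightarrow> (\<exists>D. bounded_clinear D \<and>
      ((\<lambda>w. onorm (\<lambda>x. (1 / (w - z)) *\<^sub>C (M w x - M z x) - D x)) \<longlongrightarrow> 0) (at z))) \<and>
    (\<forall>z. Im z > 0 \<longrightarrow> nonneg_operator (Im_operator (M z))) \<and>
    (\<forall>z. Im z > 0 \<longrightarrow> M (cnj z) = cadjoint (M z))"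

text \<open>
  A positive operator-valued measure on the real line. It need only be finite on bounded sets
  (the total mass of the measures in question is infinite), so bounded operators are assigned to
  the bounded Borel sets only. Countable additivity is in the strong operator topology.
\<close>

definition povm :: "(real set \<Rightarrow> 'n::chilbert_space \<Rightarrow> 'n) \<Rightarrow> bool" where
  "povm \<Omega> \<longleftrightarrow>
    (\<forall>B \<in> sets borel. bounded B \<longrightarrow> bounded_clinear (\<Omega> B) \<and> nonneg_operator (\<Omega> B)) \<and>
    (\<forall>B :: nat \<Rightarrow> real set. range B \<subseteq> sets borel \<longrightarrow> disjoint_family B \<longrightarrow> bounded (\<Union>n. B n) \<longrightarrow>
      (\<forall>\<xi>. (\<lambda>n. \<Omega> (B n) \<xi>) sums \<Omega> (\<Union>n. B n) \<xi>))"

text \<open>The scalar Borel measure \<open>d(\<xi>, \<Omega>(\<lambda>) \<xi>)\<close>, extended from the bounded to all Borel sets.\<close>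

definition povm_scalar :: "(real set \<Rightarrow> 'n::chilbert_space \<Rightarrow> 'n) \<Rightarrow> 'n \<Rightarrow> real measure" where
  "povm_scalar \<Omega> \<xi> = measure_of UNIV (sets borel)
    (\<lambda>B. SUP n. ennreal (Re (cinner \<xi> (\<Omega> (B \<inter> {- real n..real n}) \<xi>))))"

text \<open>
  Integration of scalar functions in the strong operator topology, modelled on
  \<open>has_bochner_integral\<close>: the integrals of simple functions approximating \<open>f\<close> in \<open>L\<^sup>1\<close> with
  respect to all measures \<open>d(\<xi>, \<Omega>(\<lambda>) \<xi>)\<close> converge strongly.
\<close>

definition povm_simple_integral ::
    "(real set \<Rightarrow> 'n::chilbert_space \<Rightarrow> 'n) \<Rightarrow> (real \<Rightarrow> complex) \<Rightarrow> 'n \<Rightarrow> 'n" where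
  "povm_simple_integral \<Omega> s \<xi> = (\<Sum>c \<in> range s - {0}. c *\<^sub>C \<Omega> (s -` {c}) \<xi>)"

definition has_strong_integral ::
    "(real set \<Rightarrow> 'n::chilbert_space \<Rightarrow> 'n) \<Rightarrow> (real \<Rightarrow> complex) \<Rightarrow> ('n \<Rightarrow> 'n) \<Rightarrow> bool" where
  "has_strong_integral \<Omega> f T \<longleftrightarrow> f \<in> borel_measurable borel \<and>
    (\<exists>s :: nat \<Rightarrow> real \<Rightarrow> complex.
      (\<forall>n. simple_function borel (s n) \<and> bounded {x. s n x \<noteq> 0}) \<and>
      (\<forall>\<xi>. (\<lambda>n. \<integral>\<^sup>+x. ennreal (norm (f x - s n x)) \<partial>povm_scalar \<Omega> \<xi>) \<longlonglongrightarrow> 0) \<and>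
      (\<forall>\<xi>. (\<lambda>n. povm_simple_integral \<Omega> (s n) \<xi>) \<longlonglongrightarrow> T \<xi>))"

definition povm_support :: "(real set \<Rightarrow> 'n::chilbert_space \<Rightarrow> 'n) \<Rightarrow> real set" where
  "povm_support \<Omega> = {x. \<forall>e>0. \<Omega> {x - e<..<x + e} \<noteq> (\<lambda>\<xi>. 0)}"

text \<open>The second conjunct states that the measure \<open>(1 + \<lambda>\<^sup>2)\<^sup>-\<^sup>1 d\<Omega>(\<lambda>)\<close> has total mass \<open>I\<close>.\<close>

definition N0_representation ::
    "(real set \<Rightarrow> 'n::chilbert_space \<Rightarrow> 'n) \<Rightarrow> (complex \<Rightarrow> 'n \<Rightarrow> 'n) \<Rightarrow> bool" where
  "N0_representation \<Omega> M \<longleftrightarrow>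
    povm \<Omega> \<and>
    has_strong_integral \<Omega> (\<lambda>x. complex_of_real (1 / (1 + x\<^sup>2))) (\<lambda>\<xi>. \<xi>) \<and>
    (\<forall>\<xi>. \<xi> \<noteq> 0 \<longrightarrow> (\<integral>\<^sup>+x. 1 \<partial>povm_scalar \<Omega> \<xi>) = \<infinity>) \<and>
    (\<forall>z. Im z > 0 \<longrightarrow> has_strong_integral \<Omega>
      (\<lambda>x. 1 / (complex_of_real x - z) - complex_of_real (x / (1 + x\<^sup>2))) (M z))"

definition N0 :: "(complex \<Rightarrow> 'n::chilbert_space \<Rightarrow> 'n) set" where
  "N0 = {M. operator_Herglotz M \<and> (\<exists>\<Omega>. N0_representation \<Omega> M)}"

text \<open>
  The representing measure is unique by the Stieltjes inversion formula, so it does not matter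
  that it is quantified afresh in each class. In \<open>N0K\<close> note that \<open>inverse 0 = \<infinity>\<close> in \<open>ennreal\<close>.
\<close>

definition N0F :: "(complex \<Rightarrow> 'n::chilbert_space \<Rightarrow> 'n) set" where
  "N0F = {M \<in> N0. \<exists>\<Omega>. N0_representation \<Omega> M \<and> povm_support \<Omega> \<subseteq> {0..} \<and>
    (\<forall>\<xi>. \<xi> \<noteq> 0 \<longrightarrow> (\<exists>R>0. (\<integral>\<^sup>+x\<in>{R..}. inverse (ennreal x) \<partial>povm_scalar \<Omega> \<xi>) = \<infinity>))}"

definition N0K :: "(complex \<Rightarrow> 'n::chilbert_space \<Rightarrow> 'n) set" where
  "N0K = {M \<in> N0. \<exists>\<Omega>. N0_representation \<Omega> M \<and> povm_support \<Omega> \<subseteq> {0..} \<and>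
    (\<forall>\<xi>. \<xi> \<noteq> 0 \<longrightarrow> (\<exists>R>0. (\<integral>\<^sup>+x\<in>{0..R}. inverse (ennreal x) \<partial>povm_scalar \<Omega> \<xi>) = \<infinity>))}"

definition N0FK :: "(complex \<Rightarrow> 'n::chilbert_space \<Rightarrow> 'n) set" where
  "N0FK = N0F \<inter> N0K"


section \<open>Unbounded operators\<close>

text \<open>
  \<open>S\<close> is the underlying Hilbert space, a closed subspace of the ambient type, and an operator in
  \<open>S\<close> is identified with its graph. So \<open>A \<subseteq> B\<close> says that \<open>B\<close> extends \<open>A\<close>, and \<open>A\<close> is a closed
  operator iff \<open>closed A\<close>.
\<close>

definition hilbert_subspace :: "'h::chilbert_space set \<Rightarrow> bool" where
  "hilbert_subspace S \<longleftrightarrow> csubspace S \<and> closed S"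

definition operator_in :: "'h::chilbert_space set \<Rightarrow> 'h rel \<Rightarrow> bool" where
  "operator_in S A \<longleftrightarrow> A \<subseteq> S \<times> S \<and> single_valued A \<and> (0, 0) \<in> A \<and>
    (\<forall>f g u v. (f, g) \<in> A \<longrightarrow> (u, v) \<in> A \<longrightarrow> (f + u, g + v) \<in> A) \<and>
    (\<forall>c f g. (f, g) \<in> A \<longrightarrow> (c *\<^sub>C f, c *\<^sub>C g) \<in> A)"

definition op_apply :: "'h rel \<Rightarrow> 'h \<Rightarrow> 'h" where
  "op_apply A f = (THE g. (f, g) \<in> A)"

definition densely_defined :: "'h::chilbert_space set \<Rightarrow> 'h rel \<Rightarrow> bool" where
  "densely_defined S A \<longleftrightarrow> S \<subseteq> closure (Domain A)"

definition op_adjoint :: "'h::chilbert_space set \<Rightarrow> 'h rel \<Rightarrow> 'h rel" where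
  "op_adjoint S A = {(f, g). f \<in> S \<and> g \<in> S \<and> (\<forall>(u, v) \<in> A. cinner f v = cinner g u)}"

definition dd_closed_symmetric :: "'h::chilbert_space set \<Rightarrow> 'h rel \<Rightarrow> bool" where
  "dd_closed_symmetric S A \<longleftrightarrow>
    operator_in S A \<and> densely_defined S A \<and> closed A \<and> A \<subseteq> op_adjoint S A"

definition self_adjoint :: "'h::chilbert_space set \<Rightarrow> 'h rel \<Rightarrow> bool" where
  "self_adjoint S A \<longleftrightarrow> operator_in S A \<and> densely_defined S A \<and> A = op_adjoint S A"

definition nonneg_op :: "'h::chilbert_space rel \<Rightarrow> bool" where
  "nonneg_op A \<longleftrightarrow> (\<forall>(f, g) \<in> A. cinner f g \<in> \<real>\<^sub>\<ge>\<^sub>0)"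

definition deficiency_plus :: "'h::chilbert_space set \<Rightarrow> 'h rel \<Rightarrow> 'h set" where
  "deficiency_plus S A = {f. (f, \<i> *\<^sub>C f) \<in> op_adjoint S A}"

text \<open>\<open>(A - z)\<^sup>-\<^sup>1 x\<close>\<close>

definition op_resolvent :: "'h::chilbert_space rel \<Rightarrow> complex \<Rightarrow> 'h \<Rightarrow> 'h" where
  "op_resolvent A z x = (THE f. \<exists>g. (f, g) \<in> A \<and> g - z *\<^sub>C f = x)"

definition form_Cauchy :: "'h::chilbert_space rel \<Rightarrow> (nat \<Rightarrow> 'h) \<Rightarrow> bool" where
  "form_Cauchy A fn \<longleftrightarrow>
    ((\<lambda>(m, n). cinner (fn n - fn m) (op_apply A (fn n - fn m))) \<longlongrightarrow> 0)
      (sequentially \<times>\<^sub>F sequentially)"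

definition Friedrichs_form_domain :: "'h::chilbert_space set \<Rightarrow> 'h rel \<Rightarrow> 'h set" where
  "Friedrichs_form_domain S A =
    {f \<in> S. \<exists>fn. range fn \<subseteq> Domain A \<and> fn \<longlonglongrightarrow> f \<and> form_Cauchy A fn}"

definition Friedrichs_extension :: "'h::chilbert_space set \<Rightarrow> 'h rel \<Rightarrow> 'h rel" where
  "Friedrichs_extension S A = {(f, g) \<in> op_adjoint S A. f \<in> Friedrichs_form_domain S A}"

definition Krein_extension :: "'h::chilbert_space set \<Rightarrow> 'h rel \<Rightarrow> 'h rel" where
  "Krein_extension S A = {(f, g) \<in> op_adjoint S A.
    \<exists>fn. range fn \<subseteq> Domain A \<and> (\<lambda>n. op_apply A (fn n)) \<longlonglongrightarrow> g \<and> form_Cauchy A fn}"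

text \<open>The function \<open>V\<^sup>* (z I + (1 + z\<^sup>2) P (H - z)\<^sup>-\<^sup>1 P) V\<close>, with \<open>P\<close> the orthogonal projection onto \<open>K\<close>.\<close>

definition Herglotz_realization ::
    "'h::chilbert_space rel \<Rightarrow> 'h set \<Rightarrow> ('n::chilbert_space \<Rightarrow> 'h) \<Rightarrow> complex \<Rightarrow> 'n \<Rightarrow> 'n" where
  "Herglotz_realization H K V z = (\<lambda>\<xi>. cadjoint V
    (z *\<^sub>C V \<xi> + (1 + z\<^sup>2) *\<^sub>C orth_proj K (op_resolvent H z (orth_proj K (V \<xi>)))))"

end

theory Submission
  imports Defs "HOL-Real_Asymp.Real_Asymp"
begin

text \<open>
  With \<open>d\<Omega>\<^sub>\<xi>(\<lambda>) = d(\<xi>, \<Omega>(\<lambda>) \<xi>)\<close>, the functions \<open>\<xi> / (\<lambda> - z)\<close> for \<open>\<xi> \<in> \<N>\<close> and nonreal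
  \<open>z\<close> span a dense subspace of \<open>L\<^sup>2(\<Omega>)\<close>. Their Gram kernel is positive definite because
  it is a limit of Riemann sums, and a Cholesky decomposition of this kernel along a countable dense
  set realizes them as vectors \<open>\<gamma>(z) \<xi>\<close> of \<open>ell2\<close>. Multiplication by \<open>\<lambda>\<close> is the closure
  \<open>H\<close> of the operator sending \<open>\<gamma>(z) \<xi> - \<gamma>(w) \<xi>\<close> to \<open>z \<gamma>(z) \<xi> - w \<gamma>(w) \<xi>\<close>; it is self-adjoint, and
  \<open>(H - z)\<^sup>-\<^sup>1 \<gamma>(\<i>) \<xi> = (\<gamma>(z) \<xi> - \<gamma>(\<i>) \<xi>) / (z - \<i>)\<close> yields the realization of \<open>M\<close> with \<open>V = \<gamma>(\<i>)\<close>. The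
  symmetric operator is the restriction of \<open>H\<close> with \<open>ran (Hdot + \<i>) = (ran V)\<^sup>\<bottom>\<close>. It is densely
  defined because \<open>ran V\<close> meets the domain of \<open>H\<close> only in \<open>0\<close>, as \<open>\<Omega>\<^sub>\<xi>\<close> has infinite mass.

  If \<open>Hdot\<close> is not dense in \<open>H\<close> for the form norm, then the orthogonal complement contains a
  vector of \<open>ker (Hdot\<^sup>* + 1)\<close>, which puts some \<open>V \<xi> \<noteq> 0\<close> into the form domain of
  \<open>H\<close> (for the Krein extension: into the range of \<open>H\<^sup>1\<^sup>/\<^sup>2\<close>); this would bound
  \<open>y\<^sup>2 Re (V \<xi>, (H - \<i> y)\<^sup>-\<^sup>1 V \<xi>)\<close> as \<open>y \<rightarrow> \<infinity>\<close> (for Krein: \<open>(Re + Im) (V \<xi>, (H - \<i> y)\<^sup>-\<^sup>1 V \<xi>)\<close>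
  as \<open>y \<rightarrow> 0\<close>), contradicting the divergence of the integral of \<open>\<lambda>\<^sup>-\<^sup>1 d\<Omega>\<^sub>\<xi>\<close>. Both quantities
  are functions of \<open>M\<close> alone. For the uniqueness, the variational principle for
  \<open>(H' + 1)\<^sup>-\<^sup>1\<close> sandwiches each nonnegative extension between the Krein and the Friedrichs extension.
\<close>

section \<open>Hilbert space preliminaries\<close>

text \<open>An operator-valued measure yields honest scalar measures only on the diagonal, and the
  Hilbert space has to live inside \<open>ell2\<close>. So vectors of L^2 are never built as
  functions: sesquilinear integrals are obtained by polarizing Riemann sums, only inner products of
  simple poles are computed, and vectors are recovered from their Gram kernel. Poles fit because a
  product of two decays like 1/(1 + t^2), the weight whose total mass is I.

  Spectral theorem and square roots are avoided as well. \<open>V \<xi>\<close> stands for \<xi>/(t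
  - i), which lies in the domain of multiplication by t iff t^2/(1 + t^2) is integrable, hence iff
  the mass is finite. This and the two divergence conditions are read off from the resolvent on the
  imaginary axis: Fatou's lemma links it to the integrals, elementary bounds link it to domains and
  forms.

  The conditions are phrased through M because \<open>N0F\<close> and \<open>N0K\<close> each bring
  their own measure; in the combined case a condition proved with one measure is then available in
  the model of the other.\<close>

lemma cinner_add_left: "cinner (x + y) z = cinner x z + cinner y z"
  by (metis cinner_commute cinner_add_right complex_cnj_add)

lemma cinner_scaleC_left: "cinner (a *\<^sub>C x) y = cnj a * cinner x y"
  by (metis cinner_commute cinner_scaleC_right complex_cnj_mult)

lemma cinner_scaleR_right: "cinner x (r *\<^sub>R y) = r *\<^sub>R cinner x y"
  by (simp add: scaleC_of_real[symmetric] cinner_scaleC_right scaleR_conv_of_real)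

lemma cinner_scaleR_left: "cinner (r *\<^sub>R x) y = r *\<^sub>R cinner x y"
  by (simp add: scaleC_of_real[symmetric] cinner_scaleC_left scaleR_conv_of_real)

lemma norm_scaleC: "norm (a *\<^sub>C x) = cmod a * norm x"
proof -
  have "complex_of_real ((norm (a *\<^sub>C x))\<^sup>2) = complex_of_real ((cmod a * norm x)\<^sup>2)"
    by (simp add: cinner_self[symmetric] cinner_scaleC_right cinner_scaleC_left power_mult_distrib
        complex_norm_square del: of_real_power)
  then have "(norm (a *\<^sub>C x))\<^sup>2 = (cmod a * norm x)\<^sup>2" unfolding of_real_eq_iff .
  then show ?thesis by (simp add: power2_eq_iff_nonneg)
qed

lemma cinner_norm_le: "cmod (cinner x y) \<le> norm x * norm y"
proof (cases "y = 0")
  case True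
  have "cinner x (0 *\<^sub>R y) = 0" unfolding cinner_scaleR_right by simp
  with True show ?thesis by (simp add: scaleR_zero_left)
next
  case False
  define t where "t = cinner y x / complex_of_real ((norm y)\<^sup>2)"
  define n where "n = (norm y)\<^sup>2"
  have n: "n > 0" using False by (simp add: n_def)
  have c: "cinner x y = cnj (cinner y x)" by (rule cinner_commute)
  have "cinner (x + (- t) *\<^sub>C y) (x + (- t) *\<^sub>C y)
      = cinner x x - t * cinner x y - cnj t * cinner y x + cnj t * t * cinner y y"
    by (simp add: cinner_add_left cinner_add_right cinner_scaleC_left cinner_scaleC_right algebra_simps)
  also have "\<dots> = cinner x x - cinner y x * cnj (cinner y x) / n"
    using n by (simp add: t_def c cinner_self n_def[symmetric] field_simps)
  also have "\<dots> = complex_of_real ((norm x)\<^sup>2 - (cmod (cinner y x))\<^sup>2 / n)"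
    by (simp add: cinner_self complex_norm_square[symmetric])
  finally have "(norm (x + (- t) *\<^sub>C y))\<^sup>2 = (norm x)\<^sup>2 - (cmod (cinner y x))\<^sup>2 / n"
    unfolding cinner_self of_real_eq_iff .
  then have "(cmod (cinner y x))\<^sup>2 / n \<le> (norm x)\<^sup>2"
    using zero_le_power2[of "norm (x + (- t) *\<^sub>C y)"] by linarith
  then have "(cmod (cinner y x))\<^sup>2 \<le> (norm x * norm y)\<^sup>2"
    using n by (simp add: n_def field_simps power_mult_distrib)
  then have "cmod (cinner y x) \<le> norm x * norm y"
    by (rule power2_le_imp_le) simp
  then show ?thesis by (simp add: c)
qed

text \<open>Real bilinearity covers the antilinear first argument too: limits, continuity and the
  rules for differences and sums are all inherited from it.\<close>

interpretation cinner: bounded_bilinear "cinner :: 'a::chilbert_space \<Rightarrow> 'a \<Rightarrow> complex"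
  by standard (auto simp: cinner_add_left cinner_add_right cinner_scaleR_left cinner_scaleR_right
      intro!: exI[of _ 1] cinner_norm_le)

interpretation scaleC: bounded_bilinear "scaleC :: complex \<Rightarrow> 'a::chilbert_space \<Rightarrow> 'a"
proof
  show "(r *\<^sub>R a) *\<^sub>C b = r *\<^sub>R a *\<^sub>C b" for r a and b :: 'a
    by (simp add: scaleC_of_real[symmetric] scaleC_scaleC scaleR_conv_of_real)
  show "a *\<^sub>C r *\<^sub>R b = r *\<^sub>R a *\<^sub>C b" for r a and b :: 'a
    by (simp add: scaleC_of_real[symmetric] scaleC_scaleC mult.commute)
  show "\<exists>K. \<forall>a (b::'a). norm (a *\<^sub>C b) \<le> norm a * norm b * K"
    by (rule exI[of _ 1]) (simp add: norm_scaleC)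
qed (simp_all add: scaleC_add_left scaleC_add_right)

lemma scaleC_one [simp]: "1 *\<^sub>C x = x"
  using scaleC_of_real[of 1 x] by simp

lemma scaleC_minus_one: "(- 1) *\<^sub>C x = - x"
  by (simp add: scaleC.minus_left)

lemma cinner_eq_zero_iff [simp]: "cinner x x = 0 \<longleftrightarrow> x = 0"
  by (simp add: cinner_self)

lemma cinner_eqI:
  assumes "\<And>u. cinner u x = cinner u y"
  shows "x = y"
proof -
  have "cinner (x - y) (x - y) = 0" using assms[of "x - y"] by (simp add: cinner.diff_right)
  then show ?thesis by simp
qed

lemma Re_cinner_commute: "Re (cinner x y) = Re (cinner y x)"
  by (subst cinner_commute) simp

lemma Re_cinner_self: "Re (cinner x x) = (norm x)\<^sup>2"
  by (simp add: cinner_self)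

lemma cinner_orth_sym: "cinner x y = 0 \<longleftrightarrow> cinner y x = 0"
  by (metis cinner_commute complex_cnj_zero)

lemma tendsto_cinner:
  "(f \<longlongrightarrow> x) F \<Longrightarrow> (g \<longlongrightarrow> y) F \<Longrightarrow> ((\<lambda>n. cinner (f n) (g n)) \<longlongrightarrow> cinner x y) F"
  by (rule cinner.tendsto)

lemma norm_diff_sq: "(norm (x - y))\<^sup>2 = (norm x)\<^sup>2 - 2 * Re (cinner x y) + (norm y)\<^sup>2"
  using Re_cinner_self[of "x - y"] Re_cinner_commute[of x y]
  by (simp add: cinner.diff_left cinner.diff_right Re_cinner_self)

lemma csubspace_imp_subspace: "csubspace K \<Longrightarrow> subspace K"
  unfolding csubspace_def subspace_def by (metis scaleC_of_real)

lemma csubspace_diff: "csubspace K \<Longrightarrow> x \<in> K \<Longrightarrow> y \<in> K \<Longrightarrow> x - y \<in> K"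
  using csubspace_imp_subspace subspace_diff by blast

lemma csubspace_add: "csubspace K \<Longrightarrow> x \<in> K \<Longrightarrow> y \<in> K \<Longrightarrow> x + y \<in> K"
  by (simp add: csubspace_def)

lemma csubspace_scale: "csubspace K \<Longrightarrow> x \<in> K \<Longrightarrow> c *\<^sub>C x \<in> K"
  by (simp add: csubspace_def)

lemma csubspace_closure:
  assumes K: "csubspace K" shows "csubspace (closure K)"
  unfolding csubspace_def
proof (intro conjI ballI allI)
  show "0 \<in> closure K" using K closure_subset by (auto simp: csubspace_def)
  show "x + y \<in> closure K" if xy: "x \<in> closure K" "y \<in> closure K" for x y
  proof -
    from xy obtain f g where "\<forall>n. f n \<in> K" "f \<longlonglongrightarrow> x" "\<forall>n. g n \<in> K" "g \<longlonglongrightarrow> y"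
      unfolding closure_sequential by blast
    then have "\<forall>n. f n + g n \<in> K" "(\<lambda>n. f n + g n) \<longlonglongrightarrow> x + y"
      using csubspace_add[OF K] by (auto intro: tendsto_add)
    then show ?thesis unfolding closure_sequential by (intro exI conjI)
  qed
  show "c *\<^sub>C x \<in> closure K" if x: "x \<in> closure K" for c x
  proof -
    from x obtain f where "\<forall>n. f n \<in> K" "f \<longlonglongrightarrow> x" unfolding closure_sequential by blast
    then have "\<forall>n. c *\<^sub>C f n \<in> K" "(\<lambda>n. c *\<^sub>C f n) \<longlonglongrightarrow> c *\<^sub>C x"
      using csubspace_scale[OF K] scaleC.tendsto[OF tendsto_const] by auto
    then show ?thesis unfolding closure_sequential by (intro exI conjI)
  qed
qed

text \<open>The quadratic polynomial in t given by the form at x + t y never becomes negative. The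
  form may be degenerate, and its symmetry and positivity are required only on L, since it is later
  a form on the graph of an operator.\<close>

lemma semi_Cauchy_Schwarz:
  fixes b :: "'a::real_vector \<Rightarrow> 'a \<Rightarrow> real"
  assumes L: "subspace L" "x \<in> L" "y \<in> L"
    and add: "\<And>x y z. x \<in> L \<Longrightarrow> y \<in> L \<Longrightarrow> z \<in> L \<Longrightarrow> b (x + y) z = b x z + b y z"
    and scale: "\<And>r x y. x \<in> L \<Longrightarrow> y \<in> L \<Longrightarrow> b (r *\<^sub>R x) y = r * b x y"
    and sym: "\<And>x y. x \<in> L \<Longrightarrow> y \<in> L \<Longrightarrow> b x y = b y x"
    and pos: "\<And>x. x \<in> L \<Longrightarrow> 0 \<le> b x x"
  shows "(b x y)\<^sup>2 \<le> b x x * b y y"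
proof -
  have "0 \<le> b x x + 2 * t * b x y + t\<^sup>2 * b y y" for t
  proof -
    have ty: "t *\<^sub>R y \<in> L" using L by (simp add: subspace_scale)
    then have m: "x + t *\<^sub>R y \<in> L" using L by (simp add: subspace_add)
    have "b (x + t *\<^sub>R y) (x + t *\<^sub>R y) = b x x + 2 * t * b x y + t\<^sup>2 * b y y"
      using add[OF L(2) ty m] sym[OF L(2) m] sym[OF ty m] add[OF L(2) ty L(2)] add[OF L(2) ty ty]
        sym[OF L(2) ty] scale[OF L(3) L(2), of t] scale[OF L(3) ty, of t] scale[OF L(3) L(3), of t]
        sym[OF L(3) ty] sym[OF L(2) L(3)]
      by (simp add: power2_eq_square algebra_simps)
    with pos[OF m] show ?thesis by simp
  qed
  note h = this
  show ?thesis
  proof (cases "b y y = 0")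
    case True
    have "b x y = 0"
    proof (rule ccontr)
      assume "b x y \<noteq> 0"
      \<comment> \<open>At this t the expression, which is affine in t, equals -1.\<close>
      with h[of "- (b x x + 1) / (2 * b x y)"] True show False by (simp add: field_simps)
    qed
    then show ?thesis using True by simp
  next
    case False
    with pos[OF L(3)] have p: "b y y > 0" by simp
    from h[of "- b x y / b y y"] p show ?thesis
      by (simp add: field_simps power2_eq_square)
  qed
qed

text \<open>The proof minimises the functional \<open>b x x - 2 * l x\<close>.\<close>

lemma semi_Riesz:
  fixes b :: "'a::real_vector \<Rightarrow> 'a \<Rightarrow> real" and l :: "'a \<Rightarrow> real"
  assumes L: "subspace L"
    and add: "\<And>x y z. x \<in> L \<Longrightarrow> y \<in> L \<Longrightarrow> z \<in> L \<Longrightarrow> b (x + y) z = b x z + b y z"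
    and scale: "\<And>r x y. x \<in> L \<Longrightarrow> y \<in> L \<Longrightarrow> b (r *\<^sub>R x) y = r * b x y"
    and sym: "\<And>x y. x \<in> L \<Longrightarrow> y \<in> L \<Longrightarrow> b x y = b y x"
    and pos: "\<And>x. x \<in> L \<Longrightarrow> 0 \<le> b x x"
    and ladd: "\<And>x y. x \<in> L \<Longrightarrow> y \<in> L \<Longrightarrow> l (x + y) = l x + l y"
    and lscale: "\<And>r x. x \<in> L \<Longrightarrow> l (r *\<^sub>R x) = r * l x"
    and bound: "\<And>x. x \<in> L \<Longrightarrow> (l x)\<^sup>2 \<le> C * b x x" and C: "C \<ge> 0"
  obtains f where "\<And>n. f n \<in> L"
    "\<And>e. e > 0 \<Longrightarrow> \<exists>N. \<forall>m\<ge>N. \<forall>n\<ge>N. b (f n - f m) (f n - f m) < e"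
    "\<And>x. x \<in> L \<Longrightarrow> (\<lambda>n. b (f n) x) \<longlonglongrightarrow> l x"
proof -
  define J where "J x = b x x - 2 * l x" for x
  have Jb: "- C \<le> J x" if x: "x \<in> L" for x
  proof -
    \<comment> \<open>AM-GM: twice the square root of C b(x, x) is at most C + b(x, x), so J is
      bounded below by -C.\<close>
    have "0 \<le> (C - b x x)\<^sup>2" by simp
    then have "4 * (C * b x x) \<le> (C + b x x)\<^sup>2" by (simp add: power2_eq_square algebra_simps)
    with bound[OF x] have "(2 * l x)\<^sup>2 \<le> (C + b x x)\<^sup>2" by (simp add: power_mult_distrib)
    then have "\<bar>2 * l x\<bar> \<le> \<bar>C + b x x\<bar>" by (simp add: abs_le_square_iff)
    then show ?thesis using C pos[OF x] by (simp add: J_def)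
  qed
  define m where "m = Inf (J ` L)"
  have ne: "J ` L \<noteq> {}" using subspace_0[OF L] by auto
  have bdd: "bdd_below (J ` L)" using Jb by (auto intro: bdd_belowI[of _ "- C"])
  have mle: "m \<le> J x" if "x \<in> L" for x
    unfolding m_def using that bdd by (auto intro: cInf_lower)
  have "\<exists>x\<in>L. J x < m + inverse (real (Suc n))" for n
  proof -
    have "Inf (J ` L) < m + inverse (real (Suc n))" unfolding m_def by simp
    then show ?thesis using cInf_less_iff[OF ne bdd] by auto
  qed
  \<comment> \<open>L carries no completeness for b, so a minimizer may be missing; the minimizing
    sequence itself is the result.\<close>
  then obtain f where f: "\<And>n. f n \<in> L" "\<And>n. J (f n) < m + inverse (real (Suc n))" by metis
  have exp: "J (x + t *\<^sub>R y) = J x + 2 * t * (b x y - l y) + t\<^sup>2 * b y y"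
    if x: "x \<in> L" and y: "y \<in> L" for x y t
  proof -
    have ty: "t *\<^sub>R y \<in> L" using L y by (simp add: subspace_scale)
    then have mm: "x + t *\<^sub>R y \<in> L" using L x by (simp add: subspace_add)
    have "b (x + t *\<^sub>R y) (x + t *\<^sub>R y) = b x x + 2 * t * b x y + t\<^sup>2 * b y y"
      using add[OF x ty mm] sym[OF x mm] sym[OF ty mm] add[OF x ty x] add[OF x ty ty]
        sym[OF x ty] scale[OF y x, of t] scale[OF y ty, of t] scale[OF y y, of t]
        sym[OF y ty] sym[OF x y]
      by (simp add: power2_eq_square algebra_simps)
    then show ?thesis
      by (simp add: J_def ladd[OF x ty] lscale[OF y] algebra_simps)
  qed
  \<comment> \<open>Parallelogram law: J is at least m at the midpoint, and b(f k - f n, f k - f n)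
    = 2 J(f n) + 2 J(f k) - 4 J(midpoint).\<close>
  have cau: "b (f n - f k) (f n - f k) \<le> 2 * inverse (real (Suc n)) + 2 * inverse (real (Suc k))" for n k
  proof -
    have d: "f k - f n \<in> L" "f n - f k \<in> L" using f L by (auto simp: subspace_diff)
    have "b (f n - f k) (f n - f k) = b (f k - f n) (f k - f n)"
      using scale[OF d(1) d(1), of "-1"] scale[OF d(1) d(2), of "-1"] sym[OF d(1) d(2)] by simp
    moreover have "f n + (1/2) *\<^sub>R (f k - f n) \<in> L"
      using L d f by (simp add: subspace_add subspace_scale)
    then have "m \<le> J (f n + (1/2) *\<^sub>R (f k - f n))" by (rule mle)
    moreover have "f n + 1 *\<^sub>R (f k - f n) = f k" by simp
    then have "J (f k) = J (f n + 1 *\<^sub>R (f k - f n))" by simp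
    ultimately show ?thesis using f(2)[of n] f(2)[of k] exp[OF f(1) d(1), of n "1/2"] exp[OF f(1) d(1), of n "1"]
      by (simp add: power2_eq_square)
  qed
  have lim: "(\<lambda>n. b (f n) x) \<longlonglongrightarrow> l x" if x: "x \<in> L" for x
  proof -
    have le: "(b (f n) x - l x)\<^sup>2 \<le> inverse (real (Suc n)) * (b x x + 1)" for n
    proof -
      \<comment> \<open>A step t = -a/p in direction x lowers J by at least a^2/p, so a must be
        small; the summand 1 keeps p positive where b degenerates.\<close>
      define p where "p = b x x + 1"
      define a where "a = b (f n) x - l x"
      have p: "p > 0" "b x x \<le> p" using pos[OF x] by (auto simp: p_def)
      define t where "t = - a / p"
      have "f n + t *\<^sub>R x \<in> L" using L x f by (simp add: subspace_add subspace_scale)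
      then have "m \<le> J (f n) + 2 * t * a + t\<^sup>2 * b x x"
        using mle[of "f n + t *\<^sub>R x"] exp[OF f(1) x, of n t] by (simp add: a_def)
      also have "\<dots> \<le> J (f n) + 2 * t * a + t\<^sup>2 * p" using p by (simp add: mult_left_mono)
      also have "\<dots> = J (f n) - a\<^sup>2 / p" using p by (simp add: t_def power2_eq_square field_simps)
      finally have "a\<^sup>2 / p \<le> inverse (real (Suc n))" using f(2)[of n] by linarith
      then show ?thesis using p by (simp add: a_def p_def field_simps)
    qed
    have "(\<lambda>n. (b (f n) x - l x)\<^sup>2) \<longlonglongrightarrow> 0"
    proof (rule tendsto_sandwich[OF _ _ tendsto_const])
      show "(\<lambda>n. inverse (real (Suc n)) * (b x x + 1)) \<longlonglongrightarrow> 0"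
        using tendsto_mult_right[OF LIMSEQ_inverse_real_of_nat] by simp
    qed (use le in auto)
    then have "(\<lambda>n. b (f n) x - l x) \<longlonglongrightarrow> 0" by simp
    then show ?thesis by (simp add: LIM_zero_iff)
  qed
  have "\<exists>N. \<forall>m\<ge>N. \<forall>n\<ge>N. b (f n - f m) (f n - f m) < e" if e: "e > 0" for e
  proof -
    obtain N where N: "inverse (real (Suc N)) < e / 4" using reals_Archimedean[of "e/4"] e by auto
    have s: "inverse (real (Suc n)) < e / 4" if "n \<ge> N" for n
    proof -
      have "inverse (real (Suc n)) \<le> inverse (real (Suc N))"
        using that by (intro le_imp_inverse_le) auto
      then show ?thesis using N by linarith
    qed
    have "b (f n - f k) (f n - f k) < e" if "k \<ge> N" "n \<ge> N" for n k
      using cau[of n k] s[OF that(1)] s[OF that(2)] by linarith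
    then show ?thesis by blast
  qed
  then show ?thesis using that f(1) lim by blast
qed

lemma Cauchy_norm_sqI:
  fixes f :: "nat \<Rightarrow> 'a::real_normed_vector"
  assumes "\<And>e. e > 0 \<Longrightarrow> \<exists>N. \<forall>m\<ge>N. \<forall>n\<ge>N. (norm (f n - f m))\<^sup>2 < e"
  shows "Cauchy f"
proof (rule metric_CauchyI)
  fix e :: real assume e: "e > 0"
  then obtain N where N: "\<forall>m\<ge>N. \<forall>n\<ge>N. (norm (f n - f m))\<^sup>2 < e\<^sup>2" using assms[of "e\<^sup>2"] by auto
  have "dist (f m) (f n) < e" if "m \<ge> N" "n \<ge> N" for m n
    using N that e power_less_imp_less_base[of "norm (f m - f n)" 2 e] by (simp add: dist_norm)
  then show "\<exists>M. \<forall>m\<ge>M. \<forall>n\<ge>M. dist (f m) (f n) < e" by blast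
qed

text \<open>Replacing k by i k turns imaginary parts into real ones. This leads back from the
  real-valued minimization to complex inner products.\<close>

lemma csubspace_eqI_Re:
  assumes K: "csubspace K" and R: "\<And>k. k \<in> K \<Longrightarrow> Re (cinner k x) = Re (cinner k y)" and k: "k \<in> K"
  shows "cinner k x = cinner k y"
proof (rule complex_eqI)
  show "Im (cinner k x) = Im (cinner k y)"
    using R[OF csubspace_scale[OF K k, of \<i>]] by (simp add: cinner_scaleC_left)
qed (rule R[OF k])

text \<open>The projection represents the functional Re (x, k) on K. The minimizing sequence is
  Cauchy in norm, hence converges in the complete ambient space, and its limit stays in the closed
  set K.\<close>

lemma projection_exists:
  assumes K: "csubspace K" "closed K"
  obtains p where "p \<in> K" "\<And>k. k \<in> K \<Longrightarrow> cinner k (x - p) = 0"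
proof -
  have C: "(Re (cinner x k))\<^sup>2 \<le> (norm x)\<^sup>2 * Re (cinner k k)" for k
  proof -
    have "\<bar>Re (cinner x k)\<bar> \<le> norm x * norm k"
      using abs_Re_le_cmod[of "cinner x k"] cinner_norm_le[of x k] by linarith
    then have "\<bar>Re (cinner x k)\<bar>\<^sup>2 \<le> (norm x * norm k)\<^sup>2" by (rule power_mono) simp
    then show ?thesis by (simp add: power_mult_distrib Re_cinner_self)
  qed
  obtain f where f: "\<And>n. f n \<in> K"
    and cau: "\<And>e. e > 0 \<Longrightarrow> \<exists>N. \<forall>m\<ge>N. \<forall>n\<ge>N. Re (cinner (f n - f m) (f n - f m)) < e"
    and lim: "\<And>k. k \<in> K \<Longrightarrow> (\<lambda>n. Re (cinner (f n) k)) \<longlonglongrightarrow> Re (cinner x k)"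
    by (rule semi_Riesz[where L = K and b = "\<lambda>x y. Re (cinner x y)" and l = "\<lambda>k. Re (cinner x k)"
          and C = "(norm x)\<^sup>2"])
      (use csubspace_imp_subspace[OF K(1)] C in \<open>auto simp: cinner_add_left cinner_add_right cinner_scaleR_left
        cinner_scaleR_right Re_cinner_self intro: Re_cinner_commute\<close>)
  have "Cauchy f" by (rule Cauchy_norm_sqI) (use cau in \<open>simp add: Re_cinner_self\<close>)
  then obtain p where p: "f \<longlonglongrightarrow> p" using convergent_def convergent_eq_Cauchy by blast
  have pK: "p \<in> K" using closed_sequentially[OF K(2) f p] .
  have "Re (cinner k p) = Re (cinner k x)" if k: "k \<in> K" for k
  proof -
    have "(\<lambda>n. Re (cinner (f n) k)) \<longlonglongrightarrow> Re (cinner p k)"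
      by (intro tendsto_Re tendsto_cinner p tendsto_const)
    with lim[OF k] show ?thesis using LIMSEQ_unique Re_cinner_commute by metis
  qed
  from csubspace_eqI_Re[OF K(1) this] pK show ?thesis
    by (intro that[of p]) (auto simp: cinner.diff_right)
qed

lemma Riesz_representation:
  fixes l :: "'a::chilbert_space \<Rightarrow> complex"
  assumes add: "\<And>x y. l (x + y) = l x + l y" and scale: "\<And>c x. l (c *\<^sub>C x) = c * l x"
    and bound: "\<And>x. cmod (l x) \<le> B * norm x"
  obtains y where "\<And>x. l x = cinner y x"
proof -
  have C: "(Re (l x))\<^sup>2 \<le> B\<^sup>2 * Re (cinner x x)" for x
  proof -
    have "\<bar>Re (l x)\<bar> \<le> B * norm x" using abs_Re_le_cmod[of "l x"] bound[of x] by linarith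
    then have "\<bar>Re (l x)\<bar>\<^sup>2 \<le> (B * norm x)\<^sup>2" by (rule power_mono) simp
    then show ?thesis by (simp add: power_mult_distrib Re_cinner_self)
  qed
  have sR: "l (r *\<^sub>R x) = of_real r * l x" for r x using scale[of "of_real r" x] by (simp add: scaleC_of_real)
  obtain f where 
    cau: "\<And>e. e > 0 \<Longrightarrow> \<exists>N. \<forall>m\<ge>N. \<forall>n\<ge>N. Re (cinner (f n - f m) (f n - f m)) < e"
    and lim: "\<And>k. (\<lambda>n. Re (cinner (f n) k)) \<longlonglongrightarrow> Re (l k)"
    by (rule semi_Riesz[where L = UNIV and b = "\<lambda>x y. Re (cinner x y)" and l = "\<lambda>k. Re (l k)"
          and C = "B\<^sup>2"])
      (use C in \<open>auto simp: cinner_add_left cinner_add_right cinner_scaleR_left add sR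
        cinner_scaleR_right Re_cinner_self intro: Re_cinner_commute\<close>)
  have "Cauchy f" by (rule Cauchy_norm_sqI) (use cau in \<open>simp add: Re_cinner_self\<close>)
  then obtain p where p: "f \<longlonglongrightarrow> p" using convergent_def convergent_eq_Cauchy by blast
  have R: "Re (l x) = Re (cinner p x)" for x
  proof -
    have "(\<lambda>n. Re (cinner (f n) x)) \<longlonglongrightarrow> Re (cinner p x)"
      by (intro tendsto_Re tendsto_cinner p tendsto_const)
    with lim show ?thesis using LIMSEQ_unique by blast
  qed
  have "l x = cinner p x" for x
    using R[of x] R[of "\<i> *\<^sub>C x"] by (intro complex_eqI) (auto simp: scale cinner_scaleC_right)
  then show ?thesis by (rule that)
qed

section \<open>Adjoints, projections and polarization\<close>

lemma cadjoint_eqI: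
  assumes "\<And>u. cinner (A u) y = cinner u x"
  shows "cadjoint A y = x"
  unfolding cadjoint_def by (rule the_equality) (use assms in \<open>auto intro: cinner_eqI\<close>)

lemma cadjoint_works:
  assumes A: "bounded_clinear A"
  shows "cinner (A u) y = cinner u (cadjoint A y)"
proof -
  from A obtain K where K: "\<And>x. norm (A x) \<le> K * norm x" by (auto simp: bounded_clinear_def)
  have "cmod (cinner y (A x)) \<le> norm y * K * norm x" for x
    using cinner_norm_le[of y "A x"] mult_left_mono[OF K[of x], of "norm y"] by simp
  then obtain v where v: "\<And>x. cinner y (A x) = cinner v x"
    using Riesz_representation[of "\<lambda>x. cinner y (A x)" "norm y * K"] A
    by (auto simp: bounded_clinear_def clinear_def cinner_add_right cinner_scaleC_right)
  have "cinner (A u) y = cinner u v" for u using v[of u] cinner_commute by metis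
  then show ?thesis using cadjoint_eqI[of A y v] by simp
qed

lemma orth_proj_eqI:
  assumes "p \<in> K" "csubspace K" "\<And>k. k \<in> K \<Longrightarrow> cinner k (x - p) = 0"
  shows "orth_proj K x = p"
  unfolding orth_proj_def
proof (rule the_equality)
  fix q assume q: "q \<in> K \<and> (\<forall>k\<in>K. cinner k (x - q) = 0)"
  then have "q - p \<in> K" using assms by (auto intro: csubspace_diff)
  then have "cinner (q - p) (x - p) = 0" "cinner (q - p) (x - q) = 0" using q assms by auto
  then have "cinner (q - p) (q - p) = 0" by (simp add: cinner.diff_right)
  then show "q = p" by simp
qed (use assms in auto)

text \<open>The signs of i belong to a form that is antilinear in its first argument. Differences
  are written with explicit complex scalars so that the rules for sums and multiples rewrite every
  term.\<close>

lemma polarization: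
  fixes B :: "'a::chilbert_space \<Rightarrow> 'a \<Rightarrow> complex"
  assumes "\<And>x y z. B (x + y) z = B x z + B y z" "\<And>x y z. B x (y + z) = B x y + B x z"
    "\<And>c x y. B (c *\<^sub>C x) y = cnj c * B x y" "\<And>c x y. B x (c *\<^sub>C y) = c * B x y"
  shows "B x y = (B (x + y) (x + y) - B (x + (- 1) *\<^sub>C y) (x + (- 1) *\<^sub>C y)
    - \<i> * B (x + \<i> *\<^sub>C y) (x + \<i> *\<^sub>C y) + \<i> * B (x + (- \<i>) *\<^sub>C y) (x + (- \<i>) *\<^sub>C y)) / 4"
  by (simp only: assms) (simp add: algebra_simps)

section \<open>Self-adjoint operators and quadratic forms\<close>

lemma operator_in_add: "operator_in S A \<Longrightarrow> (f, g) \<in> A \<Longrightarrow> (u, v) \<in> A \<Longrightarrow> (f + u, g + v) \<in> A"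
  by (auto simp: operator_in_def)

lemma operator_in_scale: "operator_in S A \<Longrightarrow> (f, g) \<in> A \<Longrightarrow> (c *\<^sub>C f, c *\<^sub>C g) \<in> A"
  by (auto simp: operator_in_def)

lemma operator_in_diff: "operator_in S A \<Longrightarrow> (f, g) \<in> A \<Longrightarrow> (u, v) \<in> A \<Longrightarrow> (f - u, g - v) \<in> A"
  using operator_in_add[of S A f g "(-1) *\<^sub>C u" "(-1) *\<^sub>C v"] operator_in_scale[of S A u v "-1"]
  by (simp add: scaleC_minus_one)

lemma operator_in_mem: "operator_in S A \<Longrightarrow> (f, g) \<in> A \<Longrightarrow> f \<in> S \<and> g \<in> S"
  by (auto simp: operator_in_def)

lemma operator_in_Domain:
  assumes op: "operator_in S A"
  shows "csubspace (Domain A)"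
  unfolding csubspace_def
proof (intro conjI ballI allI)
  show "0 \<in> Domain A" using op unfolding operator_in_def by blast
  show "x + y \<in> Domain A" if "x \<in> Domain A" "y \<in> Domain A" for x y
    using that operator_in_add[OF op] by blast
  show "c *\<^sub>C x \<in> Domain A" if "x \<in> Domain A" for c x
    using that operator_in_scale[OF op] by blast
qed

lemma operator_in_subspace:
  assumes "operator_in S A" shows "subspace A"
proof (rule subspaceI)
  show "0 \<in> A" using assms by (simp add: operator_in_def zero_prod_def)
  fix p q and r :: real assume "p \<in> A" "q \<in> A"
  then have "(fst p, snd p) \<in> A" "(fst q, snd q) \<in> A" by simp_all
  then have "(fst p + fst q, snd p + snd q) \<in> A" "(of_real r *\<^sub>C fst p, of_real r *\<^sub>C snd p) \<in> A"
    using operator_in_add[OF assms] operator_in_scale[OF assms] by blast+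
  then show "p + q \<in> A" "r *\<^sub>R p \<in> A"
    by (simp_all add: scaleC_of_real plus_prod_def scaleR_prod_def)
qed

lemma op_apply_eq: "operator_in S A \<Longrightarrow> (f, g) \<in> A \<Longrightarrow> op_apply A f = g"
  unfolding op_apply_def by (rule the_equality) (auto simp: operator_in_def single_valued_def)

lemma closed_op_adjoint:
  assumes "closed S" shows "closed (op_adjoint S A)"
proof -
  have "op_adjoint S A = (S \<times> S) \<inter> (\<Inter>p\<in>A. {x. cinner (fst x) (snd p) = cinner (snd x) (fst p)})"
    by (force simp: op_adjoint_def)
  moreover have "closed {x :: 'a \<times> 'a. cinner (fst x) (snd p) = cinner (snd x) (fst p)}" for p :: "'a \<times> 'a"
    by (intro closed_Collect_eq cinner.continuous_on continuous_intros)
  ultimately show ?thesis using assms by (auto intro!: closed_Int closed_Times closed_INT)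
qed

lemma self_adjoint_operator_in: "self_adjoint S A \<Longrightarrow> operator_in S A"
  by (simp add: self_adjoint_def)

lemma self_adjoint_sym:
  "self_adjoint S A \<Longrightarrow> (f, g) \<in> A \<Longrightarrow> (u, v) \<in> A \<Longrightarrow> cinner f v = cinner g u"
  unfolding self_adjoint_def op_adjoint_def by blast

lemma self_adjointD:
  assumes "self_adjoint S A" "f \<in> S" "g \<in> S" "\<And>u v. (u, v) \<in> A \<Longrightarrow> cinner f v = cinner g u"
  shows "(f, g) \<in> A"
proof -
  have "(f, g) \<in> op_adjoint S A" using assms(2-) by (auto simp: op_adjoint_def)
  then show ?thesis using assms(1) by (simp add: self_adjoint_def)
qed

lemma self_adjoint_Im_zero:
  assumes "self_adjoint S A" "(f, g) \<in> A" shows "Im (cinner f g) = 0"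
proof -
  have "cinner f g = cnj (cinner f g)"
    using self_adjoint_sym[OF assms(1,2,2)] cinner_commute[of g f] by simp
  then show ?thesis by (metis Im_complex_of_real Reals_cnj_iff complex_is_Real_iff)
qed

text \<open>The lower bound makes preimages of a Cauchy sequence Cauchy, so the range of A - z is
  closed because the graph is. By \<open>dense\<close>, the component of h orthogonal to that range
  vanishes.\<close>

lemma range_eq_of_lower_bound:
  assumes op: "operator_in S A" and Acl: "closed A" and Ssub: "csubspace S" and c: "c > 0"
    and lower: "\<And>f g. (f, g) \<in> A \<Longrightarrow> c * norm f \<le> norm (g - z *\<^sub>C f)"
    and dense: "\<And>d. d \<in> S \<Longrightarrow> (\<And>f g. (f, g) \<in> A \<Longrightarrow> cinner d (g - z *\<^sub>C f) = 0) \<Longrightarrow> d = 0"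
    and h: "h \<in> S"
  obtains f g where "(f, g) \<in> A" "g - z *\<^sub>C f = h"
proof -
  define K where "K = {g - z *\<^sub>C f | f g. (f, g) \<in> A}"
  have K: "csubspace K"
    unfolding csubspace_def
  proof (intro conjI ballI allI)
    have "0 - z *\<^sub>C 0 \<in> K" unfolding K_def using op operator_in_def by blast
    then show "0 \<in> K" by (simp add: scaleC.zero_right)
    fix x y c assume x: "x \<in> K" and y: "y \<in> K"
    from x obtain f g where 1: "(f, g) \<in> A" "x = g - z *\<^sub>C f" by (auto simp: K_def)
    from y obtain u v where 2: "(u, v) \<in> A" "y = v - z *\<^sub>C u" by (auto simp: K_def)
    have "x + y = (g + v) - z *\<^sub>C (f + u)" by (simp add: 1 2 scaleC_add_right)
    then show "x + y \<in> K" unfolding K_def using operator_in_add[OF op 1(1) 2(1)] by blast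
    have "c *\<^sub>C x = c *\<^sub>C g - z *\<^sub>C (c *\<^sub>C f)" by (simp add: 1 scaleC.diff_right scaleC_scaleC mult.commute)
    then show "c *\<^sub>C x \<in> K" unfolding K_def using operator_in_scale[OF op 1(1)] by blast
  qed
  have Kcl: "closed K"
    unfolding closed_sequential_limits
  proof (intro allI impI, elim conjE)
    fix h l assume hK: "\<forall>n. h n \<in> K" and hl: "h \<longlonglongrightarrow> l"
    from hK have "\<forall>n. \<exists>f g. (f, g) \<in> A \<and> h n = g - z *\<^sub>C f" unfolding K_def by blast
    then obtain f g where fg: "\<And>n. (f n, g n) \<in> A" "\<And>n. h n = g n - z *\<^sub>C f n" by metis
    have "Cauchy f"
    proof (rule metric_CauchyI)
      fix e :: real assume "e > 0"
      then have "c * e > 0" using c by simp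
      then obtain N where N: "\<forall>m\<ge>N. \<forall>n\<ge>N. dist (h m) (h n) < c * e"
        using LIMSEQ_imp_Cauchy[OF hl] metric_CauchyD by blast
      have "dist (f m) (f n) < e" if "m \<ge> N" "n \<ge> N" for m n
      proof -
        have "h m - h n = (g m - g n) - z *\<^sub>C (f m - f n)" by (simp add: fg scaleC.diff_right)
        then have "c * norm (f m - f n) \<le> norm (h m - h n)"
          using lower[OF operator_in_diff[OF op fg(1)[of m] fg(1)[of n]]] by simp
        also have "\<dots> < c * e" using N that by (simp add: dist_norm)
        finally show ?thesis using c by (simp add: dist_norm)
      qed
      then show "\<exists>M. \<forall>m\<ge>M. \<forall>n\<ge>M. dist (f m) (f n) < e" by blast
    qed
    then obtain f0 where f0: "f \<longlonglongrightarrow> f0" using convergent_def convergent_eq_Cauchy by blast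
    have "(\<lambda>n. h n + z *\<^sub>C f n) \<longlonglongrightarrow> l + z *\<^sub>C f0"
      by (intro tendsto_add hl scaleC.tendsto tendsto_const f0)
    then have "g \<longlonglongrightarrow> l + z *\<^sub>C f0" by (simp add: fg(2))
    with f0 have "(\<lambda>n. (f n, g n)) \<longlonglongrightarrow> (f0, l + z *\<^sub>C f0)" by (rule tendsto_Pair)
    then have "(f0, l + z *\<^sub>C f0) \<in> A" by (rule closed_sequentially[OF Acl, rotated]) (rule fg(1))
    moreover have "l = (l + z *\<^sub>C f0) - z *\<^sub>C f0" by simp
    ultimately show "l \<in> K" unfolding K_def by blast
  qed
  obtain p where p: "p \<in> K" "\<And>k. k \<in> K \<Longrightarrow> cinner k (h - p) = 0"
    using projection_exists[OF K Kcl, of h] by blast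
  have KS: "K \<subseteq> S"
  proof
    fix k assume "k \<in> K"
    then obtain f g where "(f, g) \<in> A" "k = g - z *\<^sub>C f" by (auto simp: K_def)
    then show "k \<in> S" using operator_in_mem[OF op] csubspace_diff[OF Ssub] csubspace_scale[OF Ssub] by metis
  qed
  define d where "d = h - p"
  have dS: "d \<in> S" unfolding d_def using h p(1) KS csubspace_diff[OF Ssub] by blast
  have "d = 0"
  proof (rule dense[OF dS])
    fix u v assume "(u, v) \<in> A"
    then have "v - z *\<^sub>C u \<in> K" by (auto simp: K_def)
    then show "cinner d (v - z *\<^sub>C u) = 0" using p(2) by (simp add: d_def cinner_orth_sym[of "h - p"])
  qed
  then show ?thesis using p(1) that by (auto simp: K_def d_def)
qed

lemma self_adjoint_closed: "self_adjoint S A \<Longrightarrow> closed S \<Longrightarrow> closed A"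
  using closed_op_adjoint[of S A] by (simp add: self_adjoint_def)

text \<open>A vector d of S orthogonal to the range of A - z lies in the domain with A d = cnj z d,
  and the lower bound at cnj z forces d = 0.\<close>

lemma self_adjoint_range:
  assumes sa: "self_adjoint S A" and S: "hilbert_subspace S" and c: "c > 0"
    and lower: "\<And>f g. (f, g) \<in> A \<Longrightarrow> c * norm f \<le> norm (g - z *\<^sub>C f)"
    and lower': "\<And>f g. (f, g) \<in> A \<Longrightarrow> c * norm f \<le> norm (g - cnj z *\<^sub>C f)"
    and h: "h \<in> S"
  obtains f g where "(f, g) \<in> A" "g - z *\<^sub>C f = h"
proof -
  have Ssub: "csubspace S" and Scl: "closed S" using S by (auto simp: hilbert_subspace_def)
  have dense: "d = 0" if dS: "d \<in> S" and orth: "\<And>f g. (f, g) \<in> A \<Longrightarrow> cinner d (g - z *\<^sub>C f) = 0" for d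
  proof -
    have "(d, cnj z *\<^sub>C d) \<in> A"
    proof (rule self_adjointD[OF sa dS csubspace_scale[OF Ssub dS]])
      fix u v assume "(u, v) \<in> A"
      from orth[OF this] show "cinner d v = cinner (cnj z *\<^sub>C d) u"
        by (simp add: cinner.diff_right cinner_scaleC_right cinner_scaleC_left)
    qed
    from lower'[OF this] have "c * norm d \<le> 0" by simp
    then show ?thesis using c by (simp add: mult_le_0_iff)
  qed
  obtain f g where "(f, g) \<in> A" "g - z *\<^sub>C f = h"
    using range_eq_of_lower_bound[OF self_adjoint_operator_in[OF sa] self_adjoint_closed[OF sa Scl] Ssub c lower dense h]
    by blast
  then show ?thesis by (rule that)
qed

text \<open>For (f, g) in the adjoint, solve (A - i) u = g - i f. Then f - u is an eigenvector of
  the adjoint for i, hence orthogonal to the range of A + i, so f = u.\<close>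

lemma self_adjointI:
  assumes op: "operator_in S A" and S: "hilbert_subspace S" and cl: "closed A"
    and sym: "\<And>f g u v. (f, g) \<in> A \<Longrightarrow> (u, v) \<in> A \<Longrightarrow> cinner f v = cinner g u"
    and dense: "\<And>z d. z \<in> {\<i>, - \<i>} \<Longrightarrow> d \<in> S \<Longrightarrow> (\<And>f g. (f, g) \<in> A \<Longrightarrow> cinner d (g - z *\<^sub>C f) = 0) \<Longrightarrow> d = 0"
  shows "self_adjoint S A"
proof -
  have Ssub: "csubspace S" and Scl: "closed S" using S by (auto simp: hilbert_subspace_def)
  have real: "Im (cinner f g) = 0" if "(f, g) \<in> A" for f g
  proof -
    have "cinner f g = cnj (cinner f g)" using sym[OF that that] cinner_commute[of g f] by simp
    then show ?thesis by (metis Im_complex_of_real Reals_cnj_iff complex_is_Real_iff)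
  qed
  have lower: "1 * norm f \<le> norm (g - \<i> *\<^sub>C f)" if fg: "(f, g) \<in> A" for f g
  proof -
    have "cinner g f = cnj (cinner f g)" by (rule cinner_commute)
    then have "Re (cinner (g - \<i> *\<^sub>C f) (g - \<i> *\<^sub>C f)) = (norm g)\<^sup>2 + (norm f)\<^sup>2"
      using real[OF fg]
      by (simp only: cinner.diff_left cinner.diff_right cinner_scaleC_left cinner_scaleC_right)
        (simp add: cinner_self)
    then have "(norm f)\<^sup>2 \<le> (norm (g - \<i> *\<^sub>C f))\<^sup>2" by (simp add: Re_cinner_self)
    then show ?thesis by (simp add: power2_le_iff_abs_le)
  qed
  have dense_i: "d = 0" if "d \<in> S" "\<And>f g. (f, g) \<in> A \<Longrightarrow> cinner d (g - \<i> *\<^sub>C f) = 0" for d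
    using dense[of \<i> d] that by blast
  have "op_adjoint S A \<subseteq> A"
  proof (rule subrelI)
    fix f g assume fg: "(f, g) \<in> op_adjoint S A"
    then have fgS: "f \<in> S" "g \<in> S" by (auto simp: op_adjoint_def)
    have "g - \<i> *\<^sub>C f \<in> S" using csubspace_diff[OF Ssub fgS(2) csubspace_scale[OF Ssub fgS(1)]] .
    then obtain u v where uv: "(u, v) \<in> A" "v - \<i> *\<^sub>C u = g - \<i> *\<^sub>C f"
      using range_eq_of_lower_bound[OF op cl Ssub zero_less_one lower dense_i] by blast
    have "f - u = 0"
    proof (rule dense[of "- \<i>"])
      show "f - u \<in> S" using csubspace_diff[OF Ssub] fgS(1) operator_in_mem[OF op uv(1)] by blast
      fix a b assume ab: "(a, b) \<in> A"
      have "cinner f b = cinner g a" using fg ab by (auto simp: op_adjoint_def)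
      moreover have "cinner u b = cinner v a" by (rule sym[OF uv(1) ab])
      moreover have "g - v = \<i> *\<^sub>C (f - u)"
        using uv(2) by (simp add: scaleC.diff_right algebra_simps)
      then have "cinner (g - v) a = cinner (\<i> *\<^sub>C (f - u)) a" by simp
      ultimately show "cinner (f - u) (b - (- \<i>) *\<^sub>C a) = 0"
        by (simp add: cinner.diff_left cinner.diff_right cinner_scaleC_left cinner_scaleC_right)
    qed simp
    then show "(f, g) \<in> A" using uv by simp
  qed
  moreover have "A \<subseteq> op_adjoint S A"
    using sym operator_in_mem[OF op] by (auto simp: op_adjoint_def)
  ultimately have eq: "A = op_adjoint S A" by blast
  have "densely_defined S A"
    unfolding densely_defined_def
  proof
    fix x assume x: "x \<in> S"
    obtain p where p: "p \<in> closure (Domain A)" "\<And>k. k \<in> closure (Domain A) \<Longrightarrow> cinner k (x - p) = 0"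
      using projection_exists[OF csubspace_closure[OF operator_in_Domain[OF op]] closed_closure, of x] by blast
    have "closure (Domain A) \<subseteq> S"
      using operator_in_mem[OF op] by (intro closure_minimal[OF _ Scl]) auto
    then have xp: "x - p \<in> S" using csubspace_diff[OF Ssub x] p(1) by blast
    have "cinner (x - p) u = 0" if "(u, v) \<in> A" for u v
      using p(2)[of u] that closure_subset[of "Domain A"] by (auto simp: cinner_orth_sym[of "x - p"])
    \<comment> \<open>Density of the domain comes out of A being its own adjoint: a vector
      orthogonal to the domain is paired with 0 there, and A is single-valued.\<close>
    then have "(0, x - p) \<in> op_adjoint S A"
      using xp Ssub by (auto simp: op_adjoint_def csubspace_def cinner.zero_left)
    then have "(0, x - p) \<in> A" by (simp add: eq[symmetric])
    then have "x - p = 0" using op unfolding operator_in_def single_valued_def by blast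
    then show "x \<in> closure (Domain A)" using p(1) by simp
  qed
  then show ?thesis using op eq by (simp add: self_adjoint_def)
qed

text \<open>(f, A f) is real, so the imaginary part of (f, (A - z) f) is -Im z times the squared
  norm of f.\<close>

lemma self_adjoint_lower_bound:
  assumes sa: "self_adjoint S A" and fg: "(f, g) \<in> A"
  shows "\<bar>Im z\<bar> * norm f \<le> norm (g - z *\<^sub>C f)"
proof (cases "f = 0")
  case False
  have "cinner f (g - z *\<^sub>C f) = cinner f g - z * of_real ((norm f)\<^sup>2)"
    by (simp add: cinner.diff_right cinner_scaleC_right cinner_self)
  then have "\<bar>Im z\<bar> * (norm f)\<^sup>2 = \<bar>Im (cinner f (g - z *\<^sub>C f))\<bar>"
    using self_adjoint_Im_zero[OF sa fg] by (simp add: abs_mult del: of_real_power)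
  also have "\<dots> \<le> norm f * norm (g - z *\<^sub>C f)"
    using abs_Im_le_cmod[of "cinner f (g - z *\<^sub>C f)"] cinner_norm_le[of f "g - z *\<^sub>C f"] by linarith
  finally have "norm f * (\<bar>Im z\<bar> * norm f) \<le> norm f * norm (g - z *\<^sub>C f)"
    by (simp add: power2_eq_square mult_ac)
  then show ?thesis using False by simp
qed simp

lemma self_adjoint_resolvent:
  assumes sa: "self_adjoint S A" and S: "hilbert_subspace S" and z: "Im z \<noteq> 0" and h: "h \<in> S"
  obtains f g where "(f, g) \<in> A" "g - z *\<^sub>C f = h"
proof (rule self_adjoint_range[OF sa S _ _ _ h])
  show "0 < \<bar>Im z\<bar>" using z by simp
qed (use self_adjoint_lower_bound[OF sa, of _ _ z] self_adjoint_lower_bound[OF sa, of _ _ "cnj z"] in auto)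

section \<open>Nonnegative operators and convergence in the form norm\<close>

lemma nonneg_opD: "nonneg_op A \<Longrightarrow> (f, g) \<in> A \<Longrightarrow> 0 \<le> Re (cinner f g)"
  unfolding nonneg_op_def complex_nonneg_Reals_iff by blast

lemma nonneg_op_cinner: "nonneg_op A \<Longrightarrow> (f, g) \<in> A \<Longrightarrow> cinner f g = of_real (Re (cinner f g))"
  unfolding nonneg_op_def complex_nonneg_Reals_iff by (auto simp: complex_eq_iff)

text \<open>Positivity of the form bounds A + 1 below by 1; this is the shift z = -1.\<close>

lemma nonneg_self_adjoint_range:
  assumes sa: "self_adjoint S A" and S: "hilbert_subspace S" and nn: "nonneg_op A" and h: "h \<in> S"
  obtains f g where "(f, g) \<in> A" "f + g = h"
proof -
  have *: "1 * norm f \<le> norm (g - (-1) *\<^sub>C f)" if fg: "(f, g) \<in> A" for f g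
  proof (cases "f = 0")
    case False
    have "(norm f)\<^sup>2 \<le> Re (cinner f (f + g))"
      using nonneg_opD[OF nn fg] by (simp add: cinner.add_right Re_cinner_self)
    also have "\<dots> \<le> norm f * norm (f + g)"
      using complex_Re_le_cmod[of "cinner f (f + g)"] cinner_norm_le[of f "f + g"] by linarith
    finally have "norm f * norm f \<le> norm f * norm (f + g)" by (simp add: power2_eq_square)
    then show ?thesis using False by (simp add: scaleC_minus_one add.commute)
  qed simp
  show ?thesis
  proof (rule self_adjoint_range[OF sa S zero_less_one _ _ h, of "-1"])
    fix f g assume "(f, g) \<in> A" "g - (-1) *\<^sub>C f = h"
    then show ?thesis using that by (simp add: scaleC_minus_one add.commute)
  qed (use * in auto)
qed

text \<open>The form of a nonnegative operator is real, so real parts control the complex limit over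
  pairs of indices. Carrying the images g along replaces every use of
  \<open>op_apply\<close>.\<close>

lemma form_CauchyI:
  assumes op: "operator_in S A" and nn: "nonneg_op A" and fg: "\<And>n. (f n, g n) \<in> A"
    and cau: "\<And>e. e > 0 \<Longrightarrow> \<exists>N. \<forall>m\<ge>N. \<forall>n\<ge>N. Re (cinner (f n - f m) (g n - g m)) < e"
  shows "form_Cauchy A f"
  unfolding form_Cauchy_def tendsto_iff eventually_prod_sequentially
proof (intro allI impI)
  fix e :: real assume "e > 0"
  then obtain N where N: "\<forall>m\<ge>N. \<forall>n\<ge>N. Re (cinner (f n - f m) (g n - g m)) < e" using cau by blast
  have d: "(f n - f m, g n - g m) \<in> A" for n m by (rule operator_in_diff[OF op fg fg])
  have "dist (cinner (f n - f m) (op_apply A (f n - f m))) 0 < e" if "n \<ge> N" "m \<ge> N" for n m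
    using N that nonneg_op_cinner[OF nn d, of n m] nonneg_opD[OF nn d, of n m]
    by (simp add: op_apply_eq[OF op d]) (metis abs_of_nonneg norm_of_real)
  then show "\<exists>N. \<forall>m\<ge>N. \<forall>n\<ge>N. dist (case (n, m) of (m, n) \<Rightarrow> cinner (f n - f m) (op_apply A (f n - f m))) 0 < e"
    by (intro exI[of _ N]) auto
qed

lemma form_CauchyD:
  assumes op: "operator_in S A" and fg: "\<And>n. (f n, g n) \<in> A" and "form_Cauchy A f" "e > 0"
  shows "\<exists>N. \<forall>m\<ge>N. \<forall>n\<ge>N. Re (cinner (f n - f m) (g n - g m)) < e"
proof -
  have d: "(f n - f m, g n - g m) \<in> A" for n m by (rule operator_in_diff[OF op fg fg])
  from assms(3,4) obtain N where N: "\<forall>m\<ge>N. \<forall>n\<ge>N. cmod (cinner (f m - f n) (g m - g n)) < e"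
    unfolding form_Cauchy_def tendsto_iff eventually_prod_sequentially by (auto simp: op_apply_eq[OF op d])
  have "Re (cinner (f n - f m) (g n - g m)) < e" if "m \<ge> N" "n \<ge> N" for m n
    using N that complex_Re_le_cmod[of "cinner (f n - f m) (g n - g m)"] le_less_trans by blast
  then show ?thesis by blast
qed

text \<open>q(x - y) = 2 q(x) + 2 q(y) - q(x + y) for the quadratic form q of A, and the last term
  has a sign.\<close>

lemma form_parallelogram_le:
  assumes op: "operator_in S A" and nn: "nonneg_op A" and fg: "(f, g) \<in> A" and uv: "(u, v) \<in> A"
  shows "Re (cinner (f - u) (g - v)) \<le> 2 * Re (cinner f g) + 2 * Re (cinner u v)"
  using nonneg_opD[OF nn operator_in_add[OF op fg uv]]
  by (simp add: cinner.diff_left cinner.diff_right cinner.add_left cinner.add_right)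

lemma form_Cauchy_diff:
  assumes op: "operator_in S A" and nn: "nonneg_op A"
    and fg: "\<And>n. (f n, g n) \<in> A" "form_Cauchy A f" and uv: "\<And>n. (u n, v n) \<in> A" "form_Cauchy A u"
  shows "form_Cauchy A (\<lambda>n. f n - u n)"
proof (rule form_CauchyI[OF op nn])
  show "(f n - u n, g n - v n) \<in> A" for n by (rule operator_in_diff[OF op fg(1) uv(1)])
  fix e :: real assume "e > 0"
  then have e: "e / 4 > 0" by simp
  obtain N1 where N1: "\<forall>m\<ge>N1. \<forall>n\<ge>N1. Re (cinner (f n - f m) (g n - g m)) < e / 4"
    using form_CauchyD[OF op fg e] by blast
  obtain N2 where N2: "\<forall>m\<ge>N2. \<forall>n\<ge>N2. Re (cinner (u n - u m) (v n - v m)) < e / 4"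
    using form_CauchyD[OF op uv e] by blast
  have "Re (cinner (f n - u n - (f m - u m)) (g n - v n - (g m - v m))) < e"
    if "m \<ge> max N1 N2" "n \<ge> max N1 N2" for m n
  proof -
    have "(f n - f m, g n - g m) \<in> A" "(u n - u m, v n - v m) \<in> A"
      by (rule operator_in_diff[OF op fg(1) fg(1)], rule operator_in_diff[OF op uv(1) uv(1)])
    note form_parallelogram_le[OF op nn this]
    moreover have "Re (cinner (f n - f m) (g n - g m)) < e / 4" using N1 that by simp
    moreover have "Re (cinner (u n - u m) (v n - v m)) < e / 4" using N2 that by simp
    ultimately have "Re (cinner ((f n - f m) - (u n - u m)) ((g n - g m) - (v n - v m))) < e" by linarith
    then show ?thesis by (simp add: algebra_simps)
  qed
  then show "\<exists>N. \<forall>m\<ge>N. \<forall>n\<ge>N. Re (cinner (f n - u n - (f m - u m)) (g n - v n - (g m - v m))) < e"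
    by blast
qed

lemma form_null_sequence:
  assumes sa: "self_adjoint S A"
    and fg: "\<And>n. (f n, g n) \<in> A"
    and cau: "\<And>e. e > 0 \<Longrightarrow> \<exists>N. \<forall>m\<ge>N. \<forall>n\<ge>N. Re (cinner (f n - f m) (g n - g m)) < e"
    and pos: "\<And>n. 0 \<le> Re (cinner (f n) (g n))"
    and null: "\<And>n. (\<lambda>m. Re (cinner (f m) (g n))) \<longlonglongrightarrow> 0"
  shows "(\<lambda>n. Re (cinner (f n) (g n))) \<longlonglongrightarrow> 0"
proof (rule LIMSEQ_I)
  fix e :: real assume "e > 0"
  then obtain N where N: "\<forall>m\<ge>N. \<forall>n\<ge>N. Re (cinner (f n - f m) (g n - g m)) < e / 2"
    using cau[of "e / 2"] by auto
  have "Re (cinner (f n) (g n)) \<le> e / 2" if n: "n \<ge> N" for n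
  proof (rule tendsto_lowerbound[of _ _ sequentially])
    show "(\<lambda>m. e / 2 + 2 * Re (cinner (f m) (g n))) \<longlonglongrightarrow> e / 2"
      using tendsto_add[OF tendsto_const[of "e/2"] tendsto_mult_right[OF null[of n], of 2]] by (simp add: mult.commute)
    show "\<forall>\<^sub>F m in sequentially. Re (cinner (f n) (g n)) \<le> e / 2 + 2 * Re (cinner (f m) (g n))"
    proof (rule eventually_sequentiallyI[of N])
      fix m assume m: "m \<ge> N"
      have "cinner (f n) (g m) = cinner (g n) (f m)" by (rule self_adjoint_sym[OF sa fg fg])
      then have "Re (cinner (f n) (g m)) = Re (cinner (f m) (g n))" by (simp add: Re_cinner_commute[of "g n"])
      moreover have "Re (cinner (f n - f m) (g n - g m)) < e / 2" using N n m by blast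
      ultimately show "Re (cinner (f n) (g n)) \<le> e / 2 + 2 * Re (cinner (f m) (g n))"
        using pos[of m] by (simp add: cinner.diff_left cinner.diff_right)
    qed
  qed simp
  then show "\<exists>N. \<forall>n\<ge>N. norm (Re (cinner (f n) (g n)) - 0) < e"
    using \<open>e > 0\<close> pos by (intro exI[of _ N]) (force intro: le_less_trans[of _ "e / 2"])
qed

section \<open>Resolvent bounds on the imaginary axis\<close>

text \<open>In terms of the spectral theorem, the next bounds say that
  \<open>\<lambda>\<^sup>2 y\<^sup>2 / (\<lambda>\<^sup>2 + y\<^sup>2) \<le> \<lambda>\<^sup>2\<close>, \<open>\<lambda> y\<^sup>2 / (\<lambda>\<^sup>2 + y\<^sup>2) \<le> \<lambda>\<close> and
  \<open>\<lambda>\<^sup>2 (\<lambda> + y) / (\<lambda>\<^sup>2 + y\<^sup>2) \<le> 2 \<lambda>\<close>, respectively.\<close>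

lemma resolvent_domain_bound:
  assumes sa: "self_adjoint S A" and xh: "(x, h) \<in> A" and vw: "(v, w) \<in> A"
    and eq: "w - (\<i> * complex_of_real y) *\<^sub>C v = x"
  shows "y\<^sup>2 * ((norm x)\<^sup>2 - y * Im (cinner x v)) \<le> (norm h)\<^sup>2"
proof -
  note op = self_adjoint_operator_in[OF sa]
  \<comment> \<open>w = x + i y v lies in the domain again and w' is its image, so x and h are (A -
    i y) v and (A - i y) w.\<close>
  define w' where "w' = h + (\<i> * complex_of_real y) *\<^sub>C w"
  have w: "w = x + (\<i> * complex_of_real y) *\<^sub>C v" using eq by (simp add: algebra_simps)
  have ww: "(w, w') \<in> A"
    using operator_in_add[OF op xh operator_in_scale[OF op vw, of "\<i> * complex_of_real y"]] by (simp add: w w'_def)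
  have vw0: "Im (cinner v w) = 0" by (rule self_adjoint_Im_zero[OF sa vw])
  have ww0: "Im (cinner w w') = 0" by (rule self_adjoint_Im_zero[OF sa ww])
  have wv: "cinner w v = cnj (cinner v w)" "cinner w' w = cnj (cinner w w')" by (rule cinner_commute)+
  have x: "x = w - (\<i> * complex_of_real y) *\<^sub>C v" and h: "h = w' - (\<i> * complex_of_real y) *\<^sub>C w"
    by (simp_all add: w w'_def)
  have "Re (cinner x x) = (norm w)\<^sup>2 + y\<^sup>2 * (norm v)\<^sup>2"
    unfolding x using vw0 
    by (simp only: cinner.diff_left cinner.diff_right cinner_scaleC_left cinner_scaleC_right)
      (simp add: cinner_self wv power2_eq_square algebra_simps)
  moreover have "Im (cinner x v) = y * (norm v)\<^sup>2"
    unfolding x using vw0 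
    by (simp only: cinner.diff_left cinner.diff_right cinner_scaleC_left cinner_scaleC_right)
      (simp add: cinner_self wv power2_eq_square algebra_simps)
  moreover have "Re (cinner h h) = (norm w')\<^sup>2 + y\<^sup>2 * (norm w)\<^sup>2"
    unfolding h using ww0 
    by (simp only: cinner.diff_left cinner.diff_right cinner_scaleC_left cinner_scaleC_right)
      (simp add: cinner_self wv power2_eq_square algebra_simps)
  ultimately show ?thesis by (simp add: Re_cinner_self power2_eq_square algebra_simps)
qed

lemma resolvent_form_bound:
  assumes sa: "self_adjoint S A" and nn: "nonneg_op A" and xh: "(x, h) \<in> A" and vw: "(v, w) \<in> A"
    and eq: "w - (\<i> * complex_of_real y) *\<^sub>C v = x"
  shows "y\<^sup>2 * Re (cinner x v) \<le> Re (cinner x h)"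
    and "Re (cinner h w) + Im (cinner h w) \<le> 2 * Re (cinner x h)"
proof -
  note op = self_adjoint_operator_in[OF sa]
  define w' where "w' = h + (\<i> * complex_of_real y) *\<^sub>C w"
  have w: "w = x + (\<i> * complex_of_real y) *\<^sub>C v" using eq by (simp add: algebra_simps)
  have ww: "(w, w') \<in> A"
    using operator_in_add[OF op xh operator_in_scale[OF op vw, of "\<i> * complex_of_real y"]] by (simp add: w w'_def)
  have vw0: "Im (cinner v w) = 0" by (rule self_adjoint_Im_zero[OF sa vw])
  have ww0: "Im (cinner w w') = 0" by (rule self_adjoint_Im_zero[OF sa ww])
  have wv: "cinner w v = cnj (cinner v w)" "cinner w' w = cnj (cinner w w')" by (rule cinner_commute)+
  have vw': "cinner v w' = of_real ((norm w)\<^sup>2)" using self_adjoint_sym[OF sa vw ww] by (simp add: cinner_self)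
  have wv': "cinner w' v = of_real ((norm w)\<^sup>2)" using vw' cinner_commute[of w' v] by simp
  have x: "x = w - (\<i> * complex_of_real y) *\<^sub>C v" and h: "h = w' - (\<i> * complex_of_real y) *\<^sub>C w"
    by (simp_all add: w w'_def)
  have 1: "Re (cinner x h) = Re (cinner w w') + y\<^sup>2 * Re (cinner v w)"
    unfolding x h using vw0 ww0
    by (simp add: cinner.diff_left cinner.diff_right cinner_scaleC_left cinner_scaleC_right cinner_self vw'
        power2_eq_square algebra_simps)
  have 2: "Re (cinner x v) = Re (cinner v w)"
    unfolding x using vw0
    by (simp add: cinner.diff_left cinner.diff_right cinner_scaleC_left cinner_scaleC_right cinner_self wv)
  have 3: "Re (cinner h w) = Re (cinner w w')" "Im (cinner h w) = y * (norm w)\<^sup>2"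
    unfolding h using ww0
    by (simp_all add: cinner.diff_left cinner.diff_right cinner_scaleC_left cinner_scaleC_right cinner_self wv)
  have p: "0 \<le> Re (cinner w w')" "0 \<le> Re (cinner v w)" using nonneg_opD[OF nn ww] nonneg_opD[OF nn vw] .
  show "y\<^sup>2 * Re (cinner x v) \<le> Re (cinner x h)" using 1 2 p by simp
  \<comment> \<open>Positivity at w - y v controls y |w|^2, the term that comes from the imaginary
    part.\<close>
  have "(w - complex_of_real y *\<^sub>C v, w' - complex_of_real y *\<^sub>C w) \<in> A"
    by (rule operator_in_diff[OF op ww operator_in_scale[OF op vw]])
  from nonneg_opD[OF nn this] have "2 * y * (norm w)\<^sup>2 \<le> Re (cinner w w') + y\<^sup>2 * Re (cinner v w)"
    by (simp add: cinner.diff_left cinner.diff_right cinner_scaleC_left cinner_scaleC_right cinner_self vw'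
        power2_eq_square algebra_simps)
  moreover have "0 \<le> y\<^sup>2 * Re (cinner v w)" by (rule mult_nonneg_nonneg[OF zero_le_power2 p(2)])
  moreover have "a + n \<le> 2 * (a + b)" if "2 * n \<le> a + b" "0 \<le> a" "0 \<le> b" for a b n :: real
    using that by argo
  ultimately show "Re (cinner h w) + Im (cinner h w) \<le> 2 * Re (cinner x h)"
    unfolding 1 3 using p(1) by (simp only: mult.assoc)
qed

lemma resolvent_tendsto:
  assumes sa: "self_adjoint S A" and z: "Im z \<noteq> 0"
    and vw: "\<And>n. (v n, w n) \<in> A" and vw0: "(v0, w0) \<in> A"
    and lim: "(\<lambda>n. w n - z *\<^sub>C v n) \<longlonglongrightarrow> w0 - z *\<^sub>C v0"
  shows "v \<longlonglongrightarrow> v0"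
proof -
  note op = self_adjoint_operator_in[OF sa]
  have "(\<lambda>n. norm (v n - v0)) \<longlonglongrightarrow> 0"
  proof (rule tendsto_sandwich[OF _ _ tendsto_const])
    have "(\<lambda>n. (w n - z *\<^sub>C v n) - (w0 - z *\<^sub>C v0)) \<longlonglongrightarrow> 0" using lim LIM_zero by blast
    then show "(\<lambda>n. norm ((w n - z *\<^sub>C v n) - (w0 - z *\<^sub>C v0)) / \<bar>Im z\<bar>) \<longlonglongrightarrow> 0"
      using z by (intro tendsto_divide_zero tendsto_norm_zero)
    have "norm (v n - v0) \<le> norm ((w n - z *\<^sub>C v n) - (w0 - z *\<^sub>C v0)) / \<bar>Im z\<bar>" for n
      using self_adjoint_lower_bound[OF sa operator_in_diff[OF op vw[of n] vw0], of z] z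
      by (simp add: field_simps scaleC.diff_right)
    then show "\<forall>\<^sub>F n in sequentially. norm (v n - v0) \<le> norm ((w n - z *\<^sub>C v n) - (w0 - z *\<^sub>C v0)) / \<bar>Im z\<bar>"
      by simp
  qed simp
  then show ?thesis by (simp add: tendsto_norm_zero_iff LIM_zero_iff)
qed

text \<open>For fixed y the expression y^2 Re (x, (A - i y)^-1 x) is dominated by the form and
  continuous in x, so the bound survives at limits x0 outside the domain. It is going to be
  contradicted at x0 = V \<xi>.\<close>

lemma form_domain_bound:
  assumes sa: "self_adjoint S A" and S: "hilbert_subspace S" and nn: "nonneg_op A"
    and xh: "\<And>n. (x n, h n) \<in> A" and bd: "\<And>n. Re (cinner (x n) (h n)) \<le> C" and lim: "x \<longlonglongrightarrow> x0"
    and vw: "(v, w) \<in> A" and eq: "w - (\<i> * complex_of_real y) *\<^sub>C v = x0" and y: "y > 0"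
  shows "y\<^sup>2 * Re (cinner x0 v) \<le> C"
proof -
  note op = self_adjoint_operator_in[OF sa]
  have "\<forall>n. \<exists>v w. (v, w) \<in> A \<and> w - (\<i> * complex_of_real y) *\<^sub>C v = x n"
    using self_adjoint_resolvent[OF sa S, of "\<i> * complex_of_real y"] y operator_in_mem[OF op xh] by (metis Im_i_times Re_complex_of_real less_irrefl)
  then obtain vn wn where n: "\<And>n. (vn n, wn n) \<in> A" "\<And>n. wn n - (\<i> * complex_of_real y) *\<^sub>C vn n = x n"
    by metis
  have "vn \<longlonglongrightarrow> v"
    by (rule resolvent_tendsto[OF sa _ n(1) vw, of "\<i> * complex_of_real y"]) (use y lim in \<open>auto simp: n(2) eq\<close>)
  then have "(\<lambda>n. y\<^sup>2 * Re (cinner (x n) (vn n))) \<longlonglongrightarrow> y\<^sup>2 * Re (cinner x0 v)"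
    by (intro tendsto_intros tendsto_cinner lim)
  then show ?thesis
    by (rule LIMSEQ_le_const2) (use resolvent_form_bound(1)[OF sa nn xh n] bd order_trans in blast)
qed

text \<open>The limits x0 of images A x with bounded form make up the range of the square root of A;
  the resolvent expression passes to such limits by continuity.\<close>

lemma form_range_bound:
  assumes sa: "self_adjoint S A" and S: "hilbert_subspace S" and nn: "nonneg_op A"
    and xh: "\<And>n. (x n, h n) \<in> A" and bd: "\<And>n. Re (cinner (x n) (h n)) \<le> C" and lim: "h \<longlonglongrightarrow> x0"
    and vw: "(v, w) \<in> A" and eq: "w - (\<i> * complex_of_real y) *\<^sub>C v = x0" and y: "y > 0"
  shows "Re (cinner x0 v) + Im (cinner x0 v) \<le> 2 * C"
proof -
  note op = self_adjoint_operator_in[OF sa]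
  let ?z = "\<i> * complex_of_real y"
  have "\<forall>n. \<exists>v w. (v, w) \<in> A \<and> w - ?z *\<^sub>C v = x n"
    using self_adjoint_resolvent[OF sa S, of "\<i> * complex_of_real y"] y operator_in_mem[OF op xh] by (metis Im_i_times Re_complex_of_real less_irrefl)
  then obtain vn wn where n: "\<And>n. (vn n, wn n) \<in> A" "\<And>n. wn n - ?z *\<^sub>C vn n = x n"
    by metis
  \<comment> \<open>wn n = A (A - i y)^-1 (x n) = (A - i y)^-1 (h n), so convergence of h carries
    over to wn.\<close>
  have w: "(wn n, h n + ?z *\<^sub>C wn n) \<in> A" for n
  proof -
    have "wn n = x n + ?z *\<^sub>C vn n" using n(2)[of n] by (simp add: algebra_simps)
    then show ?thesis using operator_in_add[OF op xh operator_in_scale[OF op n(1), of ?z n]] by metis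
  qed
  have "wn \<longlonglongrightarrow> v"
    by (rule resolvent_tendsto[OF sa _ w vw, of ?z]) (use y lim in \<open>auto simp: eq\<close>)
  then have "(\<lambda>n. Re (cinner (h n) (wn n)) + Im (cinner (h n) (wn n))) \<longlonglongrightarrow> Re (cinner x0 v) + Im (cinner x0 v)"
    by (intro tendsto_intros tendsto_cinner lim)
  moreover have "Re (cinner (h n) (wn n)) + Im (cinner (h n) (wn n)) \<le> 2 * C" for n
    using resolvent_form_bound(2)[OF sa nn xh[of n] n(1)[of n] n(2)[of n]] bd[of n] y by linarith
  ultimately show ?thesis by (intro LIMSEQ_le_const2) blast+
qed

section \<open>The symmetric operator of a realization and its extensions\<close>

text \<open>\<open>nodom\<close> is the abstract form of infinite mass; it is the source of the
  density of \<open>Hdot\<close>.\<close>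

locale realization =
  fixes S :: "'h::chilbert_space set" and H :: "'h rel" and V :: "'n::chilbert_space \<Rightarrow> 'h"
  assumes S: "hilbert_subspace S" and sa: "self_adjoint S H" and V: "clinear V"
    and iso: "\<And>x y. cinner (V x) (V y) = cinner x y" and VS: "\<And>x. V x \<in> S"
    and nodom: "\<And>x g. (V x, g) \<in> H \<Longrightarrow> x = 0"
begin

lemmas op = self_adjoint_operator_in[OF sa]

lemma csub: "csubspace S" and clS: "closed S"
  using S by (auto simp: hilbert_subspace_def)

lemma V_add: "V (x + y) = V x + V y" and V_scale: "V (c *\<^sub>C x) = c *\<^sub>C V x"
  using V by (auto simp: clinear_def)

lemma V_diff: "V (x - y) = V x - V y"
  using V_add[of x "(-1) *\<^sub>C y"] V_scale[of "-1" y] by (simp add: scaleC_minus_one)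

lemma V_zero: "V 0 = 0"
  using V_diff[of 0 0] by simp

lemma V_norm: "norm (V x) = norm x"
proof -
  have "(norm (V x))\<^sup>2 = (norm x)\<^sup>2" using iso[of x x] by (metis Re_cinner_self)
  then show ?thesis by (simp add: power2_eq_iff_nonneg)
qed

lemma csub_range: "csubspace (range V)"
  unfolding csubspace_def
proof (intro conjI ballI allI)
  show "0 \<in> range V" using V_zero by (metis rangeI)
  show "x + y \<in> range V" if "x \<in> range V" "y \<in> range V" for x y
    using that V_add by (metis (no_types, lifting) imageE rangeI)
  show "c *\<^sub>C x \<in> range V" if "x \<in> range V" for c x
    using that V_scale by (metis (no_types, lifting) imageE rangeI)
qed

lemma closed_range: "closed (range V)"
  unfolding closed_sequential_limits
proof (intro allI impI, elim conjE)
  fix y l assume y: "\<forall>n. y n \<in> range V" and yl: "y \<longlonglongrightarrow> l"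
  define x where "x n = inv V (y n)" for n
  have x: "y n = V (x n)" for n unfolding x_def using y by (simp add: f_inv_into_f)
  have "Cauchy x"
    using LIMSEQ_imp_Cauchy[OF yl] by (simp add: Cauchy_def dist_norm x V_diff[symmetric] V_norm)
  then obtain x0 where x0: "x \<longlonglongrightarrow> x0" using convergent_def convergent_eq_Cauchy by blast
  then have "(\<lambda>n. norm (V (x n) - V x0)) \<longlonglongrightarrow> 0"
    by (simp add: V_diff[symmetric] V_norm tendsto_norm_zero_iff LIM_zero_iff)
  then have "y \<longlonglongrightarrow> V x0" by (simp add: x[symmetric] tendsto_norm_zero_iff LIM_zero_iff)
  then show "l \<in> range V" using LIMSEQ_unique[OF yl] by blast
qed

lemma double_complement:
  assumes x: "x \<in> S" and orth: "\<And>k. k \<in> S \<Longrightarrow> (\<And>\<xi>. cinner (V \<xi>) k = 0) \<Longrightarrow> cinner x k = 0"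
  shows "x \<in> range V"
proof -
  obtain p where p: "p \<in> range V" "\<And>k. k \<in> range V \<Longrightarrow> cinner k (x - p) = 0"
    using projection_exists[OF csub_range closed_range, of x] by blast
  have "x - p \<in> S" using csubspace_diff[OF csub x] VS p(1) by blast
  then have "cinner x (x - p) = 0" using orth p(2) by blast
  moreover have "cinner p (x - p) = 0" using p by blast
  ultimately have "cinner (x - p) (x - p) = 0" by (simp add: cinner.diff_left)
  then show ?thesis using p(1) by simp
qed

text \<open>The sign is forced: the eigenspace of the adjoint for i is the orthogonal complement of
  the range of \<open>Hdot\<close> + i, so prescribing that range as the complement of
  \<open>range V\<close> makes \<open>range V\<close> the deficiency subspace.\<close>

definition Hdot :: "'h rel" where
  "Hdot = {(f, g) \<in> H. \<forall>\<xi>. cinner (V \<xi>) (g + \<i> *\<^sub>C f) = 0}"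

lemma Hdot_sub: "Hdot \<subseteq> H"
  by (auto simp: Hdot_def)

lemma Hdot_orth: "(f, g) \<in> Hdot \<Longrightarrow> cinner (V \<xi>) (g + \<i> *\<^sub>C f) = 0"
  by (auto simp: Hdot_def)

lemma Hdot_op: "operator_in S Hdot"
  unfolding operator_in_def
proof (intro conjI allI impI)
  show "Hdot \<subseteq> S \<times> S" "single_valued Hdot" using op Hdot_sub
    by (auto simp: operator_in_def intro: single_valued_subset)
  show "(0, 0) \<in> Hdot" using op by (auto simp: operator_in_def Hdot_def scaleC.zero_right cinner.zero_right)
next
  fix f g u v assume "(f, g) \<in> Hdot" "(u, v) \<in> Hdot"
  then show "(f + u, g + v) \<in> Hdot"
    using operator_in_add[OF op, of f g u v]
    by (auto simp: Hdot_def scaleC_add_right cinner_add_right algebra_simps)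
next
  fix c f g assume "(f, g) \<in> Hdot"
  moreover have "c *\<^sub>C g + \<i> *\<^sub>C c *\<^sub>C f = c *\<^sub>C (g + \<i> *\<^sub>C f)"
    by (simp add: scaleC_add_right scaleC_scaleC mult.commute)
  ultimately show "(c *\<^sub>C f, c *\<^sub>C g) \<in> Hdot"
    using operator_in_scale[OF op, of f g c] by (auto simp: Hdot_def cinner_scaleC_right)
qed

lemma Hdot_range:
  assumes "k \<in> S" "\<And>\<xi>. cinner (V \<xi>) k = 0"
  obtains f g where "(f, g) \<in> Hdot" "g + \<i> *\<^sub>C f = k"
proof -
  obtain f g where fg: "(f, g) \<in> H" "g - (- \<i>) *\<^sub>C f = k"
    using self_adjoint_resolvent[OF sa S _ assms(1), of "- \<i>"] by auto
  then have "g + \<i> *\<^sub>C f = k" by (simp add: scaleC.minus_left)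
  then show ?thesis using fg(1) assms(2) by (intro that[of f g]) (auto simp: Hdot_def)
qed

lemma Hdot_adjoint_sup: "H \<subseteq> op_adjoint S Hdot"
  using self_adjoint_sym[OF sa] Hdot_sub operator_in_mem[OF op] by (auto simp: op_adjoint_def)

lemma op_adjointD: "(f, g) \<in> op_adjoint S A \<Longrightarrow> (u, v) \<in> A \<Longrightarrow> cinner f v = cinner g u"
  by (auto simp: op_adjoint_def)

lemma closed_Hdot: "closed Hdot"
proof -
  have "Hdot = H \<inter> (\<Inter>\<xi>. {p. cinner (V \<xi>) (snd p + \<i> *\<^sub>C fst p) = 0})"
    by (auto simp: Hdot_def)
  moreover have "closed {p :: 'h \<times> 'h. cinner (V \<xi>) (snd p + \<i> *\<^sub>C fst p) = 0}" for \<xi>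
    by (intro closed_Collect_eq cinner.continuous_on scaleC.continuous_on continuous_intros)
  moreover have "closed H" using closed_op_adjoint[OF clS, of H] sa by (simp add: self_adjoint_def)
  ultimately show ?thesis by (auto intro!: closed_Int closed_INT)
qed

text \<open>For h orthogonal to the domain of \<open>Hdot\<close> put u = (H - i)^-1 h. Then (u, (H
  + i) f) = (h, f) = 0 on that domain, so u lies in \<open>range V\<close> and in the domain of H,
  and \<open>nodom\<close> gives u = 0.\<close>

lemma dense_Hdot: "densely_defined S Hdot"
  unfolding densely_defined_def
proof
  fix x assume x: "x \<in> S"
  have DS: "closure (Domain Hdot) \<subseteq> S"
    using operator_in_mem[OF Hdot_op] by (intro closure_minimal[OF _ clS]) auto
  obtain p where p: "p \<in> closure (Domain Hdot)" "\<And>k. k \<in> closure (Domain Hdot) \<Longrightarrow> cinner k (x - p) = 0"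
    using projection_exists[OF csubspace_closure[OF operator_in_Domain[OF Hdot_op]] closed_closure, of x] by blast
  define h where "h = x - p"
  have hS: "h \<in> S" unfolding h_def using csubspace_diff[OF csub x] DS p(1) by blast
  obtain u v where uv: "(u, v) \<in> H" "v - \<i> *\<^sub>C u = h"
    using self_adjoint_resolvent[OF sa S _ hS, of "\<i>"] by auto
  have "u \<in> range V"
  proof (rule double_complement)
    show "u \<in> S" using operator_in_mem[OF op uv(1)] by simp
    fix k assume k: "k \<in> S" "\<And>\<xi>. cinner (V \<xi>) k = 0"
    obtain f g where fg: "(f, g) \<in> Hdot" "g + \<i> *\<^sub>C f = k" using Hdot_range[OF k] by blast
    have "f \<in> closure (Domain Hdot)" using fg(1) closure_subset by blast
    then have "cinner f h = 0" using p(2) by (simp add: h_def)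
    then have "cinner h f = 0" by (simp add: cinner_orth_sym[of h])
    moreover have "cinner u g = cinner v f" using self_adjoint_sym[OF sa uv(1)] fg(1) Hdot_sub by blast
    ultimately show "cinner u k = 0"
      by (simp add: fg(2)[symmetric] uv(2)[symmetric] cinner_add_right cinner_scaleC_right cinner.diff_left cinner_scaleC_left)
  qed
  then obtain \<xi> where "u = V \<xi>" by blast
  then have "\<xi> = 0" using nodom uv(1) by blast
  then have "u = 0" using \<open>u = V \<xi>\<close> V_zero by simp
  then have "v = 0" using uv(1) op by (auto simp: operator_in_def single_valued_def)
  then have "h = 0" using uv(2) \<open>u = 0\<close> by (simp add: scaleC.zero_right)
  then show "x \<in> closure (Domain Hdot)" using p(1) by (simp add: h_def)
qed

lemma Hdot_dd: "dd_closed_symmetric S Hdot"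
  unfolding dd_closed_symmetric_def
  using Hdot_op dense_Hdot closed_Hdot Hdot_sub Hdot_adjoint_sup by blast

lemma deficiency: "deficiency_plus S Hdot = range V"
proof (intro set_eqI iffI)
  fix f assume "f \<in> deficiency_plus S Hdot"
  then have f: "(f, \<i> *\<^sub>C f) \<in> op_adjoint S Hdot" by (simp add: deficiency_plus_def)
  show "f \<in> range V"
  proof (rule double_complement)
    show "f \<in> S" using f by (simp add: op_adjoint_def)
    fix k assume k: "k \<in> S" "\<And>\<xi>. cinner (V \<xi>) k = 0"
    obtain u v where uv: "(u, v) \<in> Hdot" "v + \<i> *\<^sub>C u = k" using Hdot_range[OF k] by blast
    show "cinner f k = 0" using op_adjointD[OF f uv(1)]
      by (simp add: uv(2)[symmetric] cinner_add_right cinner_scaleC_right cinner_scaleC_left)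
  qed
next
  fix f assume "f \<in> range V"
  then obtain \<xi> where f: "f = V \<xi>" by blast
  have "cinner f v = cinner (\<i> *\<^sub>C f) u" if "(u, v) \<in> Hdot" for u v
    using Hdot_orth[OF that, of \<xi>] by (simp add: f cinner_add_right cinner_scaleC_right cinner_scaleC_left add_eq_0_iff)
  then show "f \<in> deficiency_plus S Hdot"
    using VS csubspace_scale[OF csub] by (auto simp: deficiency_plus_def op_adjoint_def f)
qed

lemma unitary: "unitary_onto V (deficiency_plus S Hdot)"
  using V iso by (simp add: unitary_onto_def deficiency)

text \<open>Paired with V u the projection onto \<open>range V\<close> disappears, so the scalar
  identity in the hypothesis determines M.\<close>

lemma realization_eq:
  assumes z: "Im z \<noteq> 0"
    and M: "\<And>\<xi> f g u. (f, g) \<in> H \<Longrightarrow> g - z *\<^sub>C f = V \<xi> \<Longrightarrow>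
      (1 + z\<^sup>2) * cinner (V u) f = cinner u (M \<xi>) - z * cinner u \<xi>"
  shows "M = Herglotz_realization H (deficiency_plus S Hdot) V z"
proof
  fix \<xi>
  obtain f g where fg: "(f, g) \<in> H" "g - z *\<^sub>C f = V \<xi>"
    using self_adjoint_resolvent[OF sa S z VS] by blast
  have res: "op_resolvent H z (V \<xi>) = f"
    unfolding op_resolvent_def
  proof (rule the_equality)
    fix u assume "\<exists>v. (u, v) \<in> H \<and> v - z *\<^sub>C u = V \<xi>"
    then obtain v where v: "(u, v) \<in> H" "v - z *\<^sub>C u = V \<xi>" by blast
    have "\<bar>Im z\<bar> * norm (u - f) \<le> norm ((v - g) - z *\<^sub>C (u - f))"
      by (rule self_adjoint_lower_bound[OF sa operator_in_diff[OF op v(1) fg(1)]])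
    also have "(v - g) - z *\<^sub>C (u - f) = (v - z *\<^sub>C u) - (g - z *\<^sub>C f)" by (simp add: scaleC.diff_right)
    also have "\<dots> = 0" by (simp add: v(2) fg(2))
    finally have "\<bar>Im z\<bar> * norm (u - f) \<le> 0" by simp
    then show "u = f" using z by (simp add: mult_le_0_iff)
  qed (use fg in blast)
  have proj_V: "orth_proj (range V) (V \<xi>) = V \<xi>"
    by (rule orth_proj_eqI[OF _ csub_range]) (auto simp: cinner.zero_right)
  have eq: "(1 + z\<^sup>2) *\<^sub>C orth_proj (range V) f = V (M \<xi> - z *\<^sub>C \<xi>)"
  \<comment> \<open>At z = i and z = -i one cannot divide by 1 + z^2; there the hypothesis already
    says M \<xi> = z \<xi>.\<close>
  proof (cases "1 + z\<^sup>2 = 0")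
    case True
    then have "cinner u (M \<xi>) = cinner u (z *\<^sub>C \<xi>)" for u using M[OF fg, of u] by (simp add: cinner_scaleC_right)
    then have "M \<xi> = z *\<^sub>C \<xi>" by (rule cinner_eqI)
    then show ?thesis by (simp only: True scaleC.zero_left V_zero diff_self)
  next
    case False
    have "orth_proj (range V) f = V ((1 / (1 + z\<^sup>2)) *\<^sub>C (M \<xi> - z *\<^sub>C \<xi>))"
    proof (rule orth_proj_eqI[OF _ csub_range])
      fix k assume "k \<in> range V"
      then obtain u where k: "k = V u" by blast
      show "cinner k (f - V ((1 / (1 + z\<^sup>2)) *\<^sub>C (M \<xi> - z *\<^sub>C \<xi>))) = 0"
        unfolding cinner.diff_right k iso cinner_scaleC_right M[OF fg, of u, symmetric]
        using False by simp
    qed blast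
    then show ?thesis using False by (simp add: V_scale scaleC_scaleC)
  qed
  have "Herglotz_realization H (deficiency_plus S Hdot) V z \<xi> = cadjoint V (V (M \<xi>))"
    by (simp only: Herglotz_realization_def deficiency proj_V res eq) (simp add: V_diff V_scale)
  also have "\<dots> = M \<xi>" by (rule cadjoint_eqI) (rule iso)
  finally show "M \<xi> = Herglotz_realization H (deficiency_plus S Hdot) V z \<xi>" by simp
qed

text \<open>By \<open>form_domain_bound\<close>, unboundedness of this resolvent expression keeps V
  \<xi> out of the form domain of a nonnegative H.\<close>

definition form_condition :: bool where
  "form_condition \<longleftrightarrow> (\<forall>\<xi> C. \<xi> \<noteq> 0 \<longrightarrow> (\<exists>y>0. \<forall>f g. (f, g) \<in> H \<longrightarrow>
    g - (\<i> * complex_of_real y) *\<^sub>C f = V \<xi> \<longrightarrow> C < y\<^sup>2 * Re (cinner (V \<xi>) f)))"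

text \<open>The counterpart for the range of the square root of H, matched to
  \<open>form_range_bound\<close>.\<close>

definition range_condition :: bool where
  "range_condition \<longleftrightarrow> (\<forall>\<xi> C. \<xi> \<noteq> 0 \<longrightarrow> (\<exists>y>0. \<forall>f g. (f, g) \<in> H \<longrightarrow>
    g - (\<i> * complex_of_real y) *\<^sub>C f = V \<xi> \<longrightarrow> C < Re (cinner (V \<xi>) f) + Im (cinner (V \<xi>) f)))"

end

section \<open>Approximation from the symmetric operator in the nonnegative case\<close>

locale nonneg_realization = realization S H V
  for S :: "'h::chilbert_space set" and H :: "'h rel" and V :: "'n::chilbert_space \<Rightarrow> 'h" +
  assumes nn: "nonneg_op H"
begin

lemma Hdot_nonneg: "nonneg_op Hdot"
  using nn Hdot_sub by (auto simp: nonneg_op_def)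

text \<open>By von Neumann's formula \<open>ker (Hdot\<^sup>* + 1) = (H - \<i>) (H + 1)\<^sup>-\<^sup>1 (range V)\<close>.\<close>

lemma kernel_decomposition:
  assumes w: "w \<in> S" and orth: "\<And>f g. (f, g) \<in> Hdot \<Longrightarrow> cinner w (f + g) = 0"
  obtains p q \<xi> where "(p, q) \<in> H" "q - \<i> *\<^sub>C p = w" "V \<xi> = w + (1 + \<i>) *\<^sub>C p" "\<xi> = 0 \<Longrightarrow> w = 0"
proof -
  obtain p q where pq: "(p, q) \<in> H" "q - \<i> *\<^sub>C p = w"
    using self_adjoint_resolvent[OF sa S _ w, of \<i>] by auto
  have pS: "p \<in> S" using operator_in_mem[OF op pq(1)] by simp
  \<comment> \<open>This vector is (H + 1) p. Its inner product with (\<open>Hdot\<close> + i) f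
    works out to (w, f + g), which vanishes.\<close>
  have "w + (1 + \<i>) *\<^sub>C p \<in> range V"
  proof (rule double_complement)
    show "w + (1 + \<i>) *\<^sub>C p \<in> S" using csubspace_add[OF csub w csubspace_scale[OF csub pS]] .
    fix k assume k: "k \<in> S" "\<And>\<xi>. cinner (V \<xi>) k = 0"
    obtain f g where fg: "(f, g) \<in> Hdot" "g + \<i> *\<^sub>C f = k" using Hdot_range[OF k] by blast
    have "cinner p g = cinner q f" using self_adjoint_sym[OF sa pq(1)] fg(1) Hdot_sub by blast
    then have "cinner p k = cinner w f"
      by (simp add: fg(2)[symmetric] pq(2)[symmetric] cinner_add_right cinner_scaleC_right cinner.diff_left cinner_scaleC_left)
    then have "cinner (w + (1 + \<i>) *\<^sub>C p) k = cinner w (f + g)"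
      by (simp add: cinner_add_left cinner_scaleC_left)
       (simp add: fg(2)[symmetric] cinner_add_right cinner_scaleC_right algebra_simps)
    then show "cinner (w + (1 + \<i>) *\<^sub>C p) k = 0" using orth[OF fg(1)] by simp
  qed
  then obtain \<xi> where \<xi>: "V \<xi> = w + (1 + \<i>) *\<^sub>C p" by (metis imageE)
  have imp: "w = 0" if "\<xi> = 0"
  proof -
    \<comment> \<open>Here (H + 1) p = 0, which for nonnegative H leaves only p = 0.\<close>
    have w: "w = - ((1 + \<i>) *\<^sub>C p)" using \<xi> that V_zero by (simp add: eq_neg_iff_add_eq_0)
    then have "q = - p" using pq(2) by (simp add: scaleC_add_left algebra_simps)
    then have "Re (cinner p q) = - (norm p)\<^sup>2" by (simp add: cinner.minus_right Re_cinner_self)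
    then have "p = 0" using nonneg_opD[OF nn pq(1)] by simp
    then show ?thesis using w by (simp add: scaleC.zero_right)
  qed
  show ?thesis by (rule that[OF pq \<xi> imp])
qed

lemma form_bounded:
  fixes f g :: "nat \<Rightarrow> 'h"
  assumes fg: "\<And>n. (f n, g n) \<in> H"
    and cau: "\<And>e. e > 0 \<Longrightarrow> \<exists>N. \<forall>m\<ge>N. \<forall>n\<ge>N. Re (cinner (f n - f m) (g n - g m)) < e"
  obtains N C where "\<And>n. n \<ge> N \<Longrightarrow> Re (cinner (f n) (g n)) \<le> C"
proof -
  obtain N where N: "\<forall>m\<ge>N. \<forall>n\<ge>N. Re (cinner (f n - f m) (g n - g m)) < 1"
    using cau[OF zero_less_one] by blast
  have "Re (cinner (f n) (g n)) \<le> 2 + 2 * Re (cinner (f N) (g N))" if "n \<ge> N" for n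
  proof -
    \<comment> \<open>The sum of f n - f N and f N is written as a difference, the shape bounded by
      \<open>form_parallelogram_le\<close>.\<close>
    have m: "(- f N, - g N) \<in> H"
      using operator_in_scale[OF op fg[of N], of "-1"] by (simp add: scaleC_minus_one)
    have "Re (cinner (f n - f N - - f N) (g n - g N - - g N))
      \<le> 2 * Re (cinner (f n - f N) (g n - g N)) + 2 * Re (cinner (- f N) (- g N))"
      by (rule form_parallelogram_le[OF op nn operator_in_diff[OF op fg fg] m])
    moreover have "Re (cinner (f n - f N) (g n - g N)) < 1" using N that by simp
    ultimately show ?thesis by (simp add: cinner.minus_left cinner.minus_right)
  qed
  then show ?thesis by (rule that)
qed

lemma form_add_bounded:
  assumes fg: "(f, g) \<in> H" and bd: "Re (cinner f g) \<le> C" and pq: "(p, q) \<in> H"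
  shows "(f + p, g + q) \<in> H" "Re (cinner (f + p) (g + q)) \<le> 2 * C + 2 * Re (cinner p q)"
proof -
  have m: "(- p, - q) \<in> H"
    using operator_in_scale[OF op pq, of "-1"] by (simp add: scaleC_minus_one)
  show "Re (cinner (f + p) (g + q)) \<le> 2 * C + 2 * Re (cinner p q)"
    using form_parallelogram_le[OF op nn fg m] bd by (simp add: cinner.minus_left cinner.minus_right)
qed (rule operator_in_add[OF op fg pq])

lemma orth_Hdot_Re:
  assumes R: "\<And>f g. (f, g) \<in> Hdot \<Longrightarrow> Re (cinner w (f + g)) = 0" and fg: "(f, g) \<in> Hdot"
  shows "cinner w (f + g) = 0"
proof (rule complex_eqI)
  have "Re (cinner w (\<i> *\<^sub>C f + \<i> *\<^sub>C g)) = 0" by (rule R[OF operator_in_scale[OF Hdot_op fg]])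
  then show "Im (cinner w (f + g)) = Im 0"
    by (simp add: cinner_add_right cinner_scaleC_right)
qed (use R[OF fg] in simp)

lemma Hdot_subspace: "subspace Hdot"
  by (rule operator_in_subspace[OF Hdot_op])

lemma H_subspace: "subspace H"
  by (rule operator_in_subspace[OF op])

text \<open>The cases \<open>s = fst\<close> and \<open>s = snd\<close> lead to the Friedrichs and to the Krein extension. The proof
  projects \<open>(u, v)\<close> onto \<open>Hdot\<close> with respect to the inner product
  \<open>(s p, s q) + (fst p, snd q)\<close> on \<open>H\<close>.\<close>

lemma form_approximation:
  assumes s: "s = fst \<or> s = snd" and uv: "(u, v) \<in> H"
    and no_lim: "\<And>\<xi> x h C. \<xi> \<noteq> 0 \<Longrightarrow> (\<And>n::nat. (x n, h n) \<in> H) \<Longrightarrow> (\<And>n. Re (cinner (x n) (h n)) \<le> C) \<Longrightarrow>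
      \<not> (\<lambda>n. s (x n, h n)) \<longlonglongrightarrow> V \<xi>"
  shows "\<exists>f g. (\<forall>n. (f n, g n) \<in> Hdot) \<and> (\<lambda>n. s (f n, g n)) \<longlonglongrightarrow> s (u, v) \<and> form_Cauchy Hdot f \<and>
    (\<lambda>n. Re (cinner (u - f n) (v - g n))) \<longlonglongrightarrow> 0"
proof -
  define b :: "'h \<times> 'h \<Rightarrow> 'h \<times> 'h \<Rightarrow> real"
    where "b p q = Re (cinner (s p) (s q)) + Re (cinner (fst p) (snd q))" for p q
  have s_lin: "s (x + y) = s x + s y" "s (r *\<^sub>R x) = r *\<^sub>R s x" "s (x - y) = s x - s y" for x y r
    using s by auto
  have b_add: "b (x + y) z = b x z + b y z" "b z (x + y) = b z x + b z y" for x y z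
    by (simp_all add: b_def s_lin cinner_add_left cinner_add_right)
  have b_scale: "b (r *\<^sub>R x) y = r * b x y" "b x (r *\<^sub>R y) = r * b x y" for r x y
    by (simp_all add: b_def s_lin cinner_scaleR_left cinner_scaleR_right algebra_simps)
  have sym: "cinner (fst x) (snd y) = cinner (snd x) (fst y)" if "x \<in> H" "y \<in> H" for x y
    using self_adjoint_sym[OF sa, of "fst x" "snd x" "fst y" "snd y"] that by simp
  have b_sym: "b x y = b y x" if "x \<in> H" "y \<in> H" for x y
    using sym[OF that] Re_cinner_commute[of "s x" "s y"] Re_cinner_commute[of "snd x" "fst y"]
    by (simp add: b_def)
  have b_pos: "0 \<le> b x x" if "x \<in> H" for x
    using nonneg_opD[OF nn, of "fst x" "snd x"] that by (simp add: b_def Re_cinner_self)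
  have HH: "x \<in> Hdot \<Longrightarrow> x \<in> H" for x using Hdot_sub by blast
  obtain P where P: "\<And>n. P n \<in> Hdot"
    and cau: "\<And>e. e > 0 \<Longrightarrow> \<exists>N. \<forall>m\<ge>N. \<forall>n\<ge>N. b (P n - P m) (P n - P m) < e"
    and lim: "\<And>x. x \<in> Hdot \<Longrightarrow> (\<lambda>n. b (P n) x) \<longlonglongrightarrow> b (u, v) x"
  proof (rule semi_Riesz[of Hdot b "b (u, v)" "b (u, v) (u, v)", OF Hdot_subspace])
    \<comment> \<open>The functional to be represented is b against (u, v); Cauchy-Schwarz on the
      larger graph H bounds it.\<close>
    show "(b (u, v) x)\<^sup>2 \<le> b (u, v) (u, v) * b x x" if "x \<in> Hdot" for x
      by (rule semi_Cauchy_Schwarz[OF H_subspace uv HH[OF that]]) (use b_add b_scale b_sym b_pos in auto)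
  qed (use b_add b_scale b_sym b_pos HH uv in auto)
  define f where "f n = fst (P n)" for n
  define g where "g n = snd (P n)" for n
  have fg: "(f n, g n) \<in> Hdot" and Pn: "P n = (f n, g n)" for n using P by (simp_all add: f_def g_def)
  have fgH: "(f n, g n) \<in> H" for n using fg Hdot_sub by blast
  have bd: "b (P n - P m) (P n - P m)
      = (norm (s (f n, g n) - s (f m, g m)))\<^sup>2 + Re (cinner (f n - f m) (g n - g m))" for n m
    by (simp add: b_def Pn s_lin[symmetric] Re_cinner_self)
  have pos: "0 \<le> Re (cinner (f n - f m) (g n - g m))" for n m
    by (rule nonneg_opD[OF nn operator_in_diff[OF op fgH fgH]])
  have cauf: "\<exists>N. \<forall>m\<ge>N. \<forall>n\<ge>N. Re (cinner (f n - f m) (g n - g m)) < e" if "e > 0" for e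
    using cau[OF that] unfolding bd by (meson add_increasing le_less_trans order_refl zero_le_power2)
  have "Cauchy (\<lambda>n. s (f n, g n))"
    by (rule Cauchy_norm_sqI) (use cau pos in \<open>unfold bd, meson add_increasing2 le_less_trans order_refl\<close>)
  then obtain l where l: "(\<lambda>n. s (f n, g n)) \<longlonglongrightarrow> l" using convergent_def convergent_eq_Cauchy by blast
  \<comment> \<open>w is the part of s (u, v) that is not reached from \<open>Hdot\<close>; the aim
    is w = 0.\<close>
  define w where "w = s (u, v) - l"
  have sS: "s (x, y) \<in> S" if "(x, y) \<in> H" for x y using operator_in_mem[OF op that] s by auto
  have "l \<in> S" by (rule closed_sequentially[OF clS sS[OF fgH] l])
  then have wS: "w \<in> S" unfolding w_def using sS[OF uv] csubspace_diff[OF csub] by blast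
  have "Re (cinner w (x + y)) = 0" if xy: "(x, y) \<in> Hdot" for x y
  proof -
    \<comment> \<open>By symmetry of H both choices of s give this expression, so b-orthogonality of
      the residual says that w is orthogonal to the range of \<open>Hdot\<close> + 1.\<close>
    have b: "b p (x, y) = Re (cinner (s p) (x + y))" if "p \<in> H" for p
      using sym[OF that HH[OF xy]] s by (auto simp: b_def cinner_add_right)
    have "(\<lambda>n. Re (cinner (s (f n, g n)) (x + y))) \<longlonglongrightarrow> Re (cinner l (x + y))"
      by (intro tendsto_Re tendsto_cinner l tendsto_const)
    moreover have "(\<lambda>n. Re (cinner (s (f n, g n)) (x + y))) \<longlonglongrightarrow> Re (cinner (s (u, v)) (x + y))"
      using lim[OF xy] by (simp add: b[OF uv] b[OF fgH] Pn)
    ultimately have "Re (cinner (s (u, v)) (x + y)) = Re (cinner l (x + y))" by (metis LIMSEQ_unique)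
    then show ?thesis by (simp add: w_def cinner.diff_left)
  qed
  then have orth: "cinner w (x + y) = 0" if "(x, y) \<in> Hdot" for x y using orth_Hdot_Re that by blast
  have wn: "(u - f n, v - g n) \<in> H" for n by (rule operator_in_diff[OF op uv fgH])
  have wl: "(\<lambda>n. s (u - f n, v - g n)) \<longlonglongrightarrow> w"
  proof -
    have "s (u - f n, v - g n) = s (u, v) - s (f n, g n)" for n by (simp add: s_lin[symmetric])
    then show ?thesis unfolding w_def by (simp only:) (intro tendsto_intros l)
  qed
  have diff: "u - f n - (u - f m) = f m - f n" "v - g n - (v - g m) = g m - g n" for n m by simp_all
  have cauw: "\<exists>N. \<forall>m\<ge>N. \<forall>n\<ge>N. Re (cinner (u - f n - (u - f m)) (v - g n - (v - g m))) < e" if "e > 0" for e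
    using cauf[OF that] unfolding diff by blast
  obtain p q \<xi> where pq: "(p, q) \<in> H" "q - \<i> *\<^sub>C p = w" "V \<xi> = w + (1 + \<i>) *\<^sub>C p" "\<xi> = 0 \<Longrightarrow> w = 0"
    using kernel_decomposition[OF wS orth] by blast
  \<comment> \<open>Up to the unit factor c and an element of H, V \<xi> is w itself. For s = fst
    this reads V \<xi> = w + (1 + i) p; for s = snd, inserting q = w + i p gives V \<xi> = i w + (1
    - i) q.\<close>
  have "\<exists>c x y. (x, y) \<in> H \<and> cnj c * c = 1 \<and> c *\<^sub>C w + s (x, y) = V \<xi>"
    using s
  proof
    assume "s = fst"
    then show ?thesis
      using operator_in_scale[OF op pq(1), of "1 + \<i>"] pq(3)
      by (intro exI[of _ 1] exI[of _ "(1 + \<i>) *\<^sub>C p"] exI[of _ "(1 + \<i>) *\<^sub>C q"]) simp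
  next
    assume "s = snd"
    moreover have "q = w + \<i> *\<^sub>C p" using pq(2) by (simp add: algebra_simps)
    then have "\<i> *\<^sub>C w + (1 - \<i>) *\<^sub>C q = (\<i> + (1 - \<i>)) *\<^sub>C w + ((1 - \<i>) * \<i>) *\<^sub>C p"
      by (simp only: scaleC_add_right scaleC_add_left scaleC_scaleC add.assoc)
    then have "\<i> *\<^sub>C w + (1 - \<i>) *\<^sub>C q = V \<xi>" by (simp add: pq(3) algebra_simps)
    ultimately show ?thesis
      using operator_in_scale[OF op pq(1), of "1 - \<i>"]
      by (intro exI[of _ \<i>] exI[of _ "(1 - \<i>) *\<^sub>C p"] exI[of _ "(1 - \<i>) *\<^sub>C q"]) simp
  qed
  then obtain c x y where cxy: "(x, y) \<in> H" "cnj c * c = 1" "c *\<^sub>C w + s (x, y) = V \<xi>" by blast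
  have "\<xi> = 0"
  proof (rule ccontr)
    assume \<xi>: "\<xi> \<noteq> 0"
    obtain N C where NC: "\<And>n. n \<ge> N \<Longrightarrow> Re (cinner (u - f n) (v - g n)) \<le> C"
      using form_bounded[of "\<lambda>n. u - f n" "\<lambda>n. v - g n", OF wn cauw] by blast
    have wc: "(c *\<^sub>C (u - f n), c *\<^sub>C (v - g n)) \<in> H" for n by (rule operator_in_scale[OF op wn])
    have NCc: "Re (cinner (c *\<^sub>C (u - f n)) (c *\<^sub>C (v - g n))) \<le> C" if "n \<ge> N" for n
    proof -
      have "cinner (c *\<^sub>C (u - f n)) (c *\<^sub>C (v - g n)) = (cnj c * c) * cinner (u - f n) (v - g n)"
        by (simp only: cinner_scaleC_left cinner_scaleC_right mult_ac)
      then show ?thesis using NC[OF that] by (simp only: cxy(2) mult_1)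
    qed
    \<comment> \<open>These elements of H have bounded form, yet their s-components tend to c w + s
      (x, y) = V \<xi>, against \<open>no_lim\<close>. The shift by N is there because the bound
      holds from N on.\<close>
    have "\<not> (\<lambda>n. s (c *\<^sub>C (u - f (n + N)) + x, c *\<^sub>C (v - g (n + N)) + y)) \<longlonglongrightarrow> V \<xi>"
      by (rule no_lim[OF \<xi>]) (rule form_add_bounded[OF wc NCc cxy(1)], simp)+
    moreover have "s (c *\<^sub>C (u - f n) + x, c *\<^sub>C (v - g n) + y) = c *\<^sub>C s (u - f n, v - g n) + s (x, y)" for n
      using s by auto
    moreover have "(\<lambda>n. c *\<^sub>C s (u - f (n + N), v - g (n + N)) + s (x, y)) \<longlonglongrightarrow> c *\<^sub>C w + s (x, y)"
      by (intro tendsto_intros scaleC.tendsto LIMSEQ_ignore_initial_segment[OF wl])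
    ultimately show False using cxy(3) by simp
  qed
  then have w0: "w = 0" using pq(4) by simp
  have "(\<lambda>n. Re (cinner (u - f n) (v - g n))) \<longlonglongrightarrow> 0"
  proof (rule form_null_sequence[OF sa wn cauw nonneg_opD[OF nn wn]])
    fix n
    \<comment> \<open>With n fixed, the mixed form is continuous in the s-component of the moving
      argument: directly for fst, through symmetry of H for snd.\<close>
    have "\<exists>t. \<forall>m. cinner (u - f m) (v - g n) = cinner (s (u - f m, v - g m)) t"
      using s
    proof
      assume "s = fst" then show ?thesis by (intro exI[of _ "v - g n"]) simp
    next
      assume "s = snd" then show ?thesis
        using self_adjoint_sym[OF sa wn wn] by (intro exI[of _ "u - f n"]) simp
    qed
    then obtain t where t: "\<And>m. cinner (u - f m) (v - g n) = cinner (s (u - f m, v - g m)) t" by blast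
    have "(\<lambda>m. Re (cinner (s (u - f m, v - g m)) t)) \<longlonglongrightarrow> Re (cinner w t)"
      by (intro tendsto_Re tendsto_cinner wl tendsto_const)
    then show "(\<lambda>m. Re (cinner (u - f m) (v - g n))) \<longlonglongrightarrow> 0" by (simp add: t w0 cinner.zero_left)
  qed
  moreover have "l = s (u, v)" using w0 by (simp add: w_def)
  moreover have "form_Cauchy Hdot f" by (rule form_CauchyI[OF Hdot_op Hdot_nonneg fg cauf])
  ultimately show ?thesis using fg l by blast
qed

section \<open>Identification of the Friedrichs and Krein extensions\<close>

lemma Friedrichs_approximation:
  assumes F: form_condition and uv: "(u, v) \<in> H"
  shows "\<exists>f g. (\<forall>n. (f n, g n) \<in> Hdot) \<and> f \<longlonglongrightarrow> u \<and> form_Cauchy Hdot f \<and>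
    (\<lambda>n. Re (cinner (u - f n) (v - g n))) \<longlonglongrightarrow> 0"
proof -
  have "\<exists>f g. (\<forall>n. (f n, g n) \<in> Hdot) \<and> (\<lambda>n. fst (f n, g n)) \<longlonglongrightarrow> fst (u, v) \<and> form_Cauchy Hdot f \<and>
    (\<lambda>n. Re (cinner (u - f n) (v - g n))) \<longlonglongrightarrow> 0"
  proof (rule form_approximation[OF disjI1[OF refl] uv], rule notI)
    fix \<xi> :: 'n and x h :: "nat \<Rightarrow> 'h" and C :: real
    assume \<xi>: "\<xi> \<noteq> 0" and xh: "\<And>n::nat. (x n, h n) \<in> H" "\<And>n. Re (cinner (x n) (h n)) \<le> C"
    assume "(\<lambda>n. fst (x n, h n)) \<longlonglongrightarrow> V \<xi>"
    then have l: "x \<longlonglongrightarrow> V \<xi>" by simp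
    obtain y where y: "y > 0" "\<forall>f g. (f, g) \<in> H \<longrightarrow> g - (\<i> * complex_of_real y) *\<^sub>C f = V \<xi> \<longrightarrow>
      C < y\<^sup>2 * Re (cinner (V \<xi>) f)" using F \<xi> unfolding form_condition_def by blast
    obtain a c where ac: "(a, c) \<in> H" "c - (\<i> * complex_of_real y) *\<^sub>C a = V \<xi>"
      using self_adjoint_resolvent[OF sa S _ VS, of "\<i> * complex_of_real y"] y(1) by auto
    show False using form_domain_bound[OF sa S nn xh l ac y(1)] y(2) ac by force
  qed
  then show ?thesis by simp
qed

lemma Krein_approximation:
  assumes K: range_condition and uv: "(u, v) \<in> H"
  shows "\<exists>f g. (\<forall>n. (f n, g n) \<in> Hdot) \<and> g \<longlonglongrightarrow> v \<and> form_Cauchy Hdot f \<and>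
    (\<lambda>n. Re (cinner (u - f n) (v - g n))) \<longlonglongrightarrow> 0"
proof -
  have "\<exists>f g. (\<forall>n. (f n, g n) \<in> Hdot) \<and> (\<lambda>n. snd (f n, g n)) \<longlonglongrightarrow> snd (u, v) \<and> form_Cauchy Hdot f \<and>
    (\<lambda>n. Re (cinner (u - f n) (v - g n))) \<longlonglongrightarrow> 0"
  proof (rule form_approximation[OF disjI2[OF refl] uv], rule notI)
    fix \<xi> :: 'n and x h :: "nat \<Rightarrow> 'h" and C :: real
    assume \<xi>: "\<xi> \<noteq> 0" and xh: "\<And>n::nat. (x n, h n) \<in> H" "\<And>n. Re (cinner (x n) (h n)) \<le> C"
    assume "(\<lambda>n. snd (x n, h n)) \<longlonglongrightarrow> V \<xi>"
    then have l: "h \<longlonglongrightarrow> V \<xi>" by simp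
    \<comment> \<open>The condition is invoked with 2 C because \<open>form_range_bound\<close>
      loses a factor 2.\<close>
    obtain y where y: "y > 0" "\<forall>f g. (f, g) \<in> H \<longrightarrow> g - (\<i> * complex_of_real y) *\<^sub>C f = V \<xi> \<longrightarrow>
      2 * C < Re (cinner (V \<xi>) f) + Im (cinner (V \<xi>) f)" using K \<xi> unfolding range_condition_def by blast
    obtain a c where ac: "(a, c) \<in> H" "c - (\<i> * complex_of_real y) *\<^sub>C a = V \<xi>"
      using self_adjoint_resolvent[OF sa S _ VS, of "\<i> * complex_of_real y"] y(1) by auto
    show False using form_range_bound[OF sa S nn xh l ac y(1)] y(2) ac by force
  qed
  then show ?thesis by simp
qed

text \<open>x is going to be an eigenvector of the adjoint for -1 that is approximated by the
  form-Cauchy sequence d. The mixed form of d m and d n then approaches -|x|^2, but along a Cauchy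
  sequence of a nonnegative form it is almost nonnegative. The limits are assumed weakly so as to
  fit both extensions.\<close>

lemma negative_eigenvector_zero:
  assumes de: "\<And>n. (d n, e n) \<in> Hdot" and cau: "form_Cauchy Hdot d"
    and lim1: "\<And>n. (\<lambda>m. Re (cinner (d m) (e n))) \<longlonglongrightarrow> - Re (cinner x (d n))"
    and lim2: "(\<lambda>n. Re (cinner x (d n))) \<longlonglongrightarrow> (norm x)\<^sup>2"
  shows "x = 0"
proof -
  have deH: "(d n, e n) \<in> H" for n using de Hdot_sub by blast
  have "(norm x)\<^sup>2 \<le> r" if r: "r > 0" for r
  proof -
    obtain N where N: "\<forall>m\<ge>N. \<forall>n\<ge>N. Re (cinner (d n - d m) (e n - e m)) < r"
      using form_CauchyD[OF Hdot_op de cau r] by blast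
    have "- r \<le> - Re (cinner x (d n))" if n: "n \<ge> N" for n
    proof (rule tendsto_lowerbound[OF lim1[of n]])
      show "\<forall>\<^sub>F m in sequentially. - r \<le> Re (cinner (d m) (e n))"
      proof (rule eventually_sequentiallyI[of N])
        fix m assume "m \<ge> N"
        then have "Re (cinner (d n - d m) (e n - e m)) < r" using N n by blast
        moreover have "cinner (d n) (e m) = cinner (e n) (d m)" by (rule self_adjoint_sym[OF sa deH deH])
        ultimately show "- r \<le> Re (cinner (d m) (e n))"
          using nonneg_opD[OF nn deH[of m]] nonneg_opD[OF nn deH[of n]] Re_cinner_commute[of "e n" "d m"] r
          by (simp add: cinner.diff_left cinner.diff_right)
      qed
    qed simp
    then have "\<exists>N. \<forall>n\<ge>N. Re (cinner x (d n)) \<le> r" by fastforce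
    then show ?thesis by (rule LIMSEQ_le_const2[OF lim2])
  qed
  then have "(norm x)\<^sup>2 \<le> 0" by (meson dense_ge)
  then show ?thesis by simp
qed

text \<open>Both pairs have the same sum, so their difference is an eigenvector of the adjoint for
  -1.\<close>

lemma adjoint_diff:
  assumes "(f, g) \<in> op_adjoint S Hdot" "(u, v) \<in> H" "u + v = f + g"
  shows "(f - u, - (f - u)) \<in> op_adjoint S Hdot"
proof -
  have "g - v = - (f - u)" using assms(3) by (simp add: algebra_simps add_eq_0_iff)
  moreover have mem: "(u, v) \<in> op_adjoint S Hdot" using assms(2) Hdot_adjoint_sup by blast
  then have "(f - u, g - v) \<in> op_adjoint S Hdot"
    using assms(1) csubspace_diff[OF csub] op_adjointD[OF assms(1)] op_adjointD[OF mem]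
    unfolding op_adjoint_def by (auto simp: cinner.diff_left)
  ultimately show ?thesis by simp
qed

lemma Domain_seq:
  assumes "range fn \<subseteq> Domain A"
  obtains gn where "\<And>n. (fn n, gn n) \<in> A"
proof -
  have "\<forall>n. \<exists>g. (fn n, g) \<in> A" using assms by blast
  then show ?thesis using that by metis
qed

text \<open>Solve (H + 1) u = f + g. Then f - u is an eigenvector of the adjoint of
  \<open>Hdot\<close> for -1, and subtracting an approximation of u from that of f yields a
  form-Cauchy sequence approximating it in the sense of s, so it vanishes.\<close>

lemma extension_subset:
  assumes s: "s = fst \<or> s = snd" and fg: "(f, g) \<in> op_adjoint S Hdot"
    and fn: "\<And>n. (fn n, gn n) \<in> Hdot" "(\<lambda>n. s (fn n, gn n)) \<longlonglongrightarrow> s (f, g)" "form_Cauchy Hdot fn"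
    and dense: "\<And>u v. (u, v) \<in> H \<Longrightarrow>
      \<exists>un vn. (\<forall>n. (un n, vn n) \<in> Hdot) \<and> (\<lambda>n. s (un n, vn n)) \<longlonglongrightarrow> s (u, v) \<and> form_Cauchy Hdot un"
  shows "(f, g) \<in> H"
proof -
  have "f + g \<in> S" using fg csubspace_add[OF csub] by (auto simp: op_adjoint_def)
  then obtain u v where uv: "(u, v) \<in> H" "u + v = f + g"
    using nonneg_self_adjoint_range[OF sa S nn] by blast
  obtain un vn where un: "\<And>n. (un n, vn n) \<in> Hdot" "(\<lambda>n. s (un n, vn n)) \<longlonglongrightarrow> s (u, v)" "form_Cauchy Hdot un"
    using dense[OF uv(1)] by blast
  define d where "d n = fn n - un n" for n
  define e where "e n = gn n - vn n" for n
  have de: "(d n, e n) \<in> Hdot" for n unfolding d_def e_def by (rule operator_in_diff[OF Hdot_op fn(1) un(1)])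
  have "s (d n, e n) = s (fn n, gn n) - s (un n, vn n)" for n using s by (auto simp: d_def e_def)
  then have "(\<lambda>n. s (d n, e n)) \<longlonglongrightarrow> s (f, g) - s (u, v)" by (simp only:) (intro tendsto_intros fn un)
  moreover have "g - v = - (f - u)" using uv(2) by (simp add: algebra_simps)
  then have "s (f, g) - s (u, v) = s (f - u, - (f - u))" using s by auto
  ultimately have lim: "(\<lambda>n. s (d n, e n)) \<longlonglongrightarrow> s (f - u, - (f - u))" by simp
  have adj: "cinner (f - u) (e n) = - cinner (f - u) (d n)" for n
    using op_adjointD[OF adjoint_diff[OF fg uv] de] by (simp only: cinner.minus_left)
  have sym: "cinner (d m) (e n) = cinner (e m) (d n)" for m n
    using self_adjoint_sym[OF sa] de Hdot_sub by blast
  have "f - u = 0"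
  proof (rule negative_eigenvector_zero[OF de])
    show "form_Cauchy Hdot d"
      unfolding d_def by (rule form_Cauchy_diff[OF Hdot_op Hdot_nonneg fn(1,3) un(1,3)])
    have "(\<lambda>m. cinner (d m) (e n)) \<longlonglongrightarrow> - cinner (f - u) (d n)" for n
      using s
    proof
      assume "s = fst"
      then have "d \<longlonglongrightarrow> f - u" using lim by simp
      from tendsto_cinner[OF this tendsto_const[of "e n"]] show ?thesis by (simp only: adj)
    next
      assume "s = snd"
      then have "e \<longlonglongrightarrow> - (f - u)" using lim by simp
      from tendsto_cinner[OF this tendsto_const[of "d n"]] show ?thesis by (simp only: sym cinner.minus_left)
    qed
    then show "(\<lambda>m. Re (cinner (d m) (e n))) \<longlonglongrightarrow> - Re (cinner (f - u) (d n))" for n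
      using tendsto_Re by fastforce
    have "(\<lambda>n. cinner (f - u) (d n)) \<longlonglongrightarrow> cinner (f - u) (f - u)"
      using s
    proof
      assume "s = fst"
      then have "d \<longlonglongrightarrow> f - u" using lim by simp
      then show ?thesis by (rule tendsto_cinner[OF tendsto_const])
    next
      assume "s = snd"
      then have "e \<longlonglongrightarrow> - (f - u)" using lim by simp
      from tendsto_cinner[OF tendsto_const[of "f - u"] this] show ?thesis
        unfolding adj cinner.minus_right by (rule tendsto_minus_cancel)
    qed
    then show "(\<lambda>n. Re (cinner (f - u) (d n))) \<longlonglongrightarrow> (norm (f - u))\<^sup>2"
      using tendsto_Re Re_cinner_self by metis
  qed
  then show ?thesis using uv by simp
qed

lemma Friedrichs_eq:
  assumes F: form_condition
  shows "Friedrichs_extension S Hdot = H"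
proof
  show "H \<subseteq> Friedrichs_extension S Hdot"
  proof (rule subrelI)
    fix u v assume uv: "(u, v) \<in> H"
    obtain f g where fg: "\<And>n. (f n, g n) \<in> Hdot" "f \<longlonglongrightarrow> u" "form_Cauchy Hdot f"
      using Friedrichs_approximation[OF F uv] by blast
    moreover have "range f \<subseteq> Domain Hdot" using fg(1) by blast
    ultimately show "(u, v) \<in> Friedrichs_extension S Hdot"
      using uv Hdot_adjoint_sup operator_in_mem[OF op uv]
      unfolding Friedrichs_extension_def Friedrichs_form_domain_def by blast
  qed
  show "Friedrichs_extension S Hdot \<subseteq> H"
  proof (rule subrelI)
    fix f g assume "(f, g) \<in> Friedrichs_extension S Hdot"
    then obtain fn where fg: "(f, g) \<in> op_adjoint S Hdot"
      and fn: "range fn \<subseteq> Domain Hdot" "fn \<longlonglongrightarrow> f" "form_Cauchy Hdot fn"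
      unfolding Friedrichs_extension_def Friedrichs_form_domain_def by blast
    obtain gn where gn: "\<And>n. (fn n, gn n) \<in> Hdot" using Domain_seq[OF fn(1)] by blast
    show "(f, g) \<in> H"
      by (rule extension_subset[OF disjI1[OF refl] fg gn _ fn(3)])
        (use fn(2) Friedrichs_approximation[OF F] in \<open>simp, fastforce\<close>)
  qed
qed

lemma Krein_eq:
  assumes K: range_condition
  shows "Krein_extension S Hdot = H"
proof
  show "H \<subseteq> Krein_extension S Hdot"
  proof (rule subrelI)
    fix u v assume uv: "(u, v) \<in> H"
    obtain f g where fg: "\<And>n. (f n, g n) \<in> Hdot" "g \<longlonglongrightarrow> v" "form_Cauchy Hdot f"
      using Krein_approximation[OF K uv] by blast
    moreover have "range f \<subseteq> Domain Hdot" using fg(1) by blast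
    moreover have "(\<lambda>n. op_apply Hdot (f n)) \<longlonglongrightarrow> v" using fg(2) by (simp add: op_apply_eq[OF Hdot_op fg(1)])
    ultimately show "(u, v) \<in> Krein_extension S Hdot"
      using uv Hdot_adjoint_sup unfolding Krein_extension_def by blast
  qed
  show "Krein_extension S Hdot \<subseteq> H"
  proof (rule subrelI)
    fix f g assume "(f, g) \<in> Krein_extension S Hdot"
    then obtain fn where fg: "(f, g) \<in> op_adjoint S Hdot" and fn: "range fn \<subseteq> Domain Hdot"
      "(\<lambda>n. op_apply Hdot (fn n)) \<longlonglongrightarrow> g" "form_Cauchy Hdot fn"
      unfolding Krein_extension_def by blast
    obtain gn where gn: "\<And>n. (fn n, gn n) \<in> Hdot" using Domain_seq[OF fn(1)] by blast
    have "gn \<longlonglongrightarrow> g" using fn(2) by (simp add: op_apply_eq[OF Hdot_op gn])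
    then show "(f, g) \<in> H"
      by (intro extension_subset[OF disjI2[OF refl] fg gn _ fn(3)])
        (use Krein_approximation[OF K] in \<open>simp, fastforce\<close>)
  qed
qed

section \<open>Uniqueness of the nonnegative extension\<close>

text \<open>For \<open>A \<ge> 0\<close> and \<open>h = (A + 1) u\<close>, the expressions \<open>2 Re (h, f) - (f, (A + 1) f)\<close> and
  \<open>2 Re (h, A f) - (A f, (A + 1) f)\<close> have the maxima \<open>(h, u)\<close> and \<open>(h, A u)\<close> over \<open>f\<close> in the
  domain of \<open>A\<close>.\<close>

lemma variational_identity:
  assumes sa': "self_adjoint S A" and uv: "(u, v) \<in> A" and fg: "(f, g) \<in> A"
  shows "2 * Re (cinner (u + v) f) - Re (cinner f (f + g))
      = Re (cinner (u + v) u) - (norm (u - f))\<^sup>2 - Re (cinner (u - f) (v - g))"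
    and "2 * Re (cinner (u + v) g) - Re (cinner g (f + g))
      = Re (cinner (u + v) v) - (norm (v - g))\<^sup>2 - Re (cinner (u - f) (v - g))"
proof -
  note sym = self_adjoint_sym[OF sa']
  have s1: "cinner u g = cinner v f" and s2: "cinner f v = cinner g u" and s3: "cinner u v = cinner v u"
    and s4: "cinner f g = cinner g f"
    by (rule sym[OF uv fg], rule sym[OF fg uv], rule sym[OF uv uv], rule sym[OF fg fg])
  have s5: "Re (cinner f u) = Re (cinner u f)" "Re (cinner g v) = Re (cinner v g)" "Re (cinner g u) = Re (cinner u g)"
    by (rule Re_cinner_commute)+
  note s = s1 s2 s3[symmetric] s4[symmetric] s5
  show "2 * Re (cinner (u + v) f) - Re (cinner f (f + g))
      = Re (cinner (u + v) u) - (norm (u - f))\<^sup>2 - Re (cinner (u - f) (v - g))"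
    by (simp add: Re_cinner_self[symmetric] cinner.add_left cinner.add_right cinner.diff_left cinner.diff_right s)
  show "2 * Re (cinner (u + v) g) - Re (cinner g (f + g))
      = Re (cinner (u + v) v) - (norm (v - g))\<^sup>2 - Re (cinner (u - f) (v - g))"
    by (simp add: Re_cinner_self[symmetric] cinner.add_left cinner.add_right cinner.diff_left cinner.diff_right s)
qed

text \<open>\<open>Hdot\<close> lies in both graphs and its elements already reach the maximum
  belonging to H, so that maximum is at most the one belonging to H'. Friedrichs approximation gives
  this for (h, u), Krein approximation for (h, h - u), and together the quadratic forms of (H +
  1)^-1 and (H' + 1)^-1 agree. The rest is polarization.\<close>

lemma unique_extension:
  assumes F: form_condition and K: range_condition
    and sa': "self_adjoint S H'" and nn': "nonneg_op H'" and ext: "Hdot \<subseteq> H'"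
  shows "H' = H"
proof -
  note op' = self_adjoint_operator_in[OF sa']
  have quad: "Re (cinner (u + v) u) = Re (cinner (u + v) u')"
    if uv: "(u, v) \<in> H" and uv': "(u', v') \<in> H'" and eq: "u + v = u' + v'" for u v u' v'
  proof (rule antisym)
    obtain f g where fg: "\<And>n. (f n, g n) \<in> Hdot" "f \<longlonglongrightarrow> u"
      and null: "(\<lambda>n. Re (cinner (u - f n) (v - g n))) \<longlonglongrightarrow> 0"
      using Friedrichs_approximation[OF F uv] by metis
    have "Re (cinner (u + v) u) - (norm (u - f n))\<^sup>2 - Re (cinner (u - f n) (v - g n)) \<le> Re (cinner (u + v) u')" for n
    proof -
      have H: "(f n, g n) \<in> H" and H': "(f n, g n) \<in> H'" using fg(1) Hdot_sub ext by blast+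
      show ?thesis
        unfolding variational_identity(1)[OF sa uv H, symmetric] unfolding eq
        unfolding variational_identity(1)[OF sa' uv' H']
        using nonneg_opD[OF nn' operator_in_diff[OF op' uv' H']] zero_le_power2[of "norm (u' - f n)"] by linarith
    qed
    moreover have "(\<lambda>n. Re (cinner (u + v) u) - (norm (u - f n))\<^sup>2 - Re (cinner (u - f n) (v - g n)))
        \<longlonglongrightarrow> Re (cinner (u + v) u) - (norm (u - u))\<^sup>2 - 0"
      by (intro tendsto_intros fg null)
    ultimately show "Re (cinner (u + v) u) \<le> Re (cinner (u + v) u')"
      by (intro LIMSEQ_le_const2[where X = "\<lambda>n. Re (cinner (u + v) u) - (norm (u - f n))\<^sup>2 - Re (cinner (u - f n) (v - g n))"]) auto
  next
    obtain f g where fg: "\<And>n. (f n, g n) \<in> Hdot" "g \<longlonglongrightarrow> v"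
      and null: "(\<lambda>n. Re (cinner (u - f n) (v - g n))) \<longlonglongrightarrow> 0"
      using Krein_approximation[OF K uv] by metis
    have "Re (cinner (u + v) v) - (norm (v - g n))\<^sup>2 - Re (cinner (u - f n) (v - g n)) \<le> Re (cinner (u + v) v')" for n
    proof -
      have H: "(f n, g n) \<in> H" and H': "(f n, g n) \<in> H'" using fg(1) Hdot_sub ext by blast+
      show ?thesis
        unfolding variational_identity(2)[OF sa uv H, symmetric] unfolding eq
        unfolding variational_identity(2)[OF sa' uv' H']
        using nonneg_opD[OF nn' operator_in_diff[OF op' uv' H']] zero_le_power2[of "norm (v' - g n)"] by linarith
    qed
    moreover have "(\<lambda>n. Re (cinner (u + v) v) - (norm (v - g n))\<^sup>2 - Re (cinner (u - f n) (v - g n)))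
        \<longlonglongrightarrow> Re (cinner (u + v) v) - (norm (v - v))\<^sup>2 - 0"
      by (intro tendsto_intros fg null)
    ultimately have "Re (cinner (u + v) v) \<le> Re (cinner (u + v) v')"
      by (intro LIMSEQ_le_const2[where X = "\<lambda>n. Re (cinner (u + v) v) - (norm (v - g n))\<^sup>2 - Re (cinner (u - f n) (v - g n))"]) auto
    \<comment> \<open>H (H + 1)^-1 = 1 - (H + 1)^-1, and likewise for H', reverses the
      inequality.\<close>
    moreover have "v' = (u + v) - u'" by (simp add: eq)
    then have "cinner (u + v) v' = cinner (u + v) (u + v) - cinner (u + v) u'"
      by (simp only: cinner.diff_right)
    moreover have "cinner (u + v) v = cinner (u + v) (u + v) - cinner (u + v) u"
      by (simp add: cinner.add_right)
    ultimately show "Re (cinner (u + v) u') \<le> Re (cinner (u + v) u)" by simp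
  qed
  have "H' \<subseteq> H"
  proof (rule subrelI)
    fix f g assume fg: "(f, g) \<in> H'"
    have "f + g \<in> S" using operator_in_mem[OF op' fg] csubspace_add[OF csub] by blast
    then obtain u v where uv: "(u, v) \<in> H" "u + v = f + g"
      using nonneg_self_adjoint_range[OF sa S nn] by blast
    \<comment> \<open>Polarization by hand: with D the difference of the two resolvents at -1, k = D
      h and e = D k. The real part of the form of D vanishes at h, k and h + k, and D is symmetric,
      so 0 = Re (h, e) + |k|^2 = 2 |k|^2.\<close>
    define k where "k = u - f"
    have kS: "k \<in> S" unfolding k_def
      using operator_in_mem[OF op uv(1)] operator_in_mem[OF op' fg] csubspace_diff[OF csub] by blast
    obtain a b where ab: "(a, b) \<in> H" "a + b = k" using nonneg_self_adjoint_range[OF sa S nn kS] by blast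
    obtain c d where cd: "(c, d) \<in> H'" "c + d = k" using nonneg_self_adjoint_range[OF sa' S nn' kS] by blast
    define h where "h = f + g"
    define e where "e = a - c"
    have q1: "Re (cinner h k) = 0"
      using quad[OF uv(1) fg uv(2)] by (simp add: k_def h_def uv(2) cinner.diff_right)
    have q2: "Re (cinner k e) = 0"
      using quad[OF ab(1) cd(1)] by (simp add: e_def ab(2) cd(2) cinner.diff_right)
    have "(u + a, v + b) \<in> H" "(f + c, g + d) \<in> H'"
      by (rule operator_in_add[OF op uv(1) ab(1)], rule operator_in_add[OF op' fg cd(1)])
    moreover have s: "u + a + (v + b) = h + k" "f + c + (g + d) = h + k"
      using uv(2) ab(2) cd(2) by (simp_all add: h_def algebra_simps)
    ultimately have "Re (cinner (h + k) (u + a)) = Re (cinner (h + k) (f + c))"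
      using quad by metis
    then have "Re (cinner (h + k) (k + e)) = 0"
      by (simp add: k_def e_def cinner.diff_right cinner.add_right)
    then have "Re (cinner h e) + Re (cinner k k) = 0"
      using q1 q2 by (simp add: cinner.add_left cinner.add_right)
    moreover have "cinner h e = cinner k k"
    proof -
      have "cinner a v = cinner b u" "cinner c g = cinner d f"
        by (rule self_adjoint_sym[OF sa ab(1) uv(1)], rule self_adjoint_sym[OF sa' cd(1) fg])
      then have "cinner a h = cinner k u" "cinner c h = cinner k f"
        by (simp add: h_def uv(2)[symmetric] ab(2)[symmetric] cinner.add_left cinner.add_right)
          (simp add: h_def cd(2)[symmetric] cinner.add_left cinner.add_right \<open>cinner c g = cinner d f\<close>)
      then have "cinner e h = cinner k k" by (simp add: e_def k_def cinner.diff_left cinner.diff_right)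
      then show ?thesis by (metis cinner_commute)
    qed
    ultimately have "k = 0" by (simp add: Re_cinner_self)
    then show "(f, g) \<in> H" using uv by (simp add: k_def)
  qed
  moreover have "H \<subseteq> H'"
  proof (rule subrelI)
    fix u v assume uv: "(u, v) \<in> H"
    show "(u, v) \<in> H'"
    proof (rule self_adjointD[OF sa'])
      show "u \<in> S" "v \<in> S" using operator_in_mem[OF op uv] by auto
      show "cinner u b = cinner v a" if "(a, b) \<in> H'" for a b
        using self_adjoint_sym[OF sa uv] that \<open>H' \<subseteq> H\<close> by blast
    qed
  qed
  ultimately show ?thesis by blast
qed

end

section \<open>Integration against operator-valued measures\<close>

lemma sesquilinear_eqI:
  fixes B C :: "'a::chilbert_space \<Rightarrow> 'a \<Rightarrow> complex"
  assumes B: "\<And>x y z. B (x + y) z = B x z + B y z" "\<And>x y z. B x (y + z) = B x y + B x z"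
    "\<And>c x y. B (c *\<^sub>C x) y = cnj c * B x y" "\<And>c x y. B x (c *\<^sub>C y) = c * B x y"
    and C: "\<And>x y z. C (x + y) z = C x z + C y z" "\<And>x y z. C x (y + z) = C x y + C x z"
    "\<And>c x y. C (c *\<^sub>C x) y = cnj c * C x y" "\<And>c x y. C x (c *\<^sub>C y) = c * C x y"
    and eq: "\<And>x. B x x = C x x"
  shows "B x y = C x y"
  using polarization[of B x y, OF B] polarization[of C x y, OF C] by (simp only: eq)

lemma sum_nonneg_Reals:
  fixes f :: "'a \<Rightarrow> complex"
  shows "(\<And>i. i \<in> A \<Longrightarrow> f i \<in> \<real>\<^sub>\<ge>\<^sub>0) \<Longrightarrow> sum f A \<in> \<real>\<^sub>\<ge>\<^sub>0"
  by (induction A rule: infinite_finite_induct) auto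

section \<open>Scalar measures of a positive operator-valued measure\<close>

locale povm_space =
  fixes \<Omega> :: "real set \<Rightarrow> 'n::chilbert_space \<Rightarrow> 'n"
  assumes povm: "povm \<Omega>"
begin

lemma \<Omega>_clinear: "B \<in> sets borel \<Longrightarrow> bounded B \<Longrightarrow> clinear (\<Omega> B)"
  using povm by (auto simp: povm_def bounded_clinear_def)

lemma \<Omega>_add: "B \<in> sets borel \<Longrightarrow> bounded B \<Longrightarrow> \<Omega> B (x + y) = \<Omega> B x + \<Omega> B y"
  and \<Omega>_scale: "B \<in> sets borel \<Longrightarrow> bounded B \<Longrightarrow> \<Omega> B (c *\<^sub>C x) = c *\<^sub>C \<Omega> B x"
  using \<Omega>_clinear by (auto simp: clinear_def)

lemma \<Omega>_nonneg: "B \<in> sets borel \<Longrightarrow> bounded B \<Longrightarrow> cinner x (\<Omega> B x) \<in> \<real>\<^sub>\<ge>\<^sub>0"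
  using povm by (auto simp: povm_def nonneg_operator_def)

lemma \<Omega>_Re: "B \<in> sets borel \<Longrightarrow> bounded B \<Longrightarrow> 0 \<le> Re (cinner x (\<Omega> B x))"
  and \<Omega>_of_real: "B \<in> sets borel \<Longrightarrow> bounded B \<Longrightarrow> cinner x (\<Omega> B x) = of_real (Re (cinner x (\<Omega> B x)))"
  using \<Omega>_nonneg[of B x] by (auto simp: complex_nonneg_Reals_iff complex_eq_iff)

lemma \<Omega>_sums:
  "range B \<subseteq> sets borel \<Longrightarrow> disjoint_family B \<Longrightarrow> bounded (\<Union>n. B n) \<Longrightarrow> (\<lambda>n. \<Omega> (B n) x) sums \<Omega> (\<Union>n. B n) x"
  for B :: "nat \<Rightarrow> real set"
  using povm unfolding povm_def by blast

lemma \<Omega>_empty: "\<Omega> {} x = 0"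
proof -
  have "(\<lambda>n::nat. \<Omega> {} x) sums \<Omega> (\<Union>n::nat. {}) x"
    by (rule \<Omega>_sums) (auto simp: disjoint_family_on_def)
  then have "(\<lambda>n::nat. \<Omega> {} x) \<longlonglongrightarrow> 0" by (intro summable_LIMSEQ_zero sums_summable)
  then show ?thesis by (simp add: LIMSEQ_const_iff)
qed

lemma \<Omega>_Un:
  assumes A: "A \<in> sets borel" "B \<in> sets borel" "bounded A" "bounded B" "A \<inter> B = {}"
  shows "\<Omega> (A \<union> B) x = \<Omega> A x + \<Omega> B x"
proof -
  define D where "D n = (if n = 0 then A else if n = 1 then B else {})" for n :: nat
  have "(\<Union>n. D n) = D 0 \<union> D 1 \<union> (\<Union>n\<in>{2..}. D n)" by (auto simp: D_def)
  then have U: "(\<Union>n. D n) = A \<union> B" by (auto simp: D_def)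
  have "(\<lambda>n. \<Omega> (D n) x) sums \<Omega> (\<Union>n. D n) x"
    by (rule \<Omega>_sums) (use A in \<open>auto simp: U disjoint_family_on_def D_def\<close>)
  moreover have "(\<lambda>n. \<Omega> (D n) x) sums (\<Sum>n\<in>{0,1}. \<Omega> (D n) x)"
    by (rule sums_finite) (auto simp: D_def \<Omega>_empty)
  ultimately show ?thesis using sums_unique2 unfolding U by (force simp: D_def)
qed

lemma \<Omega>_mono:
  assumes "A \<in> sets borel" "B \<in> sets borel" "bounded B" "A \<subseteq> B"
  shows "Re (cinner x (\<Omega> A x)) \<le> Re (cinner x (\<Omega> B x))"
proof -
  have b: "bounded A" "bounded (B - A)" using assms by (auto intro: bounded_subset)
  have "B = A \<union> (B - A)" using assms(4) by blast
  then have "\<Omega> B x = \<Omega> A x + \<Omega> (B - A) x"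
    using \<Omega>_Un[of A "B - A" x] assms b by auto
  then show ?thesis using \<Omega>_Re[of "B - A" x] assms b by (simp add: cinner.add_right)
qed

abbreviation \<mu> :: "'n \<Rightarrow> real measure" where "\<mu> \<equiv> povm_scalar \<Omega>"

lemma sets_\<mu> [measurable_cong, simp]: "sets (\<mu> x) = sets borel"
  using sets.sigma_sets_eq[of borel] by (simp add: povm_scalar_def space_borel sets_measure_of_conv)

lemma space_\<mu> [simp]: "space (\<mu> x) = UNIV"
  using sets_eq_imp_space_eq[OF sets_\<mu>] by simp

text \<open>This makes the set function in \<open>povm_scalar\<close> a genuine measure. On each
  window [-n, n] additivity is inherited from \<open>povm\<close>; the masses increase with n, so
  the supremum commutes with the countable sum.\<close>

lemma emeasure_\<mu>:
  assumes "B \<in> sets borel"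
  shows "emeasure (\<mu> x) B = (SUP n. ennreal (Re (cinner x (\<Omega> (B \<inter> {- real n..real n}) x))))"
  unfolding povm_scalar_def
proof (rule emeasure_measure_of_sigma)
  show "sigma_algebra UNIV (sets (borel :: real measure))"
    using sets.sigma_algebra_axioms[of "borel :: real measure"] by simp
  show "positive (sets borel) (\<lambda>B. SUP n. ennreal (Re (cinner x (\<Omega> (B \<inter> {- real n..real n}) x))))"
    by (simp add: positive_def \<Omega>_empty cinner.zero_right)
  show "countably_additive (sets borel) (\<lambda>B. SUP n. ennreal (Re (cinner x (\<Omega> (B \<inter> {- real n..real n}) x))))"
    unfolding countably_additive_def
  proof (intro allI impI)
    fix A :: "nat \<Rightarrow> real set"
    assume A: "range A \<subseteq> sets borel" "disjoint_family A" "\<Union> (range A) \<in> sets borel"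
    have *: "(\<Sum>i. ennreal (Re (cinner x (\<Omega> (A i \<inter> {- real n..real n}) x))))
        = ennreal (Re (cinner x (\<Omega> (\<Union> (range A) \<inter> {- real n..real n}) x)))" for n
    proof (rule suminf_ennreal_eq)
      show "0 \<le> Re (cinner x (\<Omega> (A i \<inter> {- real n..real n}) x))" for i
        by (rule \<Omega>_Re) (use A in \<open>auto intro: bounded_subset\<close>)
      have "(\<lambda>i. \<Omega> (A i \<inter> {- real n..real n}) x) sums \<Omega> (\<Union>i. A i \<inter> {- real n..real n}) x"
      proof (rule \<Omega>_sums)
        show "disjoint_family (\<lambda>i. A i \<inter> {- real n..real n})"
          using A(2) by (auto simp: disjoint_family_on_def)
        show "bounded (\<Union>i. A i \<inter> {- real n..real n})"
          by (rule bounded_subset[of "{- real n..real n}"]) auto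
      qed (use A in auto)
      moreover have "(\<Union>i. A i \<inter> {- real n..real n}) = \<Union> (range A) \<inter> {- real n..real n}" by blast
      ultimately show "(\<lambda>i. Re (cinner x (\<Omega> (A i \<inter> {- real n..real n}) x)))
          sums Re (cinner x (\<Omega> (\<Union> (range A) \<inter> {- real n..real n}) x))"
        using bounded_linear.sums[OF bounded_linear_compose[OF bounded_linear_Re cinner.bounded_linear_right]]
        by fastforce
    qed
    have inc: "incseq (\<lambda>n. ennreal (Re (cinner x (\<Omega> (A i \<inter> {- real n..real n}) x))))" for i
      by (intro incseq_SucI ennreal_leI \<Omega>_mono) (use A in \<open>auto intro: bounded_subset\<close>)
    show "(\<Sum>i. SUP n. ennreal (Re (cinner x (\<Omega> (A i \<inter> {- real n..real n}) x))))
        = (SUP n. ennreal (Re (cinner x (\<Omega> (\<Union> (range A) \<inter> {- real n..real n}) x))))"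
      unfolding *[symmetric] by (rule ennreal_suminf_SUP_eq) (rule inc)
  qed
qed fact

lemma emeasure_\<mu>_bounded:
  assumes B: "B \<in> sets borel" "bounded B"
  shows "emeasure (\<mu> x) B = ennreal (Re (cinner x (\<Omega> B x)))"
proof -
  obtain r where r: "\<And>y. y \<in> B \<Longrightarrow> \<bar>y\<bar> \<le> r" using B(2) by (auto simp: bounded_iff)
  obtain N :: nat where N: "r \<le> real N" using real_arch_simple by blast
  have eq: "B \<inter> {- real n..real n} = B" if "n \<ge> N" for n
  proof -
    have "y \<in> {- real n..real n}" if "y \<in> B" for y
      using r[OF that] N \<open>n \<ge> N\<close> of_nat_le_iff[of N n, where 'a = real] by (auto simp: abs_le_iff)
    then show ?thesis by blast
  qed
  show ?thesis
    unfolding emeasure_\<mu>[OF B(1)]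
  proof (rule antisym)
    show "(SUP n. ennreal (Re (cinner x (\<Omega> (B \<inter> {- real n..real n}) x)))) \<le> ennreal (Re (cinner x (\<Omega> B x)))"
      by (intro SUP_least ennreal_leI \<Omega>_mono) (use B in auto)
    have "ennreal (Re (cinner x (\<Omega> B x))) = ennreal (Re (cinner x (\<Omega> (B \<inter> {- real N..real N}) x)))"
      using eq[of N] by simp
    also have "\<dots> \<le> (SUP n. ennreal (Re (cinner x (\<Omega> (B \<inter> {- real n..real n}) x))))"
      by (rule SUP_upper) simp
    finally show "ennreal (Re (cinner x (\<Omega> B x)))
        \<le> (SUP n. ennreal (Re (cinner x (\<Omega> (B \<inter> {- real n..real n}) x))))" .
  qed
qed

lemma measure_\<mu>_bounded:
  "B \<in> sets borel \<Longrightarrow> bounded B \<Longrightarrow> measure (\<mu> x) B = Re (cinner x (\<Omega> B x))"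
  by (simp add: measure_def emeasure_\<mu>_bounded \<Omega>_Re)

lemma cinner_\<Omega>: "B \<in> sets borel \<Longrightarrow> bounded B \<Longrightarrow> cinner x (\<Omega> B x) = of_real (measure (\<mu> x) B)"
  using \<Omega>_of_real by (simp add: measure_\<mu>_bounded)

text \<open>Real diagonal values at x + y and at x + i y force the symmetry.\<close>

lemma \<Omega>_hermitian:
  assumes B: "B \<in> sets borel" "bounded B"
  shows "cinner x (\<Omega> B y) = cnj (cinner y (\<Omega> B x))"
proof -
  have "cinner x (\<Omega> B y) = cinner (\<Omega> B x) y"
  proof -
    have 1: "cinner v (\<Omega> B v) = cinner (\<Omega> B v) v" for v
      using \<Omega>_of_real[OF B, of v] by (metis cinner_commute complex_cnj_complex_of_real)
    have 2: "cinner x (\<Omega> B y) + cinner y (\<Omega> B x) = cinner (\<Omega> B x) y + cinner (\<Omega> B y) x"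
      using 1[of "x + y"] 1[of x] 1[of y]
      by (simp add: \<Omega>_add[OF B] cinner_add_left cinner_add_right algebra_simps)
    have "\<i> * cinner x (\<Omega> B y) - \<i> * cinner y (\<Omega> B x) = \<i> * cinner (\<Omega> B x) y - \<i> * cinner (\<Omega> B y) x"
      using 1[of "x + \<i> *\<^sub>C y"] 1[of x] 1[of y]
      by (simp add: \<Omega>_add[OF B] \<Omega>_scale[OF B] cinner_add_left cinner_add_right cinner_scaleC_left cinner_scaleC_right
          algebra_simps)
    then have "\<i> * (cinner x (\<Omega> B y) - cinner y (\<Omega> B x)) = \<i> * (cinner (\<Omega> B x) y - cinner (\<Omega> B y) x)"
      by (simp only: right_diff_distrib)
    then have "cinner x (\<Omega> B y) - cinner y (\<Omega> B x) = cinner (\<Omega> B x) y - cinner (\<Omega> B y) x"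
      by simp
    with 2 have "cinner x (\<Omega> B y) * 2 = cinner (\<Omega> B x) y * 2" by algebra
    then show ?thesis by simp
  qed
  then show ?thesis by (simp add: cinner_commute[of "\<Omega> B x"])
qed

text \<open>Pairing with x turns the operator sums of the approximating simple functions into their
  scalar integrals, so the same sequence witnesses Bochner integrability. Their supports are
  bounded, which makes \<open>\<Omega>\<close> meaningful on the level sets and the simple functions
  integrable.\<close>

lemma strong_integral_has_integral:
  assumes "has_strong_integral \<Omega> f T"
  shows "has_bochner_integral (\<mu> x) f (cinner x (T x))"
proof -
  from assms obtain s where f: "f \<in> borel_measurable borel"
    and s: "\<And>n. simple_function borel (s n)" "\<And>n. bounded {x. s n x \<noteq> 0}"
    and l1: "(\<lambda>n. \<integral>\<^sup>+y. ennreal (norm (f y - s n y)) \<partial>\<mu> x) \<longlonglongrightarrow> 0"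
    and l2: "(\<lambda>n. povm_simple_integral \<Omega> (s n) x) \<longlonglongrightarrow> T x"
    unfolding has_strong_integral_def by blast
  have sf: "simple_function (\<mu> x) (s n)" for n
    using s(1)[of n] by (simp add: simple_function_def)
  have meas: "s n -` {c} \<in> sets borel" for n c
    using measurable_sets[OF borel_measurable_simple_function[OF s(1)], of "{c}" n] by simp
  have meas0: "{y. s n y \<noteq> 0} \<in> sets borel" for n
  proof -
    have "{y. s n y \<noteq> 0} = - (s n -` {0})" by auto
    then show ?thesis using meas[of n 0] by (simp add: borel_comp)
  qed
  have bd: "bounded (s n -` {c})" if "c \<noteq> 0" for n c
    by (rule bounded_subset[OF s(2)[of n]]) (use that in auto)
  have eq: "Bochner_Integration.simple_bochner_integral (\<mu> x) (s n) = cinner x (povm_simple_integral \<Omega> (s n) x)" for n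
  proof -
    have fin: "finite (range (s n))" using simple_functionD(1)[OF s(1)] by simp
    have "cinner x (povm_simple_integral \<Omega> (s n) x) = (\<Sum>c \<in> range (s n) - {0}. c * cinner x (\<Omega> (s n -` {c}) x))"
      by (simp add: povm_simple_integral_def cinner.sum_right cinner_scaleC_right)
    also have "\<dots> = (\<Sum>c \<in> range (s n) - {0}. measure (\<mu> x) {y. s n y = c} *\<^sub>R c)"
    proof (rule sum.cong[OF refl])
      fix c assume "c \<in> range (s n) - {0}"
      then have "cinner x (\<Omega> (s n -` {c}) x) = of_real (measure (\<mu> x) (s n -` {c}))"
        by (intro cinner_\<Omega>[OF meas bd]) auto
      moreover have "s n -` {c} = {y. s n y = c}" by auto
      ultimately show "c * cinner x (\<Omega> (s n -` {c}) x) = measure (\<mu> x) {y. s n y = c} *\<^sub>R c"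
        by (simp add: scaleR_conv_of_real)
    qed
    also have "\<dots> = (\<Sum>c \<in> range (s n). measure (\<mu> x) {y. s n y = c} *\<^sub>R c)"
      by (rule sum.mono_neutral_left) (use fin in auto)
    finally have "cinner x (povm_simple_integral \<Omega> (s n) x) = (\<Sum>c \<in> range (s n). measure (\<mu> x) {y. s n y = c} *\<^sub>R c)" .
    then show ?thesis unfolding Bochner_Integration.simple_bochner_integral_def space_\<mu> by simp
  qed
  show ?thesis
  proof (rule has_bochner_integral.intros)
    show "f \<in> borel_measurable (\<mu> x)"
      using f measurable_cong_sets[OF sets_\<mu> refl] by blast
    show "Bochner_Integration.simple_bochner_integrable (\<mu> x) (s n)" for n
      by (rule Bochner_Integration.simple_bochner_integrable.intros[OF sf])
        (simp add: emeasure_\<mu>_bounded[OF meas0 s(2)])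
    show "(\<lambda>n. \<integral>\<^sup>+y. norm (f y - s n y) \<partial>\<mu> x) \<longlonglongrightarrow> 0" by (rule l1)
    show "(\<lambda>n. Bochner_Integration.simple_bochner_integral (\<mu> x) (s n)) \<longlonglongrightarrow> cinner x (T x)"
      unfolding eq by (intro tendsto_cinner tendsto_const l2)
  qed
qed

end

section \<open>Sesquilinear integrals as limits of Riemann sums\<close>

locale normalized_povm = povm_space \<Omega> for \<Omega> :: "real set \<Rightarrow> 'n::chilbert_space \<Rightarrow> 'n" +
  assumes normalized: "has_strong_integral \<Omega> (\<lambda>x. complex_of_real (1 / (1 + x\<^sup>2))) (\<lambda>\<xi>. \<xi>)"
begin

lemma integrable_weight: "integrable (\<mu> x) (\<lambda>t. 1 / (1 + t\<^sup>2))"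
proof -
  have "integrable (\<mu> x) (\<lambda>t. complex_of_real (1 / (1 + t\<^sup>2)))"
    using strong_integral_has_integral[OF normalized, of x] by (rule integrable.intros)
  from integrable_norm[OF this] have "integrable (\<mu> x) (\<lambda>t. \<bar>1 / (1 + t\<^sup>2)\<bar>)" by (simp only: norm_of_real)
  then show ?thesis by (simp add: add_nonneg_nonneg)
qed

text \<open>Continuity serves the convergence of Riemann sums; the decay serves domination by the
  weight, which \<open>normalized\<close> makes integrable.\<close>

definition admissible :: "(real \<Rightarrow> complex) \<Rightarrow> bool" where
  "admissible g \<longleftrightarrow> continuous_on UNIV g \<and> (\<exists>C. \<forall>t. cmod (g t) \<le> C / (1 + t\<^sup>2))"

text \<open>Cells have length 1/(n + 1) and are half open, so that they partition the line;
  \<open>grid_index\<close> selects the window from -(n + 1) to n + 1.\<close>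

definition grid :: "nat \<Rightarrow> int \<Rightarrow> real set" where
  "grid n l = {real_of_int l / real (Suc n) ..< (real_of_int l + 1) / real (Suc n)}"

definition grid_index :: "nat \<Rightarrow> int set" where
  "grid_index n = {- (int (Suc n))\<^sup>2 ..< (int (Suc n))\<^sup>2}"

text \<open>Sesquilinear in x and y by construction. Off the diagonal (x, \<Omega> y) is a complex
  set function and not one of the measures \<open>\<mu>\<close>, so integrals against it are
  approached this way.\<close>

definition Riemann_sum :: "nat \<Rightarrow> (real \<Rightarrow> complex) \<Rightarrow> 'n \<Rightarrow> 'n \<Rightarrow> complex" where
  "Riemann_sum n g x y = (\<Sum>l\<in>grid_index n. g (real_of_int l / real (Suc n)) * cinner x (\<Omega> (grid n l) y))"

lemma grid_borel [simp]: "grid n l \<in> sets borel" and grid_bounded [simp]: "bounded (grid n l)"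
  by (simp_all add: grid_def)

lemma grid_iff: "t \<in> grid n l \<longleftrightarrow> \<lfloor>real (Suc n) * t\<rfloor> = l"
  by (auto simp: grid_def floor_eq_iff field_simps)

lemma finite_grid_index [simp]: "finite (grid_index n)"
  by (simp add: grid_index_def)

lemma admissible_measurable: "admissible g \<Longrightarrow> g \<in> borel_measurable borel"
  by (auto simp: admissible_def intro: borel_measurable_continuous_onI)

lemma admissible_integrable:
  assumes "admissible g" shows "integrable (\<mu> x) g"
proof -
  obtain C where C: "\<And>t. cmod (g t) \<le> C / (1 + t\<^sup>2)" using assms by (auto simp: admissible_def)
  show ?thesis
  proof (rule Bochner_Integration.integrable_bound)
    show "integrable (\<mu> x) (\<lambda>t. C * (1 / (1 + t\<^sup>2)))" by (intro integrable_mult_right integrable_weight)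
    show "g \<in> borel_measurable (\<mu> x)"
      using admissible_measurable[OF assms] measurable_cong_sets[OF sets_\<mu> refl] by blast
    show "AE t in \<mu> x. norm (g t) \<le> norm (C * (1 / (1 + t\<^sup>2)))"
      using C by (intro AE_I2) (smt (verit, best) mult_cancel_left2 real_norm_def times_divide_eq_right)
  qed
qed

lemma Riemann_sum_integral:
  "has_bochner_integral (\<mu> x) (\<lambda>t. \<Sum>l\<in>grid_index n. indicator (grid n l) t *\<^sub>R g (real_of_int l / real (Suc n)))
    (Riemann_sum n g x x)"
proof -
  have "Riemann_sum n g x x = (\<Sum>l\<in>grid_index n. measure (\<mu> x) (grid n l) *\<^sub>R g (real_of_int l / real (Suc n)))"
    unfolding Riemann_sum_def by (rule sum.cong) (auto simp: cinner_\<Omega> scaleR_conv_of_real)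
  moreover have "has_bochner_integral (\<mu> x) (\<lambda>t. \<Sum>l\<in>grid_index n. indicator (grid n l) t *\<^sub>R g (real_of_int l / real (Suc n)))
    (\<Sum>l\<in>grid_index n. measure (\<mu> x) (grid n l) *\<^sub>R g (real_of_int l / real (Suc n)))"
    by (intro has_bochner_integral_sum has_bochner_integral_indicator) (auto simp: emeasure_\<mu>_bounded)
  ultimately show ?thesis by simp
qed

lemma step_eq:
  "(\<Sum>l\<in>grid_index n. indicator (grid n l) t *\<^sub>R g (real_of_int l / real (Suc n)))
    = (if \<lfloor>real (Suc n) * t\<rfloor> \<in> grid_index n then g (real_of_int \<lfloor>real (Suc n) * t\<rfloor> / real (Suc n)) else (0 :: complex))"
proof -
  have "(\<Sum>l\<in>grid_index n. indicator (grid n l) t *\<^sub>R g (real_of_int l / real (Suc n)))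
      = (\<Sum>l\<in>grid_index n. if \<lfloor>real (Suc n) * t\<rfloor> = l then g (real_of_int l / real (Suc n)) else 0)"
    by (rule sum.cong) (auto simp: grid_iff indicator_def)
  then show ?thesis by (simp only: sum.delta'[OF finite_grid_index])
qed

lemma Riemann_sum_diagonal:
  assumes g: "admissible g"
  shows "(\<lambda>n. Riemann_sum n g x x) \<longlonglongrightarrow> (\<integral>t. g t \<partial>\<mu> x)"
proof -
  obtain C where C: "\<And>t. cmod (g t) \<le> C / (1 + t\<^sup>2)" using g by (auto simp: admissible_def)
  have C0: "0 \<le> C" using order_trans[OF norm_ge_zero C[of 0]] by simp
  define s where "s n t = (\<Sum>l\<in>grid_index n. indicator (grid n l) t *\<^sub>R g (real_of_int l / real (Suc n)))" for n t
  define tag where "tag n t = real_of_int \<lfloor>real (Suc n) * t\<rfloor> / real (Suc n)" for n t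
  have s: "s n t = (if \<lfloor>real (Suc n) * t\<rfloor> \<in> grid_index n then g (tag n t) else 0)" for n t
    unfolding s_def tag_def by (rule step_eq)
  have tag: "tag n t \<le> t" "t - tag n t \<le> 1 / real (Suc n)" for n t
  proof -
    have "real_of_int \<lfloor>real (Suc n) * t\<rfloor> \<le> real (Suc n) * t" by (rule of_int_floor_le)
    then show "tag n t \<le> t" unfolding tag_def by (simp add: divide_le_eq mult.commute del: of_nat_Suc)
    have "real (Suc n) * t - 1 \<le> real_of_int \<lfloor>real (Suc n) * t\<rfloor>" by linarith
    then have "(real (Suc n) * t - 1) / real (Suc n) \<le> tag n t"
      unfolding tag_def by (rule divide_right_mono) simp
    then show "t - tag n t \<le> 1 / real (Suc n)" by (simp add: diff_divide_distrib del: of_nat_Suc)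
  qed
  have "(\<lambda>n. \<integral>t. s n t \<partial>\<mu> x) \<longlonglongrightarrow> (\<integral>t. g t \<partial>\<mu> x)"
  proof (rule integral_dominated_convergence)
    show "g \<in> borel_measurable (\<mu> x)" using admissible_integrable[OF g] by auto
    show "s n \<in> borel_measurable (\<mu> x)" for n
      unfolding s_def using Riemann_sum_integral by (auto dest: integrable.intros borel_measurable_integrable)
    show "integrable (\<mu> x) (\<lambda>t. 3 * C * (1 / (1 + t\<^sup>2)))" by (intro integrable_mult_right integrable_weight)
    show "AE t in \<mu> x. norm (s n t) \<le> 3 * C * (1 / (1 + t\<^sup>2))" for n
    proof (rule AE_I2)
      fix t :: real
      \<comment> \<open>Origin of the factor 3: t is within 1 of its tag, so t^2 <= 2 tag^2 + 2 and
        1 + t^2 <= 3 (1 + tag^2).\<close>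
      have "(t - tag n t)\<^sup>2 \<le> 1\<^sup>2"
        by (rule power_mono) (use tag[where n = n and t = t] in \<open>auto intro: order_trans\<close>)
      then have "(t - tag n t)\<^sup>2 \<le> 1" by simp
      moreover have "0 \<le> (t - 2 * tag n t)\<^sup>2" by simp
      moreover have "t\<^sup>2 = 2 * (tag n t)\<^sup>2 + 2 * (t - tag n t)\<^sup>2 - (t - 2 * tag n t)\<^sup>2"
        by (simp add: power2_eq_square algebra_simps)
      moreover have "0 \<le> (tag n t)\<^sup>2" by simp
      ultimately have "1 + t\<^sup>2 \<le> 3 * (1 + (tag n t)\<^sup>2)" by argo
      then have "C / (1 + (tag n t)\<^sup>2) \<le> 3 * C * (1 / (1 + t\<^sup>2))"
        using mult_left_mono[of "1 + t\<^sup>2" "3 * (1 + (tag n t)\<^sup>2)" C] C0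
        by (simp add: divide_simps add_pos_nonneg mult_ac)
      then show "norm (s n t) \<le> 3 * C * (1 / (1 + t\<^sup>2))"
        using C[of "tag n t"] C0 by (simp add: s)
    qed
    show "AE t in \<mu> x. (\<lambda>n. s n t) \<longlonglongrightarrow> g t"
    proof (rule AE_I2)
      fix t :: real
      have "(\<lambda>n. tag n t) \<longlonglongrightarrow> t"
      proof (rule tendsto_sandwich[OF _ _ _ tendsto_const])
        show "\<forall>\<^sub>F n in sequentially. t - 1 / real (Suc n) \<le> tag n t" using tag(2) by (simp add: algebra_simps)
        show "(\<lambda>n. t - 1 / real (Suc n)) \<longlonglongrightarrow> t"
          using tendsto_diff[OF tendsto_const LIMSEQ_inverse_real_of_nat, of t] by (simp add: inverse_eq_divide)
      qed (use tag(1) in auto)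
      moreover have "isCont g t" using g by (simp add: admissible_def continuous_on_eq_continuous_at)
      ultimately have "(\<lambda>n. g (tag n t)) \<longlonglongrightarrow> g t" by (rule isCont_tendsto_compose[rotated])
      moreover have "\<forall>\<^sub>F n in sequentially. g (tag n t) = s n t"
      proof -
        \<comment> \<open>From N on, t lies in the window covered by
          \<open>grid_index\<close>.\<close>
        obtain N :: nat where N: "\<bar>t\<bar> < real N" using reals_Archimedean2 by blast
        show ?thesis
        proof (rule eventually_sequentiallyI[of N])
          fix n assume "n \<ge> N"
          then have n: "\<bar>t\<bar> < real (Suc n)" using N by linarith
          have "real (Suc n) * t < real (Suc n) * real (Suc n)" "real (Suc n) * - real (Suc n) \<le> real (Suc n) * t"
            by (intro mult_strict_left_mono mult_left_mono; use n in linarith)+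
          then have "\<lfloor>real (Suc n) * t\<rfloor> \<in> grid_index n"
            unfolding grid_index_def atLeastLessThan_iff le_floor_iff floor_less_iff
            by (simp add: power2_eq_square del: of_nat_Suc)
          then show "g (tag n t) = s n t" by (simp add: s)
        qed
      qed
      ultimately show "(\<lambda>n. s n t) \<longlonglongrightarrow> g t" by (rule Lim_transform_eventually)
    qed
  qed
  moreover have "(\<integral>t. s n t \<partial>\<mu> x) = Riemann_sum n g x x" for n
    unfolding s_def using Riemann_sum_integral by (rule has_bochner_integral_integral_eq)
  ultimately show ?thesis by simp
qed

lemma Riemann_sum_sesquilinear:
  "Riemann_sum n g (x + y) z = Riemann_sum n g x z + Riemann_sum n g y z"
  "Riemann_sum n g x (y + z) = Riemann_sum n g x y + Riemann_sum n g x z"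
  "Riemann_sum n g (c *\<^sub>C x) y = cnj c * Riemann_sum n g x y"
  "Riemann_sum n g x (c *\<^sub>C y) = c * Riemann_sum n g x y"
  by (simp_all add: Riemann_sum_def \<Omega>_add \<Omega>_scale cinner_add_left cinner_add_right cinner_scaleC_left
      cinner_scaleC_right sum.distrib sum_distrib_left algebra_simps)

text \<open>The integral of g against (x, \<Omega> y). For admissible g the limit exists: on the
  diagonal by dominated convergence, elsewhere by polarization.\<close>

definition form :: "(real \<Rightarrow> complex) \<Rightarrow> 'n \<Rightarrow> 'n \<Rightarrow> complex" where
  "form g x y = lim (\<lambda>n. Riemann_sum n g x y)"

lemma form_tendsto:
  assumes g: "admissible g"
  shows "(\<lambda>n. Riemann_sum n g x y) \<longlonglongrightarrow> form g x y"
proof -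
  have "(\<lambda>n. (Riemann_sum n g (x + y) (x + y) - Riemann_sum n g (x + (- 1) *\<^sub>C y) (x + (- 1) *\<^sub>C y)
    - \<i> * Riemann_sum n g (x + \<i> *\<^sub>C y) (x + \<i> *\<^sub>C y)
    + \<i> * Riemann_sum n g (x + (- \<i>) *\<^sub>C y) (x + (- \<i>) *\<^sub>C y)) / 4)
    \<longlonglongrightarrow> ((\<integral>t. g t \<partial>\<mu> (x + y)) - (\<integral>t. g t \<partial>\<mu> (x + (- 1) *\<^sub>C y)) - \<i> * (\<integral>t. g t \<partial>\<mu> (x + \<i> *\<^sub>C y))
      + \<i> * (\<integral>t. g t \<partial>\<mu> (x + (- \<i>) *\<^sub>C y))) / 4"
    by (intro tendsto_intros Riemann_sum_diagonal[OF g]) simp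
  then have "(\<lambda>n. Riemann_sum n g x y) \<longlonglongrightarrow> ((\<integral>t. g t \<partial>\<mu> (x + y)) - (\<integral>t. g t \<partial>\<mu> (x + (- 1) *\<^sub>C y))
      - \<i> * (\<integral>t. g t \<partial>\<mu> (x + \<i> *\<^sub>C y)) + \<i> * (\<integral>t. g t \<partial>\<mu> (x + (- \<i>) *\<^sub>C y))) / 4"
    by (subst polarization[of "Riemann_sum n g" for n]) (simp_all only: Riemann_sum_sesquilinear)
  then show ?thesis unfolding form_def using limI by metis
qed

lemma form_diagonal: "admissible g \<Longrightarrow> form g x x = (\<integral>t. g t \<partial>\<mu> x)"
  using form_tendsto Riemann_sum_diagonal LIMSEQ_unique by blast

lemma form_add_left: "admissible g \<Longrightarrow> form g (x + y) z = form g x z + form g y z"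
  and form_add_right: "admissible g \<Longrightarrow> form g x (y + z) = form g x y + form g x z"
  and form_scale_left: "admissible g \<Longrightarrow> form g (c *\<^sub>C x) y = cnj c * form g x y"
  and form_scale_right: "admissible g \<Longrightarrow> form g x (c *\<^sub>C y) = c * form g x y"
  by (rule LIMSEQ_unique[OF form_tendsto]; (simp add: Riemann_sum_sesquilinear)?;
      intro tendsto_intros form_tendsto; simp)+

lemma admissible_add: "admissible f \<Longrightarrow> admissible g \<Longrightarrow> admissible (\<lambda>t. f t + g t)"
proof -
  assume f: "admissible f" and g: "admissible g"
  obtain C where C: "\<And>t. cmod (f t) \<le> C / (1 + t\<^sup>2)" using f by (auto simp: admissible_def)
  obtain D where D: "\<And>t. cmod (g t) \<le> D / (1 + t\<^sup>2)" using g by (auto simp: admissible_def)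
  have "cmod (f t + g t) \<le> (C + D) / (1 + t\<^sup>2)" for t
    using norm_triangle_ineq[of "f t" "g t"] C[of t] D[of t] by (simp add: add_divide_distrib)
  then show "admissible (\<lambda>t. f t + g t)"
    using f g by (auto simp: admissible_def intro!: continuous_intros)
qed

lemma admissible_scale: "admissible f \<Longrightarrow> admissible (\<lambda>t. c * f t)"
proof -
  assume f: "admissible f"
  obtain C where C: "\<And>t. cmod (f t) \<le> C / (1 + t\<^sup>2)" using f by (auto simp: admissible_def)
  have "cmod (c * f t) \<le> (cmod c * C) / (1 + t\<^sup>2)" for t
    using mult_left_mono[OF C[of t], of "cmod c"] by (simp add: norm_mult)
  then show "admissible (\<lambda>t. c * f t)"
    using f by (auto simp: admissible_def intro!: continuous_intros)
qed

lemma admissible_cnj: "admissible f \<Longrightarrow> admissible (\<lambda>t. cnj (f t))"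
  by (auto simp: admissible_def intro!: continuous_intros)

lemma form_fun_add:
  assumes "admissible f" "admissible g"
  shows "form (\<lambda>t. f t + g t) x y = form f x y + form g x y"
proof (rule LIMSEQ_unique[OF form_tendsto[OF admissible_add[OF assms]]])
  show "(\<lambda>n. Riemann_sum n (\<lambda>t. f t + g t) x y) \<longlonglongrightarrow> form f x y + form g x y"
    using tendsto_add[OF form_tendsto[OF assms(1), of x y] form_tendsto[OF assms(2), of x y]]
    by (simp add: Riemann_sum_def sum.distrib algebra_simps)
qed

lemma form_fun_scale:
  assumes "admissible f"
  shows "form (\<lambda>t. c * f t) x y = c * form f x y"
proof (rule LIMSEQ_unique[OF form_tendsto[OF admissible_scale[OF assms]]])
  show "(\<lambda>n. Riemann_sum n (\<lambda>t. c * f t) x y) \<longlonglongrightarrow> c * form f x y"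
    using tendsto_mult_left[OF form_tendsto[OF assms, of x y], of c]
    by (simp add: Riemann_sum_def sum_distrib_left mult_ac)
qed

lemma form_cnj:
  assumes "admissible f"
  shows "form (\<lambda>t. cnj (f t)) x y = cnj (form f y x)"
proof (rule LIMSEQ_unique[OF form_tendsto[OF admissible_cnj[OF assms]]])
  have "Riemann_sum n (\<lambda>t. cnj (f t)) x y = cnj (Riemann_sum n f y x)" for n
    unfolding Riemann_sum_def cnj_sum complex_cnj_mult
    by (rule sum.cong) (auto simp: \<Omega>_hermitian[of _ y x])
  then show "(\<lambda>n. Riemann_sum n (\<lambda>t. cnj (f t)) x y) \<longlonglongrightarrow> cnj (form f y x)"
    using tendsto_cnj[OF form_tendsto[OF assms, of y x]] by simp
qed

lemma form_weight: 
  assumes "admissible (\<lambda>t. complex_of_real (1 / (1 + t\<^sup>2)))"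
  shows "form (\<lambda>t. complex_of_real (1 / (1 + t\<^sup>2))) x y = cinner x y"
proof -
  let ?w = "\<lambda>t. complex_of_real (1 / (1 + t\<^sup>2))"
  have d: "form ?w v v = cinner v v" for v
    using form_diagonal[OF assms] strong_integral_has_integral[OF normalized]
    by (metis has_bochner_integral_integral_eq)
  show ?thesis
    by (rule sesquilinear_eqI[of "form ?w" cinner])
      (simp_all only: d form_add_left[OF assms] form_add_right[OF assms] form_scale_left[OF assms]
        form_scale_right[OF assms] cinner_add_left cinner_add_right cinner_scaleC_left cinner_scaleC_right)
qed

text \<open>On each cell the double sum collapses to r times (X, \<Omega>(cell) X), with X a linear
  combination of the x a, so the Riemann sums are nonnegative and so is their limit. The choice r =
  1 gives the Gram kernel, and r t = t the form of the multiplication operator, whence the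
  alternative for negative t.\<close>

lemma form_psd:
  assumes A: "finite A" and adm: "\<And>a b. a \<in> A \<Longrightarrow> b \<in> A \<Longrightarrow> admissible (G a b)"
    and G: "\<And>a b t. a \<in> A \<Longrightarrow> b \<in> A \<Longrightarrow> G a b t = complex_of_real (r t) * cnj (\<phi> a t) * \<phi> b t"
    and r: "\<And>t. 0 \<le> r t \<or> (t < 0 \<and> (\<forall>x. emeasure (\<mu> x) {..<0} = 0))"
  shows "(\<Sum>a\<in>A. \<Sum>b\<in>A. form (G a b) (x a) (x b)) \<in> \<real>\<^sub>\<ge>\<^sub>0"
proof (rule closed_sequentially[OF closed_nonneg_Reals_complex])
  show "(\<lambda>n. \<Sum>a\<in>A. \<Sum>b\<in>A. Riemann_sum n (G a b) (x a) (x b)) \<longlonglongrightarrow> (\<Sum>a\<in>A. \<Sum>b\<in>A. form (G a b) (x a) (x b))"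
    by (intro tendsto_sum form_tendsto adm)
  fix n
  define t where "t l = real_of_int l / real (Suc n)" for l
  define X where "X l = (\<Sum>a\<in>A. \<phi> a (t l) *\<^sub>C x a)" for l
  have \<Omega>sum: "\<Omega> (grid n l) (\<Sum>b\<in>B. y b) = (\<Sum>b\<in>B. \<Omega> (grid n l) (y b))" if "finite B" for l and B :: "'b set" and y
    using that
  proof (induction B rule: finite_induct)
    case empty
    then show ?case using \<Omega>_scale[of "grid n l" 0 0] by (simp add: scaleC.zero_left)
  qed (simp add: \<Omega>_add)
  have "(\<Sum>a\<in>A. \<Sum>b\<in>A. Riemann_sum n (G a b) (x a) (x b))
      = (\<Sum>a\<in>A. \<Sum>b\<in>A. \<Sum>l\<in>grid_index n. complex_of_real (r (t l)) * (cnj (\<phi> a (t l)) * \<phi> b (t l) * cinner (x a) (\<Omega> (grid n l) (x b))))"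
    unfolding Riemann_sum_def by (intro sum.cong refl) (simp add: G t_def mult_ac)
  also have "\<dots> = (\<Sum>a\<in>A. \<Sum>l\<in>grid_index n. \<Sum>b\<in>A. complex_of_real (r (t l)) * (cnj (\<phi> a (t l)) * \<phi> b (t l) * cinner (x a) (\<Omega> (grid n l) (x b))))"
    by (intro sum.cong refl sum.swap)
  also have "\<dots> = (\<Sum>l\<in>grid_index n. \<Sum>a\<in>A. \<Sum>b\<in>A. complex_of_real (r (t l)) * (cnj (\<phi> a (t l)) * \<phi> b (t l) * cinner (x a) (\<Omega> (grid n l) (x b))))"
    by (rule sum.swap)
  also have "\<dots> = (\<Sum>l\<in>grid_index n. complex_of_real (r (t l)) * cinner (X l) (\<Omega> (grid n l) (X l)))"
  proof (rule sum.cong[OF refl])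
    fix l
    have "cinner (X l) (\<Omega> (grid n l) (X l)) = (\<Sum>a\<in>A. cinner (\<phi> a (t l) *\<^sub>C x a) (\<Omega> (grid n l) (X l)))"
      unfolding X_def by (rule cinner.sum_left)
    also have "\<dots> = (\<Sum>a\<in>A. \<Sum>b\<in>A. cnj (\<phi> a (t l)) * \<phi> b (t l) * cinner (x a) (\<Omega> (grid n l) (x b)))"
      unfolding X_def \<Omega>sum[OF A] cinner.sum_right
      by (intro sum.cong refl) (simp add: \<Omega>_scale cinner_scaleC_left cinner_scaleC_right)
    finally show "(\<Sum>a\<in>A. \<Sum>b\<in>A. complex_of_real (r (t l)) * (cnj (\<phi> a (t l)) * \<phi> b (t l) * cinner (x a) (\<Omega> (grid n l) (x b))))
      = complex_of_real (r (t l)) * cinner (X l) (\<Omega> (grid n l) (X l))"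
      by (simp add: sum_distrib_left)
  qed
  also have "\<dots> \<in> \<real>\<^sub>\<ge>\<^sub>0"
  proof (rule sum_nonneg_Reals)
    fix l
    show "complex_of_real (r (t l)) * cinner (X l) (\<Omega> (grid n l) (X l)) \<in> \<real>\<^sub>\<ge>\<^sub>0"
      using r[of "t l"]
    proof (elim disjE conjE)
      assume "0 \<le> r (t l)"
      then show ?thesis by (intro nonneg_Reals_mult_I \<Omega>_nonneg) simp_all
    next
      assume t: "t l < 0" and null: "\<forall>x. emeasure (\<mu> x) {..<0} = 0"
      \<comment> \<open>A cell with negative left endpoint lies entirely below 0, because l + 1 <= 0
        and cells are half open.\<close>
      then have "l < 0" by (simp add: t_def divide_less_0_iff)
      then have "real_of_int l + 1 \<le> 0" by linarith
      then have "(real_of_int l + 1) / real (Suc n) \<le> 0" by (simp add: divide_le_0_iff)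
      then have "grid n l \<subseteq> {..<0}" unfolding grid_def by (auto intro: less_le_trans)
      then have "emeasure (\<mu> (X l)) (grid n l) \<le> 0" using null emeasure_mono[of "grid n l" "{..<0}" "\<mu> (X l)"] by simp
      then have "measure (\<mu> (X l)) (grid n l) = 0" by (simp add: measure_def)
      then show ?thesis by (simp add: cinner_\<Omega>)
    qed
  qed
  finally show "(\<Sum>a\<in>A. \<Sum>b\<in>A. Riemann_sum n (G a b) (x a) (x b)) \<in> \<real>\<^sub>\<ge>\<^sub>0" .
qed

end

section \<open>Positive definite kernels\<close>

text \<open>Membership in the nonnegative reals includes reality of the sums, which is what forces
  hermitian symmetry below.\<close>

definition psd_kernel :: "('x \<Rightarrow> 'x \<Rightarrow> complex) \<Rightarrow> bool" where
  "psd_kernel k \<longleftrightarrow> (\<forall>A c. finite A \<longrightarrow> (\<Sum>a\<in>A. \<Sum>b\<in>A. cnj (c a) * c b * k a b) \<in> \<real>\<^sub>\<ge>\<^sub>0)"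

lemma psd_kernelD: "psd_kernel k \<Longrightarrow> finite A \<Longrightarrow> (\<Sum>a\<in>A. \<Sum>b\<in>A. cnj (c a) * c b * k a b) \<in> \<real>\<^sub>\<ge>\<^sub>0"
  unfolding psd_kernel_def by blast

lemma psd_kernel_diag: "psd_kernel k \<Longrightarrow> k a a \<in> \<real>\<^sub>\<ge>\<^sub>0"
  using psd_kernelD[of k "{a}" "\<lambda>_. 1"] by simp

lemma psd_kernel_pair:
  assumes k: "psd_kernel k"
  shows "cnj s * s * k a a + cnj s * t * k a b + cnj t * s * k b a + cnj t * t * k b b \<in> \<real>\<^sub>\<ge>\<^sub>0"
\<comment> \<open>For a = b the two-point set collapses and the coefficients add.\<close>
proof (cases "a = b")
  case True
  have "(s + t) * cnj (s + t) * k b b \<in> \<real>\<^sub>\<ge>\<^sub>0"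
    using psd_kernelD[OF k, of "{b}" "\<lambda>_. s + t"] by (simp add: mult_ac)
  then show ?thesis using True by (simp add: algebra_simps)
next
  case False
  then show ?thesis
    using psd_kernelD[OF k, of "{a, b}" "\<lambda>x. if x = a then s else t"] by (simp add: algebra_simps)
qed

lemma psd_kernel_hermitian:
  assumes k: "psd_kernel k"
  shows "k b a = cnj (k a b)"
proof -
  have "Im (k a a) = 0" "Im (k b b) = 0"
    using psd_kernel_diag[OF k] by (auto simp: complex_nonneg_Reals_iff)
  then show ?thesis
    using psd_kernel_pair[OF k, of 1 a 1 b] psd_kernel_pair[OF k, of 1 a \<i> b]
    by (auto simp: complex_nonneg_Reals_iff complex_eq_iff)
qed

lemma psd_kernel_zero:
  assumes k: "psd_kernel k" and z: "k a a = 0"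
  shows "k a b = 0"
proof (rule ccontr)
  assume nz: "k a b \<noteq> 0"
  define m where "m = (cmod (k a b))\<^sup>2"
  have m: "m > 0" using nz by (simp add: m_def)
  \<comment> \<open>With coefficient -r k(a, b) at a and 1 at b, the form takes the value k(b, b) -
    2 (k(b, b) + 1) < 0.\<close>
  define r where "r = (Re (k b b) + 1) / m"
  have "k b a = cnj (k a b)" by (rule psd_kernel_hermitian[OF k])
  moreover have "k a b * cnj (k a b) = of_real m" by (simp add: m_def complex_norm_square del: of_real_power)
  ultimately have eq: "cnj (- of_real r * k a b) * (- of_real r * k a b) * k a a + cnj (- of_real r * k a b) * 1 * k a b
      + cnj 1 * (- of_real r * k a b) * k b a + cnj 1 * 1 * k b b = k b b - 2 * of_real (r * m)"
    by (simp add: z mult_ac)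
  have "k b b - 2 * of_real (r * m) \<in> \<real>\<^sub>\<ge>\<^sub>0"
    using psd_kernel_pair[OF k, of "- of_real r * k a b" a 1 b] unfolding eq .
  then have "0 \<le> Re (k b b) - 2 * (r * m)" by (simp add: complex_nonneg_Reals_iff)
  moreover have "r * m = Re (k b b) + 1" using m by (simp add: r_def)
  moreover have "0 \<le> Re (k b b)" using psd_kernel_diag[OF k, of b] by (simp add: complex_nonneg_Reals_iff)
  ultimately show False by simp
qed

text \<open>The Schur complement is the minimum of the quadratic form over the coefficient at i, and
  t is the minimizer. If k i i = 0, division by 0 gives 0, so t = 0 and the kernel is
  unchanged.\<close>

lemma psd_kernel_Schur:
  assumes k: "psd_kernel k"
  shows "psd_kernel (\<lambda>a b. k a b - k a i * k i b / k i i)"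
  unfolding psd_kernel_def
proof (intro allI impI)
  fix A :: "'a set" and c :: "'a \<Rightarrow> complex" assume A: "finite A"
  \<comment> \<open>i may already belong to A, so the new coefficient e is added to c0 instead of
    being assigned; the form then splits into four sums.\<close>
  define c0 where "c0 a = (if a \<in> A then c a else 0)" for a
  define s where "s = (\<Sum>b\<in>A. c b * k i b)"
  define t where "t = - s / k i i"
  define A' where "A' = insert i A"
  have A': "finite A'" using A by (simp add: A'_def)
  have sum0: "(\<Sum>a\<in>A'. F (c0 a) a) = (\<Sum>a\<in>A. F (c a) a)" if "\<And>a. F 0 a = 0" for F :: "complex \<Rightarrow> 'a \<Rightarrow> complex"
    using that A unfolding A'_def c0_def by (intro sum.mono_neutral_cong_right) auto
  have sumi: "(\<Sum>a\<in>A'. if a = i then F a else 0) = F i" for F :: "'a \<Rightarrow> complex"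
    using A' by (simp add: A'_def)
  have cs: "(\<Sum>a\<in>A. cnj (c a) * k a i) = cnj s"
    unfolding s_def by (simp add: psd_kernel_hermitian[OF k, of _ i])
  define e where "e a = (if a = i then t else 0)" for a
  have "(\<Sum>a\<in>A'. \<Sum>b\<in>A'. cnj (c0 a + e a) * (c0 b + e b) * k a b)
      = (\<Sum>a\<in>A'. \<Sum>b\<in>A'. cnj (c0 a) * c0 b * k a b) + (\<Sum>a\<in>A'. \<Sum>b\<in>A'. cnj (c0 a) * e b * k a b)
      + (\<Sum>a\<in>A'. \<Sum>b\<in>A'. cnj (e a) * c0 b * k a b) + (\<Sum>a\<in>A'. \<Sum>b\<in>A'. cnj (e a) * e b * k a b)"
    by (simp add: sum.distrib[symmetric] algebra_simps)
  also have "(\<Sum>a\<in>A'. \<Sum>b\<in>A'. cnj (c0 a) * c0 b * k a b) = (\<Sum>a\<in>A. \<Sum>b\<in>A. cnj (c a) * c b * k a b)"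
    using sum0[of "\<lambda>u a. \<Sum>b\<in>A'. cnj u * c0 b * k a b"] sum0[of "\<lambda>u b. cnj (c a) * u * k a b" for a] by simp
  also have "(\<Sum>a\<in>A'. \<Sum>b\<in>A'. cnj (c0 a) * e b * k a b) = t * cnj s"
  proof -
    have "(\<Sum>b\<in>A'. cnj (c0 a) * e b * k a b) = cnj (c0 a) * k a i * t" for a
      using sumi[of "\<lambda>b. cnj (c0 a) * t * k a b"] by (simp add: e_def if_distrib[of "\<lambda>x. _ * x"] if_distrib[of "\<lambda>x. x * _"] mult_ac cong: if_cong)
    then have "(\<Sum>a\<in>A'. \<Sum>b\<in>A'. cnj (c0 a) * e b * k a b) = (\<Sum>a\<in>A. cnj (c a) * k a i * t)"
      using sum0[of "\<lambda>u a. cnj u * k a i * t"] by simp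
    also have "\<dots> = t * cnj s" by (simp add: cs[symmetric] sum_distrib_left mult_ac)
    finally show ?thesis .
  qed
  also have "(\<Sum>a\<in>A'. \<Sum>b\<in>A'. cnj (e a) * c0 b * k a b) = cnj t * s"
  proof -
    have "(\<Sum>a\<in>A'. \<Sum>b\<in>A'. cnj (e a) * c0 b * k a b) = (\<Sum>b\<in>A'. \<Sum>a\<in>A'. cnj (e a) * c0 b * k a b)" by (rule sum.swap)
    also have "(\<Sum>a\<in>A'. cnj (e a) * c0 b * k a b) = cnj t * c0 b * k i b" for b
      using sumi[of "\<lambda>a. cnj t * c0 b * k a b"] by (simp add: e_def if_distrib[of cnj] if_distrib[of "\<lambda>x. _ * x"] if_distrib[of "\<lambda>x. x * _"] mult_ac cong: if_cong)
    then have "(\<Sum>b\<in>A'. \<Sum>a\<in>A'. cnj (e a) * c0 b * k a b) = (\<Sum>b\<in>A. cnj t * c b * k i b)"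
      using sum0[of "\<lambda>u b. cnj t * u * k i b"] by simp
    also have "\<dots> = cnj t * s" by (simp add: s_def sum_distrib_left mult_ac)
    finally show ?thesis .
  qed
  also have "(\<Sum>a\<in>A'. \<Sum>b\<in>A'. cnj (e a) * e b * k a b) = cnj t * t * k i i"
  proof -
    have "(\<Sum>b\<in>A'. cnj (e a) * e b * k a b) = (if a = i then cnj t * t * k a i else 0)" for a
      using sumi[of "\<lambda>b. cnj t * t * k a b"]
      by (cases "a = i") (simp_all add: e_def if_distrib[of "\<lambda>x. _ * x"] if_distrib[of "\<lambda>x. x * _"] mult_ac cong: if_cong)
    then show ?thesis by (simp add: sumi)
  qed
  finally have Q: "(\<Sum>a\<in>A. \<Sum>b\<in>A. cnj (c a) * c b * k a b) + t * cnj s + cnj t * s + cnj t * t * k i i \<in> \<real>\<^sub>\<ge>\<^sub>0"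
    using psd_kernelD[OF k A', of "\<lambda>a. c0 a + e a"] by simp
  have ki: "cnj (k i i) = k i i" using psd_kernel_hermitian[OF k, of i i] by simp
  have "t * cnj s + cnj t * s + cnj t * t * k i i = - (cnj s * s / k i i)"
    by (cases "k i i = 0") (simp_all add: t_def ki field_simps)
  moreover have "(\<Sum>a\<in>A. \<Sum>b\<in>A. cnj (c a) * c b * (k a i * k i b / k i i))
      = (\<Sum>a\<in>A. cnj (c a) * k a i) * (\<Sum>b\<in>A. c b * k i b) / k i i"
    unfolding sum_product sum_divide_distrib by (intro sum.cong refl) (simp add: mult_ac)
  then have "(\<Sum>a\<in>A. \<Sum>b\<in>A. cnj (c a) * c b * (k a i * k i b / k i i)) = cnj s * s / k i i"
    by (simp only: cs s_def[symmetric])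
  then have "(\<Sum>a\<in>A. \<Sum>b\<in>A. cnj (c a) * c b * (k a b - k a i * k i b / k i i))
      = (\<Sum>a\<in>A. \<Sum>b\<in>A. cnj (c a) * c b * k a b) - cnj s * s / k i i"
    by (simp add: right_diff_distrib sum_subtractf)
  ultimately show "(\<Sum>a\<in>A. \<Sum>b\<in>A. cnj (c a) * c b * (k a b - k a i * k i b / k i i)) \<in> \<real>\<^sub>\<ge>\<^sub>0"
    using Q by (simp add: add.assoc)
qed

text \<open>Cholesky decomposition: \<open>Schur_iter k n\<close> is the Schur complement of the leading
  \<open>n\<close> by \<open>n\<close> block.\<close>

fun Schur_iter :: "(nat \<Rightarrow> nat \<Rightarrow> complex) \<Rightarrow> nat \<Rightarrow> nat \<Rightarrow> nat \<Rightarrow> complex" where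
  "Schur_iter k 0 a b = k a b"
| "Schur_iter k (Suc i) a b = Schur_iter k i a b - Schur_iter k i a i * Schur_iter k i i b / Schur_iter k i i i"

lemma Schur_iter_psd: "psd_kernel k \<Longrightarrow> psd_kernel (Schur_iter k i)"
proof (induction i)
  case 0
  moreover have "Schur_iter k 0 = k" by (intro ext) simp
  ultimately show ?case by simp
next
  case (Suc i)
  have "Schur_iter k (Suc i)
      = (\<lambda>a b. Schur_iter k i a b - Schur_iter k i a i * Schur_iter k i i b / Schur_iter k i i i)"
    by (intro ext) simp
  then show ?case using psd_kernel_Schur[OF Suc.IH[OF Suc.prems], of i] by simp
qed

text \<open>Eliminating a nonzero pivot i cancels row i; a zero pivot has a zero row already by
  \<open>psd_kernel_zero\<close>. Later steps subtract products with entries of that row, which are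
  0.\<close>

lemma Schur_iter_zero:
  assumes k: "psd_kernel k" and a: "a < i"
  shows "Schur_iter k i a b = 0" "Schur_iter k i b a = 0"
proof -
  have "\<forall>b. Schur_iter k i a b = 0"
    using a
  proof (induction i)
    case (Suc i)
    show ?case
    proof (cases "a < i")
      case True
      then show ?thesis using Suc.IH by simp
    next
      case False
      then have [simp]: "a = i" using Suc.prems by simp
      show ?thesis
        using psd_kernel_zero[OF Schur_iter_psd[OF k], of i i] by (cases "Schur_iter k i i i = 0") simp_all
    qed
  qed simp
  then show "Schur_iter k i a b = 0" "Schur_iter k i b a = 0"
    using psd_kernel_hermitian[OF Schur_iter_psd[OF k], of i b a] by simp_all
qed

lemma Schur_iter_telescope:
  "k a b - Schur_iter k n a b = (\<Sum>i<n. Schur_iter k i a i * Schur_iter k i i b / Schur_iter k i i i)"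
  by (induction n) (simp_all add: algebra_simps)

text \<open>The vectors are the rows of the Cholesky factor. Each has finite support, hence lies in
  \<open>ell2\<close>, and the inner product telescopes to k a b because row a of the complement is
  0 after step a.\<close>

lemma countable_feature_map:
  fixes k :: "nat \<Rightarrow> nat \<Rightarrow> complex"
  assumes k: "psd_kernel k"
  obtains \<phi> :: "nat \<Rightarrow> ell2" where "\<And>a b. cinner (\<phi> a) (\<phi> b) = k a b"
proof -
  define L where "L n i = Schur_iter k i i n / of_real (sqrt (Re (Schur_iter k i i i)))" for n i
  have L0: "L n i = 0" if "i > n" for n i using Schur_iter_zero(2)[OF k that] by (simp add: L_def)
  have mem: "summable (\<lambda>i. (cmod (L n i))\<^sup>2)" for n
    by (rule summable_finite[of "{..n}"]) (auto intro: L0)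
  define \<phi> where "\<phi> n = Abs_ell2 (L n)" for n
  have nth: "ell2_nth (\<phi> n) = L n" for n using mem by (simp add: \<phi>_def Abs_ell2_inverse)
  have "cinner (\<phi> a) (\<phi> b) = k a b" for a b
  proof -
    have "cinner (\<phi> a) (\<phi> b) = (\<Sum>i<Suc a. cnj (L a i) * L b i)"
      unfolding cinner_ell2_def nth by (rule suminf_finite) (auto intro: L0)
    also have "\<dots> = (\<Sum>i<Suc a. Schur_iter k i a i * Schur_iter k i i b / Schur_iter k i i i)"
    proof (rule sum.cong[OF refl])
      fix i
      define r where "r = Re (Schur_iter k i i i)"
      have r: "0 \<le> r" "Schur_iter k i i i = of_real r"
        using psd_kernel_diag[OF Schur_iter_psd[OF k], of i i] by (auto simp: r_def complex_nonneg_Reals_iff complex_eq_iff)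
      have "cnj (L a i) * L b i = Schur_iter k i a i * Schur_iter k i i b / (of_real (sqrt r) * of_real (sqrt r))"
        by (simp add: L_def r_def psd_kernel_hermitian[OF Schur_iter_psd[OF k], of i a i])
      also have "of_real (sqrt r) * of_real (sqrt r) = (of_real r :: complex)"
        using r(1) by (simp flip: of_real_mult)
      finally show "cnj (L a i) * L b i = Schur_iter k i a i * Schur_iter k i i b / Schur_iter k i i i"
        by (simp add: r(2))
    qed
    also have "\<dots> = k a b - Schur_iter k (Suc a) a b" by (rule Schur_iter_telescope[symmetric])
    also have "\<dots> = k a b" using Schur_iter_zero(1)[OF k, of a "Suc a" b] by simp
    finally show ?thesis .
  qed
  then show ?thesis by (rule that)
qed

text \<open>f may repeat values, so the coefficients are collected along its fibres.\<close>

lemma psd_kernel_comp: 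
  fixes k :: "'x \<Rightarrow> 'x \<Rightarrow> complex" and f :: "nat \<Rightarrow> 'x"
  assumes k: "psd_kernel k"
  shows "psd_kernel (\<lambda>a b. k (f a) (f b))"
  unfolding psd_kernel_def
proof (intro allI impI)
  fix A :: "nat set" and c :: "nat \<Rightarrow> complex" assume A: "finite A"
  define d where "d x = (\<Sum>a | a \<in> A \<and> f a = x. c a)" for x
  have g: "(\<Sum>a\<in>A. F a (f a)) = (\<Sum>x\<in>f ` A. \<Sum>a | a \<in> A \<and> f a = x. F a x)" for F :: "nat \<Rightarrow> 'x \<Rightarrow> complex"
  proof -
    have "(\<Sum>x\<in>f ` A. \<Sum>a | a \<in> A \<and> f a = x. F a x) = (\<Sum>x\<in>f ` A. \<Sum>a | a \<in> A \<and> f a = x. F a (f a))"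
      by (intro sum.cong refl) auto
    also have "\<dots> = (\<Sum>a\<in>A. F a (f a))" by (rule sum.group[OF A finite_imageI[OF A] subset_refl])
    finally show ?thesis by simp
  qed
  have "(\<Sum>b\<in>A. cnj u * c b * k x (f b)) = (\<Sum>y\<in>f ` A. cnj u * d y * k x y)" for u x
    unfolding g[of "\<lambda>b y. cnj u * c b * k x y"] d_def by (simp add: sum_distrib_left sum_distrib_right)
  then have "(\<Sum>a\<in>A. \<Sum>b\<in>A. cnj (c a) * c b * k (f a) (f b))
      = (\<Sum>a\<in>A. \<Sum>y\<in>f ` A. cnj (c a) * d y * k (f a) y)" by simp
  also have "\<dots> = (\<Sum>x\<in>f ` A. \<Sum>a | a \<in> A \<and> f a = x. \<Sum>y\<in>f ` A. cnj (c a) * d y * k x y)"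
    by (rule g)
  also have "\<dots> = (\<Sum>x\<in>f ` A. \<Sum>y\<in>f ` A. \<Sum>a | a \<in> A \<and> f a = x. cnj (c a) * d y * k x y)"
    by (intro sum.cong refl sum.swap)
  also have "\<dots> = (\<Sum>x\<in>f ` A. \<Sum>y\<in>f ` A. cnj (d x) * d y * k x y)"
    by (intro sum.cong refl, subst (2) d_def) (simp only: cnj_sum sum_distrib_right)
  also have "\<dots> \<in> \<real>\<^sub>\<ge>\<^sub>0" by (rule psd_kernelD[OF k finite_imageI[OF A]])
  finally show "(\<Sum>a\<in>A. \<Sum>b\<in>A. cnj (c a) * c b * k (f a) (f b)) \<in> \<real>\<^sub>\<ge>\<^sub>0" .
qed

text \<open>The squared distance of the images under any feature map, expressed by k so that density
  can be stated before a feature map exists.\<close>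

definition kernel_dist :: "('x \<Rightarrow> 'x \<Rightarrow> complex) \<Rightarrow> 'x \<Rightarrow> 'x \<Rightarrow> real" where
  "kernel_dist k x y = Re (k x x) - 2 * Re (k x y) + Re (k y y)"

lemma kernel_dist_norm:
  assumes "cinner u u = k x x" "cinner u v = k x y" "cinner v v = k y y"
  shows "(norm (u - v))\<^sup>2 = kernel_dist k x y"
  by (simp add: norm_diff_sq kernel_dist_def assms[symmetric] Re_cinner_self)

text \<open>Three points already have a feature map, where this is the triangle inequality combined
  with (a + b)^2 <= 2 a^2 + 2 b^2.\<close>

lemma kernel_dist_triangle:
  assumes k: "psd_kernel k"
  shows "kernel_dist k x z \<le> 2 * kernel_dist k x y + 2 * kernel_dist k y z"
proof -
  define f where "f n = (if n = 0 then x else if n = 1 then y else z)" for n :: nat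
  obtain \<phi> :: "nat \<Rightarrow> ell2" where \<phi>: "\<And>a b. cinner (\<phi> a) (\<phi> b) = k (f a) (f b)"
    using countable_feature_map[OF psd_kernel_comp[OF k, of f]] by blast
  have d: "(norm (\<phi> a - \<phi> b))\<^sup>2 = kernel_dist k (f a) (f b)" for a b
    by (rule kernel_dist_norm) (rule \<phi>)+
  have "(norm (\<phi> 0 - \<phi> 2))\<^sup>2 \<le> (norm (\<phi> 0 - \<phi> 1) + norm (\<phi> 1 - \<phi> 2))\<^sup>2"
    using norm_triangle_ineq[of "\<phi> 0 - \<phi> 1" "\<phi> 1 - \<phi> 2"] by (intro power_mono) simp_all
  also have "\<dots> \<le> 2 * (norm (\<phi> 0 - \<phi> 1))\<^sup>2 + 2 * (norm (\<phi> 1 - \<phi> 2))\<^sup>2"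
    using zero_le_power2[of "norm (\<phi> 0 - \<phi> 1) - norm (\<phi> 1 - \<phi> 2)"]
    by (simp add: power2_eq_square algebra_simps)
  finally show ?thesis unfolding d by (simp add: f_def)
qed

text \<open>\<psi> fixes the images of the dense sequence, and all other images are limits.
  Existence and inner products of these limits are seen in auxiliary feature maps, one for each pair
  x, y, defined on x, y and the sequence: on the sequence they have the Gram matrix of \<psi>, so
  limits of inner products agree.\<close>

lemma separable_feature_map:
  fixes k :: "'x \<Rightarrow> 'x \<Rightarrow> complex" and D :: "nat \<Rightarrow> 'x"
  assumes k: "psd_kernel k" and dense: "\<And>x e. e > 0 \<Longrightarrow> \<exists>n. kernel_dist k x (D n) < e"
  obtains \<phi> :: "'x \<Rightarrow> ell2" where "\<And>x y. cinner (\<phi> x) (\<phi> y) = k x y"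
proof -
  have "\<exists>s. \<forall>n. kernel_dist k x (D (s n)) < inverse (real (Suc n))" for x
    using dense[of "inverse (real (Suc n))" x for n] by (intro choice) simp
  then obtain s where s: "\<And>x n. kernel_dist k x (D (s x n)) < inverse (real (Suc n))" by metis
  obtain \<psi> :: "nat \<Rightarrow> ell2" where \<psi>: "\<And>a b. cinner (\<psi> a) (\<psi> b) = k (D a) (D b)"
    using countable_feature_map[OF psd_kernel_comp[OF k, of D]] by blast
  have loc: "\<exists>(\<theta> :: nat \<Rightarrow> ell2) u v. cinner u v = k x y \<and> (\<forall>a b. cinner (\<theta> a) (\<theta> b) = k (D a) (D b)) \<and>
      (\<lambda>n. \<theta> (s x n)) \<longlonglongrightarrow> u \<and> (\<lambda>n. \<theta> (s y n)) \<longlonglongrightarrow> v" for x y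
  proof -
    \<comment> \<open>x and y occupy the first two places, hence the shifts by 2 below.\<close>
    define f where "f n = (if n = 0 then x else if n = 1 then y else D (n - 2))" for n :: nat
    obtain \<beta> :: "nat \<Rightarrow> ell2" where \<beta>: "\<And>a b. cinner (\<beta> a) (\<beta> b) = k (f a) (f b)"
      using countable_feature_map[OF psd_kernel_comp[OF k, of f]] by blast
    have lim: "(\<lambda>n. \<beta> (s (f i) n + 2)) \<longlonglongrightarrow> \<beta> i" for i
    proof -
      have "(\<lambda>n. (norm (\<beta> i - \<beta> (s (f i) n + 2)))\<^sup>2) \<longlonglongrightarrow> 0"
      proof (rule tendsto_sandwich[OF _ _ tendsto_const LIMSEQ_inverse_real_of_nat])
        have "(norm (\<beta> i - \<beta> (s (f i) n + 2)))\<^sup>2 = kernel_dist k (f i) (D (s (f i) n))" for n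
          using kernel_dist_norm[of "\<beta> i" k "f i" "\<beta> (s (f i) n + 2)" "f (s (f i) n + 2)"] \<beta>
          by (simp add: f_def)
        then show "\<forall>\<^sub>F n in sequentially. (norm (\<beta> i - \<beta> (s (f i) n + 2)))\<^sup>2 \<le> inverse (real (Suc n))"
          using s[of "f i"] by (simp add: less_imp_le)
      qed simp
      then have "(\<lambda>n. \<beta> i - \<beta> (s (f i) n + 2)) \<longlonglongrightarrow> 0" by (simp add: tendsto_norm_zero_iff)
      from tendsto_diff[OF tendsto_const[of "\<beta> i"] this] show ?thesis by simp
    qed
    show ?thesis
      by (rule exI[of _ "\<lambda>n. \<beta> (n + 2)"], rule exI[of _ "\<beta> 0"], rule exI[of _ "\<beta> 1"])
        (use \<beta> lim[of 0] lim[of 1] in \<open>auto simp: f_def\<close>)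
  qed
  have "\<exists>u. (\<lambda>n. \<psi> (s x n)) \<longlonglongrightarrow> u" for x
  proof -
    obtain \<theta> :: "nat \<Rightarrow> ell2" and u where \<theta>: "\<And>a b. cinner (\<theta> a) (\<theta> b) = k (D a) (D b)" "(\<lambda>n. \<theta> (s x n)) \<longlonglongrightarrow> u"
      using loc[of x x] by blast
    have "(norm (\<psi> a - \<psi> b))\<^sup>2 = (norm (\<theta> a - \<theta> b))\<^sup>2" for a b
      by (simp add: kernel_dist_norm[of "\<psi> a" k "D a" "\<psi> b" "D b"] kernel_dist_norm[of "\<theta> a" k "D a" "\<theta> b" "D b"] \<psi> \<theta>(1))
    then have "norm (\<psi> a - \<psi> b) = norm (\<theta> a - \<theta> b)" for a b by (simp add: power2_eq_iff_nonneg)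
    then have "Cauchy (\<lambda>n. \<psi> (s x n))"
      using LIMSEQ_imp_Cauchy[OF \<theta>(2)] by (simp add: Cauchy_def dist_norm)
    then show ?thesis using convergent_def convergent_eq_Cauchy by blast
  qed
  then obtain \<phi> where \<phi>: "\<And>x. (\<lambda>n. \<psi> (s x n)) \<longlonglongrightarrow> \<phi> x" by metis
  have "cinner (\<phi> x) (\<phi> y) = k x y" for x y
  proof -
    obtain \<theta> :: "nat \<Rightarrow> ell2" and u v where \<theta>: "cinner u v = k x y" "\<And>a b. cinner (\<theta> a) (\<theta> b) = k (D a) (D b)"
        "(\<lambda>n. \<theta> (s x n)) \<longlonglongrightarrow> u" "(\<lambda>n. \<theta> (s y n)) \<longlonglongrightarrow> v"
      using loc[of x y] by blast
    have "(\<lambda>n. cinner (\<theta> (s x n)) (\<theta> (s y n))) \<longlonglongrightarrow> k x y"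
      using tendsto_cinner[OF \<theta>(3,4)] by (simp add: \<theta>(1))
    moreover have "(\<lambda>n. cinner (\<theta> (s x n)) (\<theta> (s y n))) \<longlonglongrightarrow> cinner (\<phi> x) (\<phi> y)"
      using tendsto_cinner[OF \<phi>[of x] \<phi>[of y]] by (simp add: \<psi> \<theta>(2))
    ultimately show ?thesis using LIMSEQ_unique by blast
  qed
  then show ?thesis by (rule that)
qed

section \<open>Separability of the sequence space\<close>

lemma separable_subset:
  fixes S T :: "'a::metric_space set"
  assumes T: "separable_set T" and S: "S \<subseteq> T"
  shows "separable_set S"
proof -
  obtain E where E: "countable E" "T \<subseteq> closure E" using T by (auto simp: separable_set_def)
  define P where "P = (\<lambda>(x, n). SOME y. y \<in> S \<and> dist x y < inverse (real (Suc n)))"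
  define C where "C = {p \<in> E \<times> UNIV. \<exists>y. y \<in> S \<and> dist (fst p) y < inverse (real (Suc (snd p)))}"
  have P: "P p \<in> S \<and> dist (fst p) (P p) < inverse (real (Suc (snd p)))" if "p \<in> C" for p
    using that unfolding C_def P_def by (cases p) (auto intro: someI2_ex)
  have "countable C" unfolding C_def
    by (rule countable_subset[of _ "E \<times> UNIV"]) (use E in auto)
  then have "countable (P ` C)" by (rule countable_image)
  moreover have "P ` C \<subseteq> S" using P by blast
  moreover have "S \<subseteq> closure (P ` C)"
  proof
    fix y assume y: "y \<in> S"
    show "y \<in> closure (P ` C)"
      unfolding closure_approachable
    proof (intro allI impI)
      fix e :: real assume "e > 0"
      then obtain n where n: "inverse (real (Suc n)) < e / 2" using reals_Archimedean[of "e / 2"] by auto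
      have "y \<in> closure E" using y S E by blast
      then obtain x where x: "x \<in> E" "dist x y < inverse (real (Suc n))"
        unfolding closure_approachable by (metis inverse_positive_iff_positive of_nat_0_less_iff zero_less_Suc)
      then have p: "(x, n) \<in> C" using y by (auto simp: C_def)
      have "dist (P (x, n)) y \<le> dist x (P (x, n)) + dist x y" by (rule dist_triangle3)
      also have "\<dots> < e" using P[OF p] x n by simp
      finally show "\<exists>z\<in>P ` C. dist z y < e" using p by blast
    qed
  qed
  ultimately show ?thesis by (auto simp: separable_set_def)
qed

lemma separable_ell2: "separable_set (UNIV :: ell2 set)"
proof -
  define q :: "rat \<times> rat \<Rightarrow> complex" where "q p = Complex (of_rat (fst p)) (of_rat (snd p))" for p
  have qd: "\<exists>p. cmod (q p - z) < e" if e: "e > 0" for z e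
  proof -
    have r: "\<exists>a. \<bar>of_rat a - r\<bar> < e / 2" for r :: real
    proof -
      obtain a where "r - e / 2 < of_rat a" "of_rat a < r + e / 2"
        using of_rat_dense[of "r - e / 2" "r + e / 2"] e by auto
      then show ?thesis by (intro exI[of _ a]) linarith
    qed
    from r[of "Re z"] obtain a where a: "\<bar>of_rat a - Re z\<bar> < e / 2" by blast
    from r[of "Im z"] obtain b where b: "\<bar>of_rat b - Im z\<bar> < e / 2" by blast
    have "cmod (q (a, b) - z) \<le> \<bar>of_rat a - Re z\<bar> + \<bar>of_rat b - Im z\<bar>"
      using cmod_le[of "q (a, b) - z"] by (simp add: q_def)
    then show ?thesis using a b by (intro exI[of _ "(a, b)"]) linarith
  qed
  define u where "u l i = (if i < length l then q (l ! i) else 0)" for l :: "(rat \<times> rat) list" and i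
  have us: "summable (\<lambda>i. (cmod (u l i))\<^sup>2)" for l
    by (rule summable_finite[of "{..<length l}"]) (auto simp: u_def)
  have nth: "ell2_nth (Abs_ell2 (u l)) = u l" for l using us by (simp add: Abs_ell2_inverse)
  have "x \<in> closure (range (\<lambda>l. Abs_ell2 (u l)))" for x
    unfolding closure_approachable
  proof (intro allI impI)
    fix e :: real assume e: "e > 0"
    have sx: "summable (\<lambda>i. (cmod (ell2_nth x i))\<^sup>2)" by (rule summable_ell2)
    obtain N where N: "(\<Sum>i. (cmod (ell2_nth x (i + N)))\<^sup>2) < e\<^sup>2 / 2"
      using suminf_exist_split[OF _ sx, of "e\<^sup>2 / 2"] e suminf_nonneg[OF summable_ignore_initial_segment[OF sx]]
      by auto
    \<comment> \<open>This tolerance makes the first N coordinates contribute at most e^2/4, next to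
      less than e^2/2 from the tail.\<close>
    have "\<exists>p. cmod (q p - ell2_nth x i) < e / (2 * real (Suc N))" for i using e by (intro qd) simp
    then obtain p where p: "\<And>i. cmod (q (p i) - ell2_nth x i) < e / (2 * real (Suc N))" by metis
    define l where "l = map p [0..<N]"
    have ul: "u l i = (if i < N then q (p i) else 0)" for i by (simp add: u_def l_def)
    have sd: "summable (\<lambda>i. (cmod (ell2_nth (Abs_ell2 (u l) - x) i))\<^sup>2)" by (rule summable_ell2)
    have "(norm (Abs_ell2 (u l) - x))\<^sup>2 = (\<Sum>i. (cmod (ell2_nth (Abs_ell2 (u l) - x) i))\<^sup>2)"
      by (simp add: norm_ell2_def suminf_nonneg[OF sd])
    also have "\<dots> = (\<Sum>i. (cmod (ell2_nth (Abs_ell2 (u l) - x) (i + N)))\<^sup>2)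
        + (\<Sum>i<N. (cmod (ell2_nth (Abs_ell2 (u l) - x) i))\<^sup>2)"
      by (rule suminf_split_initial_segment[OF sd])
    also have "(\<Sum>i. (cmod (ell2_nth (Abs_ell2 (u l) - x) (i + N)))\<^sup>2) = (\<Sum>i. (cmod (ell2_nth x (i + N)))\<^sup>2)"
      by (simp add: minus_ell2.rep_eq nth ul)
    also have "(\<Sum>i<N. (cmod (ell2_nth (Abs_ell2 (u l) - x) i))\<^sup>2) \<le> (\<Sum>i<N. (e / (2 * real (Suc N)))\<^sup>2)"
      by (intro sum_mono power_mono) (use p in \<open>auto simp: minus_ell2.rep_eq nth ul intro: less_imp_le\<close>)
    also have "\<dots> = e\<^sup>2 * (real N / (4 * (real (Suc N))\<^sup>2))"
      by (simp add: power_divide power_mult_distrib del: of_nat_Suc)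
    also have "\<dots> \<le> e\<^sup>2 * (1 / 4)"
    proof (rule mult_left_mono)
      have "real N \<le> (real (Suc N))\<^sup>2" by (simp add: power2_eq_square algebra_simps)
      then show "real N / (4 * (real (Suc N))\<^sup>2) \<le> 1 / 4" by (simp add: divide_simps)
    qed simp
    finally have "(norm (Abs_ell2 (u l) - x))\<^sup>2 < e\<^sup>2" using N zero_less_power[OF e, of 2] by linarith
    then have "dist (Abs_ell2 (u l)) x < e" using e by (simp add: dist_norm power_less_imp_less_base)
    then show "\<exists>y\<in>range (\<lambda>l. Abs_ell2 (u l)). dist y x < e" by blast
  qed
  then show ?thesis
    unfolding separable_set_def by (intro exI[of _ "range (\<lambda>l. Abs_ell2 (u l))"]) auto
qed

section \<open>The multiplication operator\<close>

text \<open>Both 1 and t^2 are compared with d = |t - z|^2, using d >= (Im z)^2 and t^2 <= 2 d + 2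
  |z|^2.\<close>

lemma pole_bound:
  assumes z: "Im z \<noteq> 0"
  shows "1 + t\<^sup>2 \<le> (2 + (1 + 2 * (cmod z)\<^sup>2) / (Im z)\<^sup>2) * (cmod (of_real t - z))\<^sup>2"
proof -
  define d where "d = (cmod (of_real t - z))\<^sup>2"
  have "\<bar>Im z\<bar> \<le> cmod (of_real t - z)" using abs_Im_le_cmod[of "of_real t - z"] by simp
  then have "\<bar>Im z\<bar>\<^sup>2 \<le> d" unfolding d_def by (rule power_mono) simp
  then have d: "(Im z)\<^sup>2 \<le> d" by simp
  have "1 + 2 * (cmod z)\<^sup>2 = (1 + 2 * (cmod z)\<^sup>2) / (Im z)\<^sup>2 * (Im z)\<^sup>2" using z by simp
  also have "\<dots> \<le> (1 + 2 * (cmod z)\<^sup>2) / (Im z)\<^sup>2 * d" using d by (intro mult_left_mono) simp_all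
  finally have 1: "1 + 2 * (cmod z)\<^sup>2 \<le> (1 + 2 * (cmod z)\<^sup>2) / (Im z)\<^sup>2 * d" .
  have "\<bar>t\<bar> \<le> cmod (of_real t - z) + cmod z"
    using norm_triangle_ineq[of "of_real t - z" z] by simp
  then have "\<bar>t\<bar>\<^sup>2 \<le> (cmod (of_real t - z) + cmod z)\<^sup>2" by (rule power_mono) simp
  also have "\<dots> \<le> 2 * d + 2 * (cmod z)\<^sup>2"
    using zero_le_power2[of "cmod (of_real t - z) - cmod z"] by (simp add: d_def power2_eq_square algebra_simps)
  finally have "t\<^sup>2 \<le> 2 * d + 2 * (cmod z)\<^sup>2" by simp
  with 1 have "1 + t\<^sup>2 \<le> 2 * d + (1 + 2 * (cmod z)\<^sup>2) / (Im z)\<^sup>2 * d" by linarith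
  then show ?thesis by (simp add: d_def distrib_right)
qed

text \<open>With the value \<open>0\<close> for real \<open>z\<close>, the kernel \<open>kern\<close> below is defined for all complex \<open>z\<close>.\<close>

definition pole :: "complex \<Rightarrow> real \<Rightarrow> complex" where
  "pole z t = (if Im z = 0 then 0 else 1 / (of_real t - z))"

lemma of_real_diff_nz: "Im z \<noteq> 0 \<Longrightarrow> of_real t - z \<noteq> 0"
  by (auto simp: complex_eq_iff)

text \<open>Decay like 1/|t|, half of what \<open>admissible\<close> asks, so that products of two
  such functions are admissible.\<close>

definition half_admissible :: "(real \<Rightarrow> complex) \<Rightarrow> bool" where
  "half_admissible \<phi> \<longleftrightarrow> continuous_on UNIV \<phi> \<and> (\<exists>C. \<forall>t. (cmod (\<phi> t))\<^sup>2 \<le> C / (1 + t\<^sup>2))"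

definition pole_const :: "complex \<Rightarrow> real" where
  "pole_const z = 2 + (1 + 2 * (cmod z)\<^sup>2) / (Im z)\<^sup>2"

lemma pole_const_nonneg: "0 \<le> pole_const z"
  by (simp add: pole_const_def)

lemma pole_le: "(cmod (pole z t))\<^sup>2 \<le> pole_const z / (1 + t\<^sup>2)"
proof (cases "Im z = 0")
  case True
  then show ?thesis using pole_const_nonneg[of z] by (simp add: pole_def)
next
  case False
  define d where "d = (cmod (of_real t - z))\<^sup>2"
  have d: "d > 0" using of_real_diff_nz[OF False] by (simp add: d_def)
  have "1 + t\<^sup>2 \<le> pole_const z * d"
    unfolding pole_const_def d_def by (rule pole_bound[OF False])
  then have "1 / d \<le> pole_const z / (1 + t\<^sup>2)"
    using d by (simp add: divide_simps add_pos_nonneg)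
  then show ?thesis using False by (simp add: pole_def norm_divide power_divide d_def)
qed

lemma half_pole: "half_admissible (pole z)"
proof -
  have "continuous_on UNIV (pole z)"
    using of_real_diff_nz[of z] unfolding pole_def by (cases "Im z = 0") (auto intro!: continuous_intros)
  then show ?thesis using pole_le half_admissible_def by blast
qed

lemma half_scale: "half_admissible \<phi> \<Longrightarrow> half_admissible (\<lambda>t. c * \<phi> t)"
proof -
  assume p: "half_admissible \<phi>"
  obtain C where C: "\<And>t. (cmod (\<phi> t))\<^sup>2 \<le> C / (1 + t\<^sup>2)" using p by (auto simp: half_admissible_def)
  have "(cmod (c * \<phi> t))\<^sup>2 \<le> ((cmod c)\<^sup>2 * C) / (1 + t\<^sup>2)" for t
    using mult_left_mono[OF C[of t], of "(cmod c)\<^sup>2"] by (simp add: norm_mult power_mult_distrib)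
  then show ?thesis using p by (auto simp: half_admissible_def intro!: continuous_intros)
qed

lemma half_diff: "half_admissible \<phi> \<Longrightarrow> half_admissible \<psi> \<Longrightarrow> half_admissible (\<lambda>t. \<phi> t - \<psi> t)"
proof -
  assume p: "half_admissible \<phi>" and q: "half_admissible \<psi>"
  obtain C where C: "\<And>t. (cmod (\<phi> t))\<^sup>2 \<le> C / (1 + t\<^sup>2)" using p by (auto simp: half_admissible_def)
  obtain D where D: "\<And>t. (cmod (\<psi> t))\<^sup>2 \<le> D / (1 + t\<^sup>2)" using q by (auto simp: half_admissible_def)
  have "(cmod (\<phi> t - \<psi> t))\<^sup>2 \<le> (2 * C + 2 * D) / (1 + t\<^sup>2)" for t
  proof -
    have "(cmod (\<phi> t - \<psi> t))\<^sup>2 \<le> (cmod (\<phi> t) + cmod (\<psi> t))\<^sup>2"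
      by (rule power_mono[OF norm_triangle_ineq4]) simp
    also have "\<dots> \<le> 2 * (cmod (\<phi> t))\<^sup>2 + 2 * (cmod (\<psi> t))\<^sup>2"
      using zero_le_power2[of "cmod (\<phi> t) - cmod (\<psi> t)"] by (simp add: power2_eq_square algebra_simps)
    also have "\<dots> \<le> 2 * (C / (1 + t\<^sup>2)) + 2 * (D / (1 + t\<^sup>2))" by (intro add_mono mult_left_mono C D) simp_all
    finally show ?thesis by (simp add: add_divide_distrib)
  qed
  then show ?thesis using p q by (auto simp: half_admissible_def intro!: continuous_intros)
qed

section \<open>The Gram kernel of poles and its feature map\<close>

locale separable_povm = normalized_povm \<Omega> for \<Omega> :: "real set \<Rightarrow> 'n::chilbert_space \<Rightarrow> 'n" +
  assumes separable: "separable_set (UNIV :: 'n set)"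
begin

lemma half_mult:
  assumes p: "half_admissible \<phi>" and q: "half_admissible \<psi>"
  shows "admissible (\<lambda>t. cnj (\<phi> t) * \<psi> t)"
proof -
  obtain C where C: "\<And>t. (cmod (\<phi> t))\<^sup>2 \<le> C / (1 + t\<^sup>2)" using p by (auto simp: half_admissible_def)
  obtain D where D: "\<And>t. (cmod (\<psi> t))\<^sup>2 \<le> D / (1 + t\<^sup>2)" using q by (auto simp: half_admissible_def)
  have "cmod (cnj (\<phi> t) * \<psi> t) \<le> (C + D) / (1 + t\<^sup>2)" for t
  proof -
    have "2 * (cmod (\<phi> t) * cmod (\<psi> t)) \<le> (cmod (\<phi> t))\<^sup>2 + (cmod (\<psi> t))\<^sup>2"
      using zero_le_power2[of "cmod (\<phi> t) - cmod (\<psi> t)"] by (simp add: power2_eq_square algebra_simps)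
    moreover have "0 \<le> cmod (\<phi> t) * cmod (\<psi> t)" by simp
    ultimately have "cmod (\<phi> t) * cmod (\<psi> t) \<le> C / (1 + t\<^sup>2) + D / (1 + t\<^sup>2)"
      using C[of t] D[of t] by linarith
    then show ?thesis by (simp add: norm_mult add_divide_distrib)
  qed
  then show ?thesis using p q by (auto simp: half_admissible_def admissible_def intro!: continuous_intros)
qed

lemma form_fun_diff:
  assumes "admissible f" "admissible g"
  shows "form (\<lambda>t. f t - g t) x y = form f x y - form g x y"
  using form_fun_add[OF assms(1) admissible_scale[OF assms(2), of "- 1"]] form_fun_scale[OF assms(2), of "- 1"]
  by simp

lemma admissible_diff: "admissible f \<Longrightarrow> admissible g \<Longrightarrow> admissible (\<lambda>t. f t - g t)"
  using admissible_add[of f "\<lambda>t. - 1 * g t"] admissible_scale[of g "- 1"] by simp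

lemma form_half_diff:
  assumes "half_admissible a" "half_admissible b" "half_admissible c" "half_admissible d"
  shows "form (\<lambda>t. cnj (a t - b t) * (c t - d t)) x y
    = form (\<lambda>t. cnj (a t) * c t) x y - form (\<lambda>t. cnj (a t) * d t) x y
      - (form (\<lambda>t. cnj (b t) * c t) x y - form (\<lambda>t. cnj (b t) * d t) x y)"
proof -
  have "(\<lambda>t. cnj (a t - b t) * (c t - d t))
    = (\<lambda>t. (cnj (a t) * c t - cnj (a t) * d t) - (cnj (b t) * c t - cnj (b t) * d t))"
    by (simp add: algebra_simps)
  then show ?thesis using assms by (simp add: form_fun_diff admissible_diff half_mult)
qed

lemma form_half_cnj:
  "half_admissible a \<Longrightarrow> half_admissible b \<Longrightarrow> form (\<lambda>t. cnj (b t) * a t) y x = cnj (form (\<lambda>t. cnj (a t) * b t) x y)"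
  using form_cnj[OF half_mult, of a b y x] by (simp add: mult.commute)

lemma integral_weight: "(\<integral>t. 1 / (1 + t\<^sup>2) \<partial>\<mu> x) = (norm x)\<^sup>2"
proof -
  have "(\<integral>t. complex_of_real (1 / (1 + t\<^sup>2)) \<partial>\<mu> x) = cinner x x"
    using strong_integral_has_integral[OF normalized] by (rule has_bochner_integral_integral_eq)
  then have "complex_of_real (\<integral>t. 1 / (1 + t\<^sup>2) \<partial>\<mu> x) = of_real ((norm x)\<^sup>2)"
    unfolding integral_complex_of_real cinner_self .
  then show ?thesis unfolding of_real_eq_iff .
qed

lemma form_le:
  assumes f: "admissible f" and C: "\<And>t. cmod (f t) \<le> C / (1 + t\<^sup>2)"
  shows "cmod (form f x x) \<le> C * (norm x)\<^sup>2"
proof -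
  have "cmod (form f x x) \<le> (\<integral>t. cmod (f t) \<partial>\<mu> x)"
    unfolding form_diagonal[OF f] by (rule integral_norm_bound)
  also have "\<dots> \<le> (\<integral>t. C * (1 / (1 + t\<^sup>2)) \<partial>\<mu> x)"
    using C by (intro integral_mono integrable_norm admissible_integrable[OF f] integrable_mult_right integrable_weight) simp
  also have "\<dots> = C * (norm x)\<^sup>2" by (simp only: integral_mult_right_zero integral_weight)
  finally show ?thesis .
qed

definition kern :: "complex \<times> 'n \<Rightarrow> complex \<times> 'n \<Rightarrow> complex" where
  "kern p q = form (\<lambda>t. cnj (pole (fst p) t) * pole (fst q) t) (snd p) (snd q)"

lemma kern_psd: "psd_kernel kern"
  unfolding psd_kernel_def
proof (intro allI impI)
  fix A :: "(complex \<times> 'n) set" and c assume A: "finite A"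
  have "(\<Sum>a\<in>A. \<Sum>b\<in>A. cnj (c a) * c b * kern a b)
      = (\<Sum>a\<in>A. \<Sum>b\<in>A. form (\<lambda>t. cnj (pole (fst a) t) * pole (fst b) t) (c a *\<^sub>C snd a) (c b *\<^sub>C snd b))"
    by (simp only: kern_def form_scale_left[OF half_mult[OF half_pole half_pole]]
        form_scale_right[OF half_mult[OF half_pole half_pole]] mult.assoc mult.left_commute)
  also have "\<dots> \<in> \<real>\<^sub>\<ge>\<^sub>0"
    by (rule form_psd[OF A, of _ "\<lambda>_. 1" "\<lambda>a. pole (fst a)"]) (auto intro: half_mult half_pole)
  finally show "(\<Sum>a\<in>A. \<Sum>b\<in>A. cnj (c a) * c b * kern a b) \<in> \<real>\<^sub>\<ge>\<^sub>0" .
qed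

text \<open>Resolvent identity: 1/(t - z) - 1/(t - w) = (z - w)/((t - z)(t - w)), where the factor
  1/(t - w) is bounded by 1/|Im w|.\<close>

lemma kern_dist_pole:
  assumes z: "Im z \<noteq> 0" and w: "Im w \<noteq> 0"
  shows "kernel_dist kern (z, x) (w, x) \<le> (cmod (z - w))\<^sup>2 / (Im w)\<^sup>2 * pole_const z * (norm x)\<^sup>2"
proof -
  let ?f = "\<lambda>t. cnj (pole z t - pole w t) * (pole z t - pole w t)"
  have adm: "admissible ?f" by (intro half_mult half_diff half_pole)
  have "form ?f x x = kern (z, x) (z, x) - kern (z, x) (w, x) - (cnj (kern (z, x) (w, x)) - kern (w, x) (w, x))"
    unfolding form_half_diff[OF half_pole half_pole half_pole half_pole] kern_def fst_conv snd_conv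
    using form_half_cnj[OF half_pole half_pole, of w z x x] by simp
  then have "kernel_dist kern (z, x) (w, x) = Re (form ?f x x)" by (simp add: kernel_dist_def)
  also have "\<dots> \<le> cmod (form ?f x x)" by (rule complex_Re_le_cmod)
  also have "\<dots> \<le> ((cmod (z - w))\<^sup>2 / (Im w)\<^sup>2 * pole_const z) * (norm x)\<^sup>2"
  proof (rule form_le[OF adm])
    fix t
    have nz: "of_real t - z \<noteq> 0" "of_real t - w \<noteq> 0" using of_real_diff_nz z w by auto
    have "pole z t - pole w t = (z - w) * pole z t * (1 / (of_real t - w))"
      using z w nz by (simp add: pole_def field_simps)
    then have 1: "(cmod (pole z t - pole w t))\<^sup>2 = (cmod (z - w))\<^sup>2 * (cmod (pole z t))\<^sup>2 * (1 / (cmod (of_real t - w))\<^sup>2)"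
      by (simp add: norm_mult norm_divide power_mult_distrib power_divide)
    have "\<bar>Im w\<bar> \<le> cmod (of_real t - w)" using abs_Im_le_cmod[of "of_real t - w"] by simp
    then have "\<bar>Im w\<bar>\<^sup>2 \<le> (cmod (of_real t - w))\<^sup>2" by (rule power_mono) simp
    then have 2: "1 / (cmod (of_real t - w))\<^sup>2 \<le> 1 / (Im w)\<^sup>2" using w nz(2) by (intro divide_left_mono) auto
    have "cmod (?f t) = (cmod (pole z t - pole w t))\<^sup>2"
      by (simp only: norm_mult complex_mod_cnj power2_eq_square)
    also have "\<dots> \<le> (cmod (z - w))\<^sup>2 * (pole_const z / (1 + t\<^sup>2)) * (1 / (Im w)\<^sup>2)"
      unfolding 1 using pole_const_nonneg by (intro mult_mono mult_nonneg_nonneg 2 pole_le order_refl divide_nonneg_nonneg) auto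
    finally show "cmod (?f t) \<le> (cmod (z - w))\<^sup>2 / (Im w)\<^sup>2 * pole_const z / (1 + t\<^sup>2)" by (simp add: field_simps)
  qed
  finally show ?thesis .
qed

lemma kern_dist_vector: "kernel_dist kern (w, x) (w, y) \<le> pole_const w * (norm (x - y))\<^sup>2"
proof -
  let ?f = "\<lambda>t. cnj (pole w t) * pole w t"
  have adm: "admissible ?f" by (intro half_mult half_pole)
  have "form ?f (x + (- 1) *\<^sub>C y) (x + (- 1) *\<^sub>C y) = kern (w, x) (w, x) - kern (w, x) (w, y) - cnj (kern (w, x) (w, y)) + kern (w, y) (w, y)"
    using form_half_cnj[OF half_pole half_pole, of w w y x]
    by (simp add: form_add_left[OF adm] form_add_right[OF adm] form_scale_left[OF adm] form_scale_right[OF adm] kern_def)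
  then have "kernel_dist kern (w, x) (w, y) = Re (form ?f (x - y) (x - y))" by (simp add: kernel_dist_def scaleC_minus_one)
  also have "\<dots> \<le> cmod (form ?f (x - y) (x - y))" by (rule complex_Re_le_cmod)
  also have "\<dots> \<le> pole_const w * (norm (x - y))\<^sup>2"
    by (rule form_le[OF adm]) (use pole_le[of w] in \<open>simp add: norm_mult power2_eq_square\<close>)
  finally show ?thesis .
qed

lemma form_zero: "form (\<lambda>t. 0) x y = 0"
  by (simp add: form_def Riemann_sum_def)

lemma kern_separable:
  "\<exists>D :: nat \<Rightarrow> complex \<times> 'n. \<forall>p. \<forall>e>0. \<exists>n. kernel_dist kern p (D n) < e"
proof -
  obtain E :: "'n set" where E: "countable E" "UNIV \<subseteq> closure E" using separable by (auto simp: separable_set_def)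
  obtain Q0 :: "complex set" where Q0: "countable Q0" "\<And>X. open X \<Longrightarrow> X \<noteq> {} \<Longrightarrow> \<exists>d\<in>Q0. d \<in> X"
    using countable_dense_exists by blast
  \<comment> \<open>0 is added to serve all real z, for which the kernel entries vanish.\<close>
  define Q where "Q = insert 0 Q0"
  have Ea: "\<exists>y\<in>E. norm (x - y) < e" if "e > 0" for x e
    using E(2) that closure_approachable[of x E] by (auto simp: dist_norm norm_minus_commute)
  have Qa: "\<exists>w\<in>Q. cmod (z - w) < e" if "e > 0" for z e
    using Q0(2)[of "ball z e"] that by (auto simp: Q_def dist_norm)
  have "E \<noteq> {}" using Ea[of 1 0] by auto
  then have ne: "Q \<times> E \<noteq> {}" by (auto simp: Q_def)
  have cQE: "countable (Q \<times> E)" using E(1) Q0(1) by (simp add: Q_def)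
  have "\<exists>d\<in>Q \<times> E. kernel_dist kern p d < e" if e: "e > 0" for p e
  proof -
    obtain z x where p: "p = (z, x)" by (cases p)
    show ?thesis
    proof (cases "Im z = 0")
      case True
      obtain y where y: "y \<in> E" using \<open>E \<noteq> {}\<close> by blast
      have "kernel_dist kern p (0, y) = 0"
        using True by (simp add: kernel_dist_def kern_def p pole_def form_zero)
      then show ?thesis using e y by (intro bexI[of _ "(0, y)"]) (auto simp: Q_def)
    next
      case False
      define c where "c = 4 / (Im z)\<^sup>2 * pole_const z * (norm x)\<^sup>2 + 1"
      have c: "c > 0" unfolding c_def using pole_const_nonneg[of z] by (intro add_nonneg_pos mult_nonneg_nonneg) auto
      \<comment> \<open>The first bound keeps |Im w| >= |Im z|/2 and makes the estimate uniform in
        w; the second makes this distance at most e/4. The triangle inequality doubles both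
        distances, so e/4 is allotted to each.\<close>
      define r where "r = min (\<bar>Im z\<bar> / 2) (sqrt (e / (4 * c)))"
      have r: "r > 0" using False e c by (simp add: r_def)
      obtain w where w: "w \<in> Q" "cmod (z - w) < r" using Qa[OF r] by blast
      have "\<bar>Im z - Im w\<bar> < \<bar>Im z\<bar> / 2"
        using abs_Im_le_cmod[of "z - w"] w(2) by (simp add: r_def)
      then have wz: "\<bar>Im z\<bar> / 2 \<le> \<bar>Im w\<bar>" by linarith
      then have Imw: "Im w \<noteq> 0" using False by auto
      have "(\<bar>Im z\<bar> / 2)\<^sup>2 \<le> \<bar>Im w\<bar>\<^sup>2" by (rule power_mono[OF wz]) simp
      then have "(Im z)\<^sup>2 \<le> 4 * (Im w)\<^sup>2" by (simp add: power_divide)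
      then have w4: "1 / (Im w)\<^sup>2 \<le> 4 / (Im z)\<^sup>2" using Imw False by (simp add: divide_simps)
      have "(cmod (z - w))\<^sup>2 \<le> (sqrt (e / (4 * c)))\<^sup>2" using w(2) by (intro power_mono) (auto simp: r_def)
      then have zw: "(cmod (z - w))\<^sup>2 \<le> e / (4 * c)" using e c by simp
      have "kernel_dist kern p (w, x) \<le> (cmod (z - w))\<^sup>2 * (1 / (Im w)\<^sup>2 * pole_const z * (norm x)\<^sup>2)"
        using kern_dist_pole[OF False Imw, of x] by (simp add: p mult_ac)
      also have "\<dots> \<le> (cmod (z - w))\<^sup>2 * (4 / (Im z)\<^sup>2 * pole_const z * (norm x)\<^sup>2)"
        by (intro mult_left_mono mult_right_mono w4) (auto simp: pole_const_nonneg)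
      also have "\<dots> \<le> (cmod (z - w))\<^sup>2 * c" by (intro mult_left_mono) (auto simp: c_def)
      also have "\<dots> \<le> e / (4 * c) * c" using zw c by (intro mult_right_mono) auto
      also have "\<dots> = e / 4" using c by simp
      finally have d1: "kernel_dist kern p (w, x) \<le> e / 4" .
      define s where "s = sqrt (e / (4 * (pole_const w + 1)))"
      have s: "s > 0" using e pole_const_nonneg[of w] by (simp add: s_def)
      obtain y where y: "y \<in> E" "norm (x - y) < s" using Ea[OF s] by blast
      have "(norm (x - y))\<^sup>2 < s\<^sup>2" using y(2) s by (intro power_strict_mono) auto
      then have "(norm (x - y))\<^sup>2 < e / (4 * (pole_const w + 1))" using e pole_const_nonneg[of w] by (simp add: s_def)
      then have "(pole_const w + 1) * (norm (x - y))\<^sup>2 < e / 4"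
        using pole_const_nonneg[of w] by (simp add: field_simps)
      moreover have "kernel_dist kern (w, x) (w, y) \<le> (pole_const w + 1) * (norm (x - y))\<^sup>2"
        using kern_dist_vector[of w x y] by (simp add: distrib_right) (smt (verit) zero_le_power2)
      ultimately have d2: "kernel_dist kern (w, x) (w, y) < e / 4" by simp
      have "kernel_dist kern p (w, y) < e"
        using kernel_dist_triangle[OF kern_psd, of p "(w, y)" "(w, x)"] d1 d2 by linarith
      then show ?thesis using w(1) y(1) by blast
    qed
  qed
  then have "\<exists>n. kernel_dist kern p (from_nat_into (Q \<times> E) n) < e" if "e > 0" for p e
    using that from_nat_into_surj[OF cQE] by metis
  then show ?thesis by blast
qed

lemma feature_exists: "\<exists>\<gamma> :: complex \<times> 'n \<Rightarrow> ell2. \<forall>p q. cinner (\<gamma> p) (\<gamma> q) = kern p q"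
proof -
  obtain D :: "nat \<Rightarrow> complex \<times> 'n" where D: "\<forall>p. \<forall>e>0. \<exists>n. kernel_dist kern p (D n) < e" using kern_separable by blast
  show ?thesis
  proof (rule separable_feature_map[OF kern_psd])
    show "\<exists>n. kernel_dist kern p (D n) < e" if "e > 0" for p e using D that by blast
    fix \<phi> :: "complex \<times> 'n \<Rightarrow> ell2" assume "\<And>p q. cinner (\<phi> p) (\<phi> q) = kern p q"
    then show ?thesis by blast
  qed
qed

text \<open>The map is chosen before it is applied to (z, x), so all vectors come from one feature
  map.\<close>

definition \<gamma> :: "complex \<Rightarrow> 'n \<Rightarrow> ell2" where
  "\<gamma> z x = (SOME g. \<forall>p q. cinner (g p) (g q) = kern p q) (z, x)"

lemma cinner_\<gamma>: "cinner (\<gamma> z x) (\<gamma> w y) = form (\<lambda>t. cnj (pole z t) * pole w t) x y"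
  using someI_ex[OF feature_exists] by (simp add: \<gamma>_def kern_def)

lemma \<gamma>_real: "Im z = 0 \<Longrightarrow> \<gamma> z x = 0"
  using cinner_\<gamma>[of z x z x] by (simp add: pole_def form_zero)

lemma pole_admissible: "admissible (\<lambda>t. cnj (pole z t) * pole w t)"
  by (intro half_mult half_pole)

text \<open>The defect has norm 0 by its Gram entries, so linearity of \<gamma> is inherited from
  \<open>form\<close>.\<close>

lemma \<gamma>_scale: "\<gamma> z (c *\<^sub>C x) = c *\<^sub>C \<gamma> z x"
proof -
  note a = pole_admissible[of z z]
  have "cinner (\<gamma> z (c *\<^sub>C x) - c *\<^sub>C \<gamma> z x) (\<gamma> z (c *\<^sub>C x) - c *\<^sub>C \<gamma> z x) = 0"
    by (simp only: cinner.diff_left cinner.diff_right cinner_scaleC_left cinner_scaleC_right cinner_\<gamma>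
        form_scale_left[OF a] form_scale_right[OF a]) simp
  then show ?thesis by simp
qed

lemma \<gamma>_scaleR: "\<gamma> z (r *\<^sub>R x) = r *\<^sub>R \<gamma> z x"
  using \<gamma>_scale[of z "of_real r" x] by (simp only: scaleC_of_real)

lemma \<gamma>_add: "\<gamma> z (x + y) = \<gamma> z x + \<gamma> z y"
proof -
  note a = pole_admissible[of z z]
  have "cinner (\<gamma> z (x + y) - (\<gamma> z x + \<gamma> z y)) (\<gamma> z (x + y) - (\<gamma> z x + \<gamma> z y)) = 0"
    by (simp only: cinner.diff_left cinner.diff_right cinner_add_left cinner_add_right cinner_\<gamma>
        form_add_left[OF a] form_add_right[OF a]) simp
  then show ?thesis by simp
qed

section \<open>The graph of multiplication by the variable\<close>

definition space_S :: "ell2 set" where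
  "space_S = closure (span (range (\<lambda>p. \<gamma> (fst p) (snd p))))"

text \<open>A single pole times t need not be square integrable. In a difference of poles the
  constants cancel: t (1/(t - z) - 1/(t - w)) = z/(t - z) - w/(t - w).\<close>

definition gens :: "ell2 rel" where
  "gens = {(\<gamma> z x - \<gamma> w x, z *\<^sub>C \<gamma> z x - w *\<^sub>C \<gamma> w x) | z w x. Im z \<noteq> 0 \<and> Im w \<noteq> 0}"

definition mult_op :: "ell2 rel" where
  "mult_op = closure (span gens)"

lemma closure_span_induct:
  assumes "G \<subseteq> X" "subspace X" "closed X" "x \<in> closure (span G)"
  shows "x \<in> X"
  using closure_minimal[OF span_minimal[OF assms(1,2)] assms(3)] assms(4) by blast

text \<open>\<open>span\<close> is the real span, so complex multiples have to be supplied by the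
  generating set.\<close>

lemma csubspace_span:
  assumes "\<And>c x. x \<in> G \<Longrightarrow> c *\<^sub>C x \<in> G"
  shows "csubspace (span G)"
  unfolding csubspace_def
proof (intro conjI allI ballI)
  show "c *\<^sub>C x \<in> span G" if "x \<in> span G" for c x
  proof -
    have "span G \<subseteq> {x. c *\<^sub>C x \<in> span G}"
      by (rule span_minimal)
        (auto simp: subspace_def scaleC.zero_right scaleC_add_right scaleC.scaleR_right span_zero
          intro: span_add span_scale span_base assms)
    then show ?thesis using that by blast
  qed
qed (auto intro: span_add span_zero)

lemma csubspace_S: "csubspace space_S"
  unfolding space_S_def
proof (intro csubspace_closure csubspace_span)
  fix c v assume "v \<in> range (\<lambda>p. \<gamma> (fst p) (snd p))"
  then obtain p where "v = \<gamma> (fst p) (snd p)" by blast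
  then show "c *\<^sub>C v \<in> range (\<lambda>p. \<gamma> (fst p) (snd p))"
    by (intro range_eqI[of _ _ "(fst p, c *\<^sub>C snd p)"]) (simp add: \<gamma>_scale)
qed

lemma closed_S: "closed space_S"
  by (simp add: space_S_def)

lemma hilbert_S: "hilbert_subspace space_S"
  by (simp add: hilbert_subspace_def csubspace_S closed_S)

lemma separable_S: "separable_set space_S"
  by (rule separable_subset[OF separable_ell2]) simp

lemma \<gamma>_in_S: "\<gamma> z x \<in> space_S"
proof -
  have "\<gamma> z x \<in> range (\<lambda>p. \<gamma> (fst p) (snd p))" by (rule range_eqI[of _ _ "(z, x)"]) simp
  then show ?thesis unfolding space_S_def by (rule closure_subset[THEN subsetD, OF span_base])
qed

lemma S_orth_zero:
  assumes d: "d \<in> space_S" and orth: "\<And>z x. cinner d (\<gamma> z x) = 0"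
  shows "d = 0"
proof -
  have "d \<in> {y. cinner d y = 0}"
  proof (rule closure_span_induct[OF _ _ _ d[unfolded space_S_def]])
    show "closed {y. cinner d y = 0}" by (intro closed_Collect_eq cinner.continuous_on continuous_intros)
  qed (use orth in \<open>auto simp: subspace_def cinner.zero_right cinner_add_right cinner_scaleR_right\<close>)
  then show ?thesis by simp
qed

lemma mult_op_closed: "closed mult_op"
  by (simp add: mult_op_def)

lemma mult_op_subspace: "subspace mult_op"
  unfolding mult_op_def subspace_def
proof (intro conjI allI ballI)
    show "0 \<in> closure (span gens)" by (rule closure_subset[THEN subsetD, OF span_zero])
    fix x y and r :: real assume x: "x \<in> closure (span gens)"
    then obtain f where f: "\<forall>n. f n \<in> span gens" "f \<longlonglongrightarrow> x" unfolding closure_sequential by blast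
    then have "\<forall>n. r *\<^sub>R f n \<in> span gens" "(\<lambda>n. r *\<^sub>R f n) \<longlonglongrightarrow> r *\<^sub>R x"
      by (auto intro: span_scale tendsto_intros)
    then show "r *\<^sub>R x \<in> closure (span gens)" unfolding closure_sequential by (intro exI conjI)
    assume "y \<in> closure (span gens)"
    then obtain g where "\<forall>n. g n \<in> span gens" "g \<longlonglongrightarrow> y" unfolding closure_sequential by blast
    with f have "\<forall>n. f n + g n \<in> span gens" "(\<lambda>n. f n + g n) \<longlonglongrightarrow> x + y"
      by (auto intro: span_add tendsto_intros)
    then show "x + y \<in> closure (span gens)" unfolding closure_sequential by (intro exI conjI)
qed

lemma gens_in: "Im z \<noteq> 0 \<Longrightarrow> Im w \<noteq> 0 \<Longrightarrow> (\<gamma> z x - \<gamma> w x, z *\<^sub>C \<gamma> z x - w *\<^sub>C \<gamma> w x) \<in> gens"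
  unfolding gens_def by blast

lemma gens_mult_op: "p \<in> gens \<Longrightarrow> p \<in> mult_op"
  unfolding mult_op_def by (rule closure_subset[THEN subsetD, OF span_base])

lemma mult_op_induct:
  assumes "(f, g) \<in> mult_op" "closed X" "subspace X"
    "\<And>z w x. Im z \<noteq> 0 \<Longrightarrow> Im w \<noteq> 0 \<Longrightarrow> (\<gamma> z x - \<gamma> w x, z *\<^sub>C \<gamma> z x - w *\<^sub>C \<gamma> w x) \<in> X"
  shows "(f, g) \<in> X"
  using closure_span_induct[of gens X "(f, g)"] assms unfolding mult_op_def gens_def by blast

lemma mult_op_S:
  assumes "(f, g) \<in> mult_op" shows "f \<in> space_S" "g \<in> space_S"
proof -
  have "(f, g) \<in> space_S \<times> space_S"
  proof (rule mult_op_induct[OF assms])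
    show "closed (space_S \<times> space_S)" by (intro closed_Times closed_S)
    show "subspace (space_S \<times> space_S)"
      using csubspace_imp_subspace[OF csubspace_S] by (rule subspace_Times[OF _ csubspace_imp_subspace[OF csubspace_S]])
    show "(\<gamma> z x - \<gamma> w x, z *\<^sub>C \<gamma> z x - w *\<^sub>C \<gamma> w x) \<in> space_S \<times> space_S" for z w x
      using csubspace_diff[OF csubspace_S] csubspace_scale[OF csubspace_S] \<gamma>_in_S by auto
  qed
  then show "f \<in> space_S" "g \<in> space_S" by auto
qed

lemma mult_op_scale:
  assumes "(f, g) \<in> mult_op" shows "(c *\<^sub>C f, c *\<^sub>C g) \<in> mult_op"
proof -
  have "(f, g) \<in> (\<lambda>p. (c *\<^sub>C fst p, c *\<^sub>C snd p)) -` mult_op"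
  proof (rule mult_op_induct[OF assms])
    show "closed ((\<lambda>p. (c *\<^sub>C fst p, c *\<^sub>C snd p)) -` mult_op)"
      by (rule closed_vimage[OF mult_op_closed]) (intro scaleC.continuous_on continuous_intros)
    have "(c *\<^sub>C 0, c *\<^sub>C 0) = (0 :: ell2 \<times> ell2)" by (simp add: scaleC.zero_right zero_prod_def)
    moreover have "(c *\<^sub>C fst (p + q), c *\<^sub>C snd (p + q)) = (c *\<^sub>C fst p, c *\<^sub>C snd p) + (c *\<^sub>C fst q, c *\<^sub>C snd q)"
      "(c *\<^sub>C fst (r *\<^sub>R p), c *\<^sub>C snd (r *\<^sub>R p)) = r *\<^sub>R (c *\<^sub>C fst p, c *\<^sub>C snd p)" for p q :: "ell2 \<times> ell2" and r
      by (simp_all add: scaleC_add_right scaleC.scaleR_right)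
    ultimately show "subspace ((\<lambda>p. (c *\<^sub>C fst p, c *\<^sub>C snd p)) -` mult_op)"
      using mult_op_subspace unfolding subspace_def vimage_def by (simp only: mem_Collect_eq fst_zero snd_zero) blast
    fix z w x assume z: "Im z \<noteq> 0" "Im w \<noteq> 0"
    have "c *\<^sub>C (\<gamma> z x - \<gamma> w x) = \<gamma> z (c *\<^sub>C x) - \<gamma> w (c *\<^sub>C x)"
      "c *\<^sub>C (z *\<^sub>C \<gamma> z x - w *\<^sub>C \<gamma> w x) = z *\<^sub>C \<gamma> z (c *\<^sub>C x) - w *\<^sub>C \<gamma> w (c *\<^sub>C x)"
      by (simp_all add: scaleC.diff_right \<gamma>_scale scaleC_scaleC mult.commute)
    then show "(\<gamma> z x - \<gamma> w x, z *\<^sub>C \<gamma> z x - w *\<^sub>C \<gamma> w x) \<in> (\<lambda>p. (c *\<^sub>C fst p, c *\<^sub>C snd p)) -` mult_op"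
      using gens_mult_op[OF gens_in[OF z, of "c *\<^sub>C x"]] by simp
  qed
  then show ?thesis by simp
qed

text \<open>z/(t - z) = t/(t - z) - 1, and the constant cancels in the difference. The resulting
  integrand is symmetric in the two generators up to conjugation.\<close>

lemma gens_cinner:
  assumes z: "Im z \<noteq> 0" "Im w \<noteq> 0" and z': "Im z' \<noteq> 0" "Im w' \<noteq> 0"
  shows "cinner (\<gamma> z x - \<gamma> w x) (z' *\<^sub>C \<gamma> z' y - w' *\<^sub>C \<gamma> w' y)
      = form (\<lambda>t. of_real t * cnj (pole z t - pole w t) * (pole z' t - pole w' t)) x y"
    and "admissible (\<lambda>t. of_real t * cnj (pole z t - pole w t) * (pole z' t - pole w' t))"
proof -
  have eq: "(\<lambda>t. of_real t * cnj (pole z t - pole w t) * (pole z' t - pole w' t))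
      = (\<lambda>t. cnj (pole z t - pole w t) * (z' * pole z' t - w' * pole w' t))"
  proof
    fix t
    have "z' * pole z' t = of_real t * pole z' t - 1" "w' * pole w' t = of_real t * pole w' t - 1"
      using z' of_real_diff_nz[of z' t] of_real_diff_nz[of w' t] by (simp_all add: pole_def field_simps)
    then have "z' * pole z' t - w' * pole w' t = of_real t * (pole z' t - pole w' t)"
      by (simp only:) (simp add: algebra_simps)
    then show "of_real t * cnj (pole z t - pole w t) * (pole z' t - pole w' t)
      = cnj (pole z t - pole w t) * (z' * pole z' t - w' * pole w' t)" by (simp only: mult_ac)
  qed
  show "admissible (\<lambda>t. of_real t * cnj (pole z t - pole w t) * (pole z' t - pole w' t))"
    unfolding eq by (intro half_mult half_diff half_scale half_pole)
  have s: "form (\<lambda>t. cnj (pole a t) * (c * pole b t)) x y = c * cinner (\<gamma> a x) (\<gamma> b y)" for a b c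
    using form_fun_scale[OF pole_admissible, of c a b x y] by (simp add: cinner_\<gamma> mult.left_commute)
  show "cinner (\<gamma> z x - \<gamma> w x) (z' *\<^sub>C \<gamma> z' y - w' *\<^sub>C \<gamma> w' y)
      = form (\<lambda>t. of_real t * cnj (pole z t - pole w t) * (pole z' t - pole w' t)) x y"
    unfolding eq form_half_diff[OF half_pole half_pole half_scale[OF half_pole] half_scale[OF half_pole]] s
    by (simp add: cinner.diff_left cinner.diff_right cinner_scaleC_right algebra_simps)
qed

lemma gens_symmetric:
  assumes "(f, g) \<in> gens" "(u, v) \<in> gens" shows "cinner f v = cinner g u"
proof -
  obtain z w x where 1: "Im z \<noteq> 0" "Im w \<noteq> 0" "f = \<gamma> z x - \<gamma> w x" "g = z *\<^sub>C \<gamma> z x - w *\<^sub>C \<gamma> w x"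
    using assms(1) unfolding gens_def by blast
  obtain z' w' y where 2: "Im z' \<noteq> 0" "Im w' \<noteq> 0" "u = \<gamma> z' y - \<gamma> w' y" "v = z' *\<^sub>C \<gamma> z' y - w' *\<^sub>C \<gamma> w' y"
    using assms(2) unfolding gens_def by blast
  have "cinner g u = cnj (cinner u g)" by (rule cinner_commute)
  also have "\<dots> = cnj (form (\<lambda>t. of_real t * cnj (pole z' t - pole w' t) * (pole z t - pole w t)) y x)"
    unfolding 1(4) 2(3) by (simp only: gens_cinner(1)[OF 2(1,2) 1(1,2)])
  also have "\<dots> = form (\<lambda>t. cnj (of_real t * cnj (pole z' t - pole w' t) * (pole z t - pole w t))) x y"
    by (rule form_cnj[OF gens_cinner(2)[OF 2(1,2) 1(1,2)], symmetric])
  also have "(\<lambda>t. cnj (of_real t * cnj (pole z' t - pole w' t) * (pole z t - pole w t)))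
      = (\<lambda>t. of_real t * cnj (pole z t - pole w t) * (pole z' t - pole w' t))"
    by (simp add: mult_ac)
  also have "form \<dots> x y = cinner f v" unfolding 1(3) 2(4) by (rule gens_cinner(1)[OF 1(1,2) 2(1,2), symmetric])
  finally show ?thesis by simp
qed

lemma mult_op_symmetric:
  assumes fg: "(f, g) \<in> mult_op" and uv: "(u, v) \<in> mult_op" shows "cinner f v = cinner g u"
proof -
  have X: "closed {p. cinner (fst p) b = cinner (snd p) a} \<and> subspace {p. cinner (fst p) b = cinner (snd p) a}"
    for a b :: ell2
    by (auto simp: subspace_def cinner.zero_left cinner_add_left cinner_scaleR_left
        intro!: closed_Collect_eq cinner.continuous_on continuous_intros)
  have Y: "closed {p. cinner a (snd p) = cinner b (fst p)} \<and> subspace {p. cinner a (snd p) = cinner b (fst p)}"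
    for a b :: ell2
    by (auto simp: subspace_def cinner.zero_right cinner_add_right cinner_scaleR_right
        intro!: closed_Collect_eq cinner.continuous_on continuous_intros)
  have 1: "cinner f v' = cinner g u'" if "(u', v') \<in> gens" for u' v'
  proof -
    have "(f, g) \<in> {p. cinner (fst p) v' = cinner (snd p) u'}"
      by (rule mult_op_induct[OF fg]) (use X gens_symmetric[OF gens_in that] in auto)
    then show ?thesis by simp
  qed
  have "(u, v) \<in> {p. cinner f (snd p) = cinner g (fst p)}"
    by (rule mult_op_induct[OF uv]) (use Y 1[OF gens_in] in auto)
  then show ?thesis by simp
qed

lemma norm_\<gamma>_sq: "(norm (\<gamma> z x))\<^sup>2 = Re (\<integral>t. cnj (pole z t) * pole z t \<partial>\<mu> x)"
  using cinner_\<gamma>[of z x z x] form_diagonal[OF pole_admissible] by (metis Re_cinner_self)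

text \<open>The integrands 1/(t^2 + (n + 1)^2) tend to 0 below the integrable weight. This is the
  limit along the imaginary axis that makes the operator single-valued.\<close>

lemma \<gamma>_tendsto_zero: "(\<lambda>n. \<gamma> (\<i> * of_nat (Suc n)) x) \<longlonglongrightarrow> 0"
proof -
  let ?p = "\<lambda>n t. cnj (pole (\<i> * of_nat (Suc n)) t) * pole (\<i> * of_nat (Suc n)) t"
  have val: "?p n t = of_real (1 / (t\<^sup>2 + (real (Suc n))\<^sup>2))" for n t
  proof -
    have "?p n t = of_real ((cmod (pole (\<i> * of_nat (Suc n)) t))\<^sup>2)" by (simp add: complex_norm_square mult.commute del: of_real_power)
    also have "(cmod (pole (\<i> * of_nat (Suc n)) t))\<^sup>2 = 1 / (t\<^sup>2 + (real (Suc n))\<^sup>2)"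
      by (simp add: pole_def norm_divide power_divide cmod_power2 del: of_nat_Suc)
    finally show ?thesis .
  qed
  have "(\<lambda>n. \<integral>t. ?p n t \<partial>\<mu> x) \<longlonglongrightarrow> (\<integral>t. 0 \<partial>\<mu> x)"
  proof (rule integral_dominated_convergence)
    show "?p n \<in> borel_measurable (\<mu> x)" for n
      using admissible_integrable[OF pole_admissible] by (rule borel_measurable_integrable)
    show "integrable (\<mu> x) (\<lambda>t. 1 / (1 + t\<^sup>2))" by (rule integrable_weight)
    show "AE t in \<mu> x. norm (?p n t) \<le> 1 / (1 + t\<^sup>2)" for n
    proof (rule AE_I2)
      fix t :: real
      have "1 \<le> (real (Suc n))\<^sup>2" by (rule one_le_power) simp
      then have "1 / (t\<^sup>2 + (real (Suc n))\<^sup>2) \<le> 1 / (1 + t\<^sup>2)"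
        by (intro divide_left_mono) (auto simp: add_pos_nonneg add_nonneg_pos intro!: mult_pos_pos)
      then show "norm (?p n t) \<le> 1 / (1 + t\<^sup>2)"
        unfolding val norm_of_real by (simp add: add_nonneg_nonneg)
    qed
    show "AE t in \<mu> x. (\<lambda>n. ?p n t) \<longlonglongrightarrow> 0"
    proof (rule AE_I2)
      fix t :: real
      have "(\<lambda>n. 1 / (t\<^sup>2 + (real (Suc n))\<^sup>2)) \<longlonglongrightarrow> 0"
      proof (rule tendsto_sandwich[OF _ _ tendsto_const])
        show "(\<lambda>n. inverse (real (Suc n))) \<longlonglongrightarrow> 0" by (rule LIMSEQ_inverse_real_of_nat)
        have "1 / (t\<^sup>2 + (real (Suc n))\<^sup>2) \<le> inverse (real (Suc n))" for n
        proof -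
          have "real (Suc n) * 1 \<le> real (Suc n) * real (Suc n)" by (intro mult_left_mono) simp_all
          then have "real (Suc n) \<le> t\<^sup>2 + (real (Suc n))\<^sup>2"
            unfolding power2_eq_square[of "real (Suc n)"] by (intro add_increasing) simp_all
          then show ?thesis by (simp add: inverse_eq_divide frac_le del: of_nat_Suc)
        qed
        then show "\<forall>\<^sub>F n in sequentially. 1 / (t\<^sup>2 + (real (Suc n))\<^sup>2) \<le> inverse (real (Suc n))" by simp
      qed (simp add: add_nonneg_nonneg)
      then have "(\<lambda>n. complex_of_real (1 / (t\<^sup>2 + (real (Suc n))\<^sup>2))) \<longlonglongrightarrow> complex_of_real 0"
        by (rule tendsto_of_real)
      then show "(\<lambda>n. ?p n t) \<longlonglongrightarrow> 0" unfolding val by simp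
    qed
  qed simp
  then have "(\<lambda>n. Re (\<integral>t. ?p n t \<partial>\<mu> x)) \<longlonglongrightarrow> Re (\<integral>t. 0 \<partial>\<mu> x)" by (rule tendsto_Re)
  then have "(\<lambda>n. (norm (\<gamma> (\<i> * of_nat (Suc n)) x))\<^sup>2) \<longlonglongrightarrow> 0" by (simp add: norm_\<gamma>_sq)
  then show ?thesis by (simp add: tendsto_norm_zero_iff)
qed

text \<open>By symmetry against the generators, (g, \<gamma> z x) is the same number for all nonreal
  z; moving z up the imaginary axis shows that it is 0.\<close>

lemma mult_op_single_valued:
  assumes "(0, g) \<in> mult_op" shows "g = 0"
proof (rule S_orth_zero)
  show "g \<in> space_S" using mult_op_S[OF assms] by simp
  have diff: "cinner g (\<gamma> z x) = cinner g (\<gamma> w x)" if "Im z \<noteq> 0" "Im w \<noteq> 0" for z w x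
    using mult_op_symmetric[OF assms gens_mult_op[OF gens_in[OF that, of x]]]
    by (simp add: cinner.zero_left cinner.diff_right)
  fix z x
  show "cinner g (\<gamma> z x) = 0"
  proof (cases "Im z = 0")
    case True
    then show ?thesis by (simp add: \<gamma>_real cinner.zero_right)
  next
    case False
    have "(\<lambda>n. cinner g (\<gamma> (\<i> * of_nat (Suc n)) x)) \<longlonglongrightarrow> cinner g 0"
      by (intro tendsto_cinner tendsto_const \<gamma>_tendsto_zero)
    moreover have "cinner g (\<gamma> (\<i> * of_nat (Suc n)) x) = cinner g (\<gamma> z x)" for n
      by (rule diff) (use False in simp_all)
    ultimately show ?thesis by (simp add: cinner.zero_right LIMSEQ_const_iff)
  qed
qed

lemma mult_op_operator: "operator_in space_S mult_op"
  unfolding operator_in_def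
proof (intro conjI allI impI)
  show "mult_op \<subseteq> space_S \<times> space_S" using mult_op_S by auto
  show "(0, 0) \<in> mult_op" using subspace_0[OF mult_op_subspace] by (simp add: zero_prod_def)
  show add: "(f + u, g + v) \<in> mult_op" if "(f, g) \<in> mult_op" "(u, v) \<in> mult_op" for f g u v
    using subspace_add[OF mult_op_subspace that] by simp
  show "(c *\<^sub>C f, c *\<^sub>C g) \<in> mult_op" if "(f, g) \<in> mult_op" for c f g using mult_op_scale[OF that] .
  show "single_valued mult_op"
  proof (rule single_valuedI)
    fix f g h assume "(f, g) \<in> mult_op" "(f, h) \<in> mult_op"
    from subspace_diff[OF mult_op_subspace this] have "(0, g - h) \<in> mult_op" by simp
    from mult_op_single_valued[OF this] show "g = h" by simp
  qed
qed

lemma \<gamma>_continuous: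
  assumes z: "Im z \<noteq> 0"
  shows "(\<lambda>n. \<gamma> (z + of_real (inverse (real (Suc n)))) x) \<longlonglongrightarrow> \<gamma> z x"
proof -
  let ?w = "\<lambda>n. z + of_real (inverse (real (Suc n)))"
  have "(\<lambda>n. (norm (\<gamma> z x - \<gamma> (?w n) x))\<^sup>2) \<longlonglongrightarrow> 0"
  proof (rule tendsto_sandwich[OF _ _ tendsto_const])
    have "(\<lambda>n. (inverse (real (Suc n)))\<^sup>2 / (Im z)\<^sup>2 * pole_const z * (norm x)\<^sup>2) \<longlonglongrightarrow> 0\<^sup>2 / (Im z)\<^sup>2 * pole_const z * (norm x)\<^sup>2"
      by (intro tendsto_intros LIMSEQ_inverse_real_of_nat) (use z in simp)
    then show "(\<lambda>n. (inverse (real (Suc n)))\<^sup>2 / (Im z)\<^sup>2 * pole_const z * (norm x)\<^sup>2) \<longlonglongrightarrow> 0" by simp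
    have "(norm (\<gamma> z x - \<gamma> (?w n) x))\<^sup>2 \<le> (inverse (real (Suc n)))\<^sup>2 / (Im z)\<^sup>2 * pole_const z * (norm x)\<^sup>2" for n
    proof -
      have "(norm (\<gamma> z x - \<gamma> (?w n) x))\<^sup>2 = kernel_dist kern (z, x) (?w n, x)"
        by (rule kernel_dist_norm) (simp_all only: cinner_\<gamma> kern_def fst_conv snd_conv)
      also have "\<dots> \<le> (cmod (z - ?w n))\<^sup>2 / (Im (?w n))\<^sup>2 * pole_const z * (norm x)\<^sup>2"
        by (rule kern_dist_pole) (use z in simp_all)
      also have "cmod (z - ?w n) = inverse (real (Suc n))"
        by (simp add: norm_minus_cancel norm_inverse del: of_nat_Suc of_real_inverse)
      finally show ?thesis by simp
    qed
    then show "\<forall>\<^sub>F n in sequentially. (norm (\<gamma> z x - \<gamma> (?w n) x))\<^sup>2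
        \<le> (inverse (real (Suc n)))\<^sup>2 / (Im z)\<^sup>2 * pole_const z * (norm x)\<^sup>2" by simp
  qed simp
  then have "(\<lambda>n. \<gamma> z x - \<gamma> (?w n) x) \<longlonglongrightarrow> 0" by (simp add: tendsto_norm_zero_iff)
  from tendsto_diff[OF tendsto_const[of "\<gamma> z x"] this] show ?thesis by simp
qed

text \<open>For nonreal z other than \<zeta>, a generator puts (z - \<zeta>) \<gamma> z x into the
  range in question; the point \<zeta> itself is reached by continuity of \<gamma>.\<close>

lemma mult_op_range_dense:
  assumes \<zeta>: "Im \<zeta> \<noteq> 0" and d: "d \<in> space_S" and orth: "\<And>f g. (f, g) \<in> mult_op \<Longrightarrow> cinner d (g - \<zeta> *\<^sub>C f) = 0"
  shows "d = 0"
proof (rule S_orth_zero[OF d])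
  have ne: "cinner d (\<gamma> z x) = 0" if z: "Im z \<noteq> 0" "z \<noteq> \<zeta>" for z x
  proof -
    have "cinner d ((z *\<^sub>C \<gamma> z x - \<zeta> *\<^sub>C \<gamma> \<zeta> x) - \<zeta> *\<^sub>C (\<gamma> z x - \<gamma> \<zeta> x)) = 0"
      by (rule orth[OF gens_mult_op[OF gens_in[OF z(1) \<zeta>]]])
    moreover have "cinner d ((z *\<^sub>C \<gamma> z x - \<zeta> *\<^sub>C \<gamma> \<zeta> x) - \<zeta> *\<^sub>C (\<gamma> z x - \<gamma> \<zeta> x))
        = (z - \<zeta>) * cinner d (\<gamma> z x)"
      by (simp only: cinner.diff_right cinner_scaleC_right) (simp add: algebra_simps)
    ultimately have "(z - \<zeta>) * cinner d (\<gamma> z x) = 0" by simp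
    then show ?thesis using z by simp
  qed
  fix z x
  show "cinner d (\<gamma> z x) = 0"
  proof (cases "Im z = 0")
    case True
    then show ?thesis by (simp add: \<gamma>_real cinner.zero_right)
  next
    case False
    show ?thesis
    proof (cases "z = \<zeta>")
      case True
      have "(\<lambda>n. cinner d (\<gamma> (\<zeta> + of_real (inverse (real (Suc n)))) x)) \<longlonglongrightarrow> cinner d (\<gamma> \<zeta> x)"
        by (intro tendsto_cinner tendsto_const \<gamma>_continuous[OF \<zeta>])
      moreover have "cinner d (\<gamma> (\<zeta> + of_real (inverse (real (Suc n)))) x) = 0" for n
      proof (rule ne)
        show "\<zeta> + of_real (inverse (real (Suc n))) \<noteq> \<zeta>" by (simp del: of_nat_Suc of_real_inverse)
      qed (use \<zeta> in simp)
      ultimately show ?thesis using True by (simp add: LIMSEQ_const_iff)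
    qed (use ne False in blast)
  qed
qed

lemma mult_op_self_adjoint: "self_adjoint space_S mult_op"
proof (rule self_adjointI[OF mult_op_operator hilbert_S mult_op_closed mult_op_symmetric])
  fix z d assume "z \<in> {\<i>, - \<i>}" "d \<in> space_S" "\<And>f g. (f, g) \<in> mult_op \<Longrightarrow> cinner d (g - z *\<^sub>C f) = 0"
  then show "d = 0" by (intro mult_op_range_dense[of z d]) auto
qed

text \<open>On the span the form is a double sum of integrals of t times products of pole
  differences, which \<open>form_psd\<close> treats with r t = t. Closedness extends this to the
  graph.\<close>

lemma mult_op_nonneg:
  assumes null: "\<And>x. emeasure (\<mu> x) {..<0} = 0"
  shows "nonneg_op mult_op"
proof -
  have "span gens \<subseteq> {p. cinner (fst p) (snd p) \<in> \<real>\<^sub>\<ge>\<^sub>0}"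
  proof
    fix p assume "p \<in> span gens"
    then obtain T r where T: "finite T" "T \<subseteq> gens" and p: "p = (\<Sum>a\<in>T. r a *\<^sub>R a)"
      unfolding span_explicit by blast
    have "\<forall>a\<in>T. \<exists>z w x. Im z \<noteq> 0 \<and> Im w \<noteq> 0 \<and> a = (\<gamma> z x - \<gamma> w x, z *\<^sub>C \<gamma> z x - w *\<^sub>C \<gamma> w x)"
      using T(2) unfolding gens_def by blast
    then obtain z w x where zwx: "\<And>a. a \<in> T \<Longrightarrow> Im (z a) \<noteq> 0" "\<And>a. a \<in> T \<Longrightarrow> Im (w a) \<noteq> 0"
      "\<And>a. a \<in> T \<Longrightarrow> a = (\<gamma> (z a) (x a) - \<gamma> (w a) (x a), z a *\<^sub>C \<gamma> (z a) (x a) - w a *\<^sub>C \<gamma> (w a) (x a))"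
      by metis
    \<comment> \<open>Real coefficients are absorbed into the vectors, turning a combination of
      generators into a plain sum of generators.\<close>
    define y where "y a = of_real (r a) *\<^sub>C x a" for a
    have ra: "r a *\<^sub>R a = (\<gamma> (z a) (y a) - \<gamma> (w a) (y a), z a *\<^sub>C \<gamma> (z a) (y a) - w a *\<^sub>C \<gamma> (w a) (y a))"
      if "a \<in> T" for a
      by (subst (2) zwx(3)[OF that])
        (simp add: y_def scaleC_of_real \<gamma>_scaleR scaleR_diff_right scaleC.scaleR_right)
    have "cinner (fst p) (snd p) = (\<Sum>a\<in>T. \<Sum>b\<in>T. cinner (fst (r a *\<^sub>R a)) (snd (r b *\<^sub>R b)))"
      unfolding p fst_sum snd_sum cinner.sum_left by (intro sum.cong refl cinner.sum_right)
    also have "\<dots> = (\<Sum>a\<in>T. \<Sum>b\<in>T. form (\<lambda>t. of_real t * cnj (pole (z a) t - pole (w a) t) * (pole (z b) t - pole (w b) t)) (y a) (y b))"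
    proof (intro sum.cong refl)
      fix a b assume a: "a \<in> T" and b: "b \<in> T"
      show "cinner (fst (r a *\<^sub>R a)) (snd (r b *\<^sub>R b))
          = form (\<lambda>t. of_real t * cnj (pole (z a) t - pole (w a) t) * (pole (z b) t - pole (w b) t)) (y a) (y b)"
        unfolding ra[OF a] ra[OF b] fst_conv snd_conv by (rule gens_cinner(1)[OF zwx(1,2)[OF a] zwx(1,2)[OF b]])
    qed
    also have "\<dots> \<in> \<real>\<^sub>\<ge>\<^sub>0"
      by (rule form_psd[OF T(1), of _ "\<lambda>t. t" "\<lambda>a t. pole (z a) t - pole (w a) t"])
        (use gens_cinner(2) zwx(1,2) null in auto)
    finally show "p \<in> {p. cinner (fst p) (snd p) \<in> \<real>\<^sub>\<ge>\<^sub>0}" by simp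
  qed
  moreover have "closed {p :: ell2 \<times> ell2. cinner (fst p) (snd p) \<in> \<real>\<^sub>\<ge>\<^sub>0}"
  proof -
    have "{p :: ell2 \<times> ell2. cinner (fst p) (snd p) \<in> \<real>\<^sub>\<ge>\<^sub>0} = (\<lambda>p. cinner (fst p) (snd p)) -` \<real>\<^sub>\<ge>\<^sub>0" by auto
    moreover have "closed \<dots>"
      by (rule closed_vimage[OF closed_nonneg_Reals_complex]) (intro cinner.continuous_on continuous_intros)
    ultimately show ?thesis by simp
  qed
  ultimately have "mult_op \<subseteq> {p. cinner (fst p) (snd p) \<in> \<real>\<^sub>\<ge>\<^sub>0}"
    unfolding mult_op_def by (rule closure_minimal)
  then show ?thesis unfolding nonneg_op_def by auto
qed

section \<open>The resolvent of the multiplication operator between vectors at the pole i\<close>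

lemma admissible_weight: "admissible (\<lambda>t. complex_of_real (1 / (1 + t\<^sup>2)))"
  unfolding admissible_def
proof (intro conjI exI[of _ 1] allI)
  have "1 + t\<^sup>2 \<noteq> 0" for t :: real using zero_le_power2[of t] by linarith
  then show "continuous_on UNIV (\<lambda>t. complex_of_real (1 / (1 + t\<^sup>2)))"
    by (intro continuous_intros) auto
  show "cmod (complex_of_real (1 / (1 + t\<^sup>2))) \<le> 1 / (1 + t\<^sup>2)" for t :: real
    unfolding norm_of_real by (simp add: add_nonneg_nonneg)
qed

lemma of_real_add_i: "complex_of_real t + \<i> \<noteq> 0" "complex_of_real t - \<i> \<noteq> 0"
  "(complex_of_real t + \<i>) * (complex_of_real t - \<i>) = of_real (1 + t\<^sup>2)"
  by (simp_all add: complex_eq_iff power2_eq_square)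

text \<open>|1/(t - i)|^2 is the weight 1/(1 + t^2), whose total mass is I.\<close>

lemma \<gamma>_i_isometry: "cinner (\<gamma> \<i> x) (\<gamma> \<i> y) = cinner x y"
proof -
  have "(\<lambda>t. cnj (pole \<i> t) * pole \<i> t) = (\<lambda>t. complex_of_real (1 / (1 + t\<^sup>2)))"
    using of_real_add_i by (simp add: pole_def fun_eq_iff flip: of_real_add_i(3))
  then show ?thesis by (simp only: cinner_\<gamma> form_weight[OF admissible_weight])
qed

text \<open>Its integral is (V u, (H - z)^-1 V x) by \<open>resolvent_formula\<close>; the weight is
  the product of the poles at i and -i.\<close>

definition resolvent_fun :: "complex \<Rightarrow> real \<Rightarrow> complex" where
  "resolvent_fun z t = complex_of_real (1 / (1 + t\<^sup>2)) / (of_real t - z)"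

lemma admissible_resolvent:
  assumes z: "Im z \<noteq> 0" shows "admissible (resolvent_fun z)"
  unfolding admissible_def
proof (intro conjI exI[of _ "1 / \<bar>Im z\<bar>"] allI)
  have "1 + t\<^sup>2 \<noteq> 0" for t :: real using zero_le_power2[of t] by linarith
  then show "continuous_on UNIV (resolvent_fun z)"
    unfolding resolvent_fun_def using of_real_diff_nz[OF z] by (intro continuous_intros) auto
  fix t :: real
  have "\<bar>Im z\<bar> \<le> cmod (of_real t - z)" using abs_Im_le_cmod[of "of_real t - z"] by simp
  then have "1 / (1 + t\<^sup>2) / cmod (of_real t - z) \<le> 1 / (1 + t\<^sup>2) / \<bar>Im z\<bar>"
    using z by (intro divide_left_mono) (auto simp: add_nonneg_nonneg intro!: mult_pos_pos)
  then show "cmod (resolvent_fun z t) \<le> 1 / \<bar>Im z\<bar> / (1 + t\<^sup>2)"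
    unfolding resolvent_fun_def norm_divide norm_of_real by (simp add: add_nonneg_nonneg mult.commute)
qed

text \<open>The explicit pair (f', g') solves the equation in the graph, and the lower bound makes
  the solution unique. z = i is excluded by the denominator z - i.\<close>

lemma resolvent_formula:
  assumes z: "Im z \<noteq> 0" "z \<noteq> \<i>" and fg: "(f, g) \<in> mult_op" "g - z *\<^sub>C f = \<gamma> \<i> x"
  shows "cinner (\<gamma> \<i> u) f = form (resolvent_fun z) u x"
proof -
  let ?c = "1 / (z - \<i>)"
  define f' where "f' = ?c *\<^sub>C (\<gamma> z x - \<gamma> \<i> x)"
  define g' where "g' = ?c *\<^sub>C (z *\<^sub>C \<gamma> z x - \<i> *\<^sub>C \<gamma> \<i> x)"
  have "(f', g') \<in> mult_op"
    unfolding f'_def g'_def by (intro mult_op_scale gens_mult_op gens_in) (use z in simp_all)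
  then have "(f - f', g - g') \<in> mult_op" using operator_in_diff[OF mult_op_operator fg(1)] by blast
  from self_adjoint_lower_bound[OF mult_op_self_adjoint this, of z]
  have "\<bar>Im z\<bar> * norm (f - f') \<le> norm ((g - g') - z *\<^sub>C (f - f'))" .
  also have "(g - g') - z *\<^sub>C (f - f') = (g - z *\<^sub>C f) - (g' - z *\<^sub>C f')" by (simp add: scaleC.diff_right)
  also have "g' - z *\<^sub>C f' = ?c *\<^sub>C ((z - \<i>) *\<^sub>C \<gamma> \<i> x)"
  proof -
    have "z *\<^sub>C f' = ?c *\<^sub>C (z *\<^sub>C (\<gamma> z x - \<gamma> \<i> x))" by (simp add: f'_def scaleC_scaleC mult.commute)
    then have "g' - z *\<^sub>C f' = ?c *\<^sub>C ((z *\<^sub>C \<gamma> z x - \<i> *\<^sub>C \<gamma> \<i> x) - z *\<^sub>C (\<gamma> z x - \<gamma> \<i> x))"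
      by (simp only: g'_def scaleC.diff_right)
    also have "(z *\<^sub>C \<gamma> z x - \<i> *\<^sub>C \<gamma> \<i> x) - z *\<^sub>C (\<gamma> z x - \<gamma> \<i> x) = (z - \<i>) *\<^sub>C \<gamma> \<i> x"
      by (simp add: scaleC.diff_right scaleC.diff_left)
    finally show ?thesis .
  qed
  also have "\<dots> = \<gamma> \<i> x" using z by (simp add: scaleC_scaleC)
  finally have "\<bar>Im z\<bar> * norm (f - f') \<le> 0" by (simp add: fg(2))
  then have "f = f'" using z by (simp add: mult_le_0_iff)
  have "cinner (\<gamma> \<i> u) f' = ?c * (form (\<lambda>t. cnj (pole \<i> t) * pole z t) u x - form (\<lambda>t. cnj (pole \<i> t) * pole \<i> t) u x)"
    by (simp only: f'_def cinner_scaleC_right cinner.diff_right cinner_\<gamma>)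
  also have "\<dots> = form (\<lambda>t. ?c * (cnj (pole \<i> t) * pole z t - cnj (pole \<i> t) * pole \<i> t)) u x"
    by (simp only: form_fun_scale[OF admissible_diff[OF pole_admissible pole_admissible]]
        form_fun_diff[OF pole_admissible pole_admissible])
  also have "(\<lambda>t. ?c * (cnj (pole \<i> t) * pole z t - cnj (pole \<i> t) * pole \<i> t)) = resolvent_fun z"
  proof
    fix t
    have nz: "of_real t - z \<noteq> 0" "z - \<i> \<noteq> 0" using of_real_diff_nz z by auto
    have "pole z t - pole \<i> t = (z - \<i>) / ((of_real t - z) * (of_real t - \<i>))"
      using nz of_real_add_i(2)[of t] z by (simp add: pole_def divide_simps)
    then have "?c * (cnj (pole \<i> t) * (pole z t - pole \<i> t))
        = 1 / ((of_real t + \<i>) * (of_real t - \<i>)) / (of_real t - z)"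
      using nz of_real_add_i(1,2)[of t] by (simp add: pole_def)
    then have "?c * (cnj (pole \<i> t) * (pole z t - pole \<i> t)) = resolvent_fun z t"
      unfolding of_real_add_i(3) by (simp add: resolvent_fun_def)
    then show "?c * (cnj (pole \<i> t) * pole z t - cnj (pole \<i> t) * pole \<i> t) = resolvent_fun z t"
      by (simp only: right_diff_distrib)
  qed
  finally show ?thesis using \<open>f = f'\<close> by simp
qed

end

section \<open>Boundary behaviour and the realizations\<close>

text \<open>Otherwise Fatou's lemma would bound the integral of \<psi> by C.\<close>

lemma Fatou_unbounded:
  fixes \<phi> :: "nat \<Rightarrow> 'a \<Rightarrow> real"
  assumes int: "\<And>n. integrable M (\<phi> n)" and nonneg: "\<And>n. AE t in M. 0 \<le> \<phi> n t"
    and le: "AE t in M. \<psi> t \<le> liminf (\<lambda>n. ennreal (\<phi> n t))"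
    and inf: "(\<integral>\<^sup>+t. \<psi> t \<partial>M) = \<infinity>"
  shows "\<exists>n. C < (\<integral>t. \<phi> n t \<partial>M)"
proof (rule ccontr)
  assume "\<not> ?thesis"
  then have C: "(\<integral>t. \<phi> n t \<partial>M) \<le> C" for n by (simp add: not_less)
  have "(\<integral>\<^sup>+t. \<psi> t \<partial>M) \<le> (\<integral>\<^sup>+t. liminf (\<lambda>n. ennreal (\<phi> n t)) \<partial>M)" by (rule nn_integral_mono_AE[OF le])
  also have "\<dots> \<le> liminf (\<lambda>n. \<integral>\<^sup>+t. ennreal (\<phi> n t) \<partial>M)"
    by (rule nn_integral_liminf) (use borel_measurable_integrable[OF int] in simp)
  also have "\<dots> \<le> liminf (\<lambda>n::nat. ennreal C)"
    by (rule Liminf_mono) (use C nn_integral_eq_integral[OF int nonneg] in \<open>simp add: ennreal_leI\<close>)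
  also have "\<dots> = ennreal C" by (simp add: Liminf_const)
  finally show False using inf by (simp add: top_unique)
qed

text \<open>In every realization of \<open>M\<close>, this is \<open>(V x, (H - \<i> y)\<^sup>-\<^sup>1 V x)\<close> for \<open>0 < y \<noteq> 1\<close>.\<close>

definition resolvent_value :: "(complex \<Rightarrow> 'n::chilbert_space \<Rightarrow> 'n) \<Rightarrow> real \<Rightarrow> 'n \<Rightarrow> complex" where
  "resolvent_value M y x = (cinner x (M (\<i> * of_real y) x) - \<i> * of_real y * cinner x x) / of_real (1 - y\<^sup>2)"

text \<open>y = 1 is left out because \<open>resolvent_value\<close> divides by 1 - y^2.\<close>

definition Friedrichs_condition :: "(complex \<Rightarrow> 'n::chilbert_space \<Rightarrow> 'n) \<Rightarrow> bool" where
  "Friedrichs_condition M \<longleftrightarrow> (\<forall>x. x \<noteq> 0 \<longrightarrow> (\<forall>C. \<exists>y>0. y \<noteq> 1 \<and> C < y\<^sup>2 * Re (resolvent_value M y x)))"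

definition Krein_condition :: "(complex \<Rightarrow> 'n::chilbert_space \<Rightarrow> 'n) \<Rightarrow> bool" where
  "Krein_condition M \<longleftrightarrow> (\<forall>x. x \<noteq> 0 \<longrightarrow> (\<forall>C. \<exists>y>0. y \<noteq> 1 \<and>
    C < Re (resolvent_value M y x) + Im (resolvent_value M y x)))"

section \<open>Recovery of M from the multiplication operator\<close>

locale Herglotz_model = separable_povm \<Omega> for \<Omega> :: "real set \<Rightarrow> 'n::chilbert_space \<Rightarrow> 'n" +
  fixes M :: "complex \<Rightarrow> 'n \<Rightarrow> 'n"
  assumes Herglotz: "operator_Herglotz M" and rep: "N0_representation \<Omega> M"
begin

lemma resolvent_fun_i:
  "resolvent_fun (\<i> * of_real y) t
    = of_real (t / ((t\<^sup>2 + y\<^sup>2) * (1 + t\<^sup>2))) + \<i> * of_real (y / ((t\<^sup>2 + y\<^sup>2) * (1 + t\<^sup>2)))" if "y \<noteq> 0"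
proof -
  have p: "t\<^sup>2 + y\<^sup>2 > 0" using that by (simp add: add_nonneg_pos)
  have "(of_real t + \<i> * of_real y) * (of_real t - \<i> * of_real y) = complex_of_real (t\<^sup>2 + y\<^sup>2)"
    by (simp add: complex_eq_iff power2_eq_square)
  moreover have "complex_of_real t - \<i> * of_real y \<noteq> 0" using that by (simp add: complex_eq_iff)
  ultimately have "1 / (complex_of_real t - \<i> * of_real y) = (of_real t + \<i> * of_real y) / complex_of_real (t\<^sup>2 + y\<^sup>2)"
    using p by (simp add: divide_simps del: of_real_add of_real_power)
  then have "resolvent_fun (\<i> * of_real y) t
      = complex_of_real (1 / (1 + t\<^sup>2)) * ((of_real t + \<i> * of_real y) / complex_of_real (t\<^sup>2 + y\<^sup>2))"
    unfolding resolvent_fun_def by (metis divide_inverse inverse_eq_divide)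
  also have "\<dots> = of_real (t / ((t\<^sup>2 + y\<^sup>2) * (1 + t\<^sup>2))) + \<i> * of_real (y / ((t\<^sup>2 + y\<^sup>2) * (1 + t\<^sup>2)))"
    by (simp add: add_divide_distrib distrib_left mult_ac)
  finally show ?thesis .
qed

lemma resolvent_integrals:
  assumes y: "y \<noteq> 0"
  shows "integrable (\<mu> x) (\<lambda>t. t / ((t\<^sup>2 + y\<^sup>2) * (1 + t\<^sup>2)))"
    and "Re (form (resolvent_fun (\<i> * of_real y)) x x) = (\<integral>t. t / ((t\<^sup>2 + y\<^sup>2) * (1 + t\<^sup>2)) \<partial>\<mu> x)"
    and "integrable (\<mu> x) (\<lambda>t. y / ((t\<^sup>2 + y\<^sup>2) * (1 + t\<^sup>2)))"
    and "Im (form (resolvent_fun (\<i> * of_real y)) x x) = (\<integral>t. y / ((t\<^sup>2 + y\<^sup>2) * (1 + t\<^sup>2)) \<partial>\<mu> x)"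
proof -
  have adm: "admissible (resolvent_fun (\<i> * of_real y))" by (rule admissible_resolvent) (use y in simp)
  note int = admissible_integrable[OF adm, of x]
  have Re: "Re (resolvent_fun (\<i> * of_real y) t) = t / ((t\<^sup>2 + y\<^sup>2) * (1 + t\<^sup>2))"
    and Im: "Im (resolvent_fun (\<i> * of_real y) t) = y / ((t\<^sup>2 + y\<^sup>2) * (1 + t\<^sup>2))" for t
    unfolding resolvent_fun_i[OF y] by (simp_all del: of_real_divide of_real_mult of_real_add of_real_power)
  show "integrable (\<mu> x) (\<lambda>t. t / ((t\<^sup>2 + y\<^sup>2) * (1 + t\<^sup>2)))" using integrable_Re[OF int] by (simp only: Re)
  show "integrable (\<mu> x) (\<lambda>t. y / ((t\<^sup>2 + y\<^sup>2) * (1 + t\<^sup>2)))" using integrable_Im[OF int] by (simp only: Im)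
  show "Re (form (resolvent_fun (\<i> * of_real y)) x x) = (\<integral>t. t / ((t\<^sup>2 + y\<^sup>2) * (1 + t\<^sup>2)) \<partial>\<mu> x)"
    using integral_Re[OF int] by (simp only: form_diagonal[OF adm] Re)
  show "Im (form (resolvent_fun (\<i> * of_real y)) x x) = (\<integral>t. y / ((t\<^sup>2 + y\<^sup>2) * (1 + t\<^sup>2)) \<partial>\<mu> x)"
    using integral_Im[OF int] by (simp only: form_diagonal[OF adm] Im)
qed

text \<open>Algebra: 1/(t - z) - t/(1 + t^2) = (z + (1 + z^2)/(t - z))/(1 + t^2). This is integrated
  on the diagonal and then polarized.\<close>

lemma M_form_upper:
  assumes z: "Im z > 0"
  shows "cinner u (M z x) = z * cinner u x + (1 + z\<^sup>2) * form (resolvent_fun z) u x"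
proof -
  let ?w = "\<lambda>t. complex_of_real (1 / (1 + t\<^sup>2))"
  have adm: "admissible (resolvent_fun z)" by (rule admissible_resolvent) (use z in simp)
  note adms = admissible_scale[OF admissible_weight, of z] admissible_scale[OF adm, of "1 + z\<^sup>2"]
  have f: "1 / (complex_of_real t - z) - complex_of_real (t / (1 + t\<^sup>2)) = z * ?w t + (1 + z\<^sup>2) * resolvent_fun z t" for t
  proof -
    have nz: "complex_of_real t - z \<noteq> 0" "complex_of_real (1 + t\<^sup>2) \<noteq> 0"
      using of_real_diff_nz z add_pos_nonneg[of 1 "t\<^sup>2"] by (auto simp del: of_real_add of_real_power)
    have "z * ?w t + (1 + z\<^sup>2) * resolvent_fun z t = (z * (of_real t - z) + (1 + z\<^sup>2)) / (of_real (1 + t\<^sup>2) * (of_real t - z))"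
      using nz by (simp add: resolvent_fun_def field_simps del: of_real_add of_real_power)
    also have "z * (of_real t - z) + (1 + z\<^sup>2) = of_real (1 + t\<^sup>2) - of_real t * (of_real t - z)"
      by (simp add: power2_eq_square algebra_simps)
    also have "\<dots> / (of_real (1 + t\<^sup>2) * (of_real t - z)) = 1 / (of_real t - z) - of_real t / of_real (1 + t\<^sup>2)"
      using nz by (simp add: diff_divide_distrib del: of_real_add of_real_power)
    finally show ?thesis by simp
  qed
  have "has_strong_integral \<Omega> (\<lambda>t. 1 / (complex_of_real t - z) - complex_of_real (t / (1 + t\<^sup>2))) (M z)"
    using rep z by (simp add: N0_representation_def)
  then have I: "has_bochner_integral (\<mu> v) (\<lambda>t. z * ?w t + (1 + z\<^sup>2) * resolvent_fun z t) (cinner v (M z v))" for v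
    using strong_integral_has_integral unfolding f by blast
  have diag: "cinner v (M z v) = z * cinner v v + (1 + z\<^sup>2) * form (resolvent_fun z) v v" for v
  proof -
    have "cinner v (M z v) = form (\<lambda>t. z * ?w t + (1 + z\<^sup>2) * resolvent_fun z t) v v"
      using form_diagonal[OF admissible_add[OF adms], of v] has_bochner_integral_integral_eq[OF I, of v] by simp
    also have "\<dots> = form (\<lambda>t. z * ?w t) v v + form (\<lambda>t. (1 + z\<^sup>2) * resolvent_fun z t) v v"
      by (rule form_fun_add[OF adms])
    also have "\<dots> = z * form ?w v v + (1 + z\<^sup>2) * form (resolvent_fun z) v v"
      by (simp only: form_fun_scale[OF admissible_weight] form_fun_scale[OF adm])
    finally show ?thesis by (simp only: form_weight[OF admissible_weight])
  qed
  have lin: "M z (a + b) = M z a + M z b" "M z (c *\<^sub>C a) = c *\<^sub>C M z a" for a b c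
    using Herglotz z by (auto simp: operator_Herglotz_def bounded_clinear_def clinear_def)
  show ?thesis
    by (rule sesquilinear_eqI[of "\<lambda>u x. cinner u (M z x)" "\<lambda>u x. z * cinner u x + (1 + z\<^sup>2) * form (resolvent_fun z) u x"])
      (simp_all add: lin diag cinner_add_left cinner_add_right cinner_scaleC_left cinner_scaleC_right
        form_add_left[OF adm] form_add_right[OF adm] form_scale_left[OF adm] form_scale_right[OF adm] algebra_simps)
qed

text \<open>In the lower half-plane M z is the adjoint of M at the conjugate point, and conjugation
  also maps the resolvent functions into each other.\<close>

lemma M_form:
  assumes z: "Im z \<noteq> 0"
  shows "cinner u (M z x) = z * cinner u x + (1 + z\<^sup>2) * form (resolvent_fun z) u x"
proof (cases "Im z > 0")
  case False
  define w where "w = cnj z"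
  have w: "Im w > 0" "z = cnj w" using z False by (auto simp: w_def)
  have adm: "admissible (resolvent_fun w)" by (rule admissible_resolvent) (use w in simp)
  have "bounded_clinear (M w)" "M z = cadjoint (M w)" using Herglotz w by (auto simp: operator_Herglotz_def)
  then have "cinner u (M z x) = cinner (M w u) x" using cadjoint_works by metis
  also have "\<dots> = cnj (cinner x (M w u))" by (rule cinner_commute)
  also have "\<dots> = cnj w * cnj (cinner x u) + (1 + (cnj w)\<^sup>2) * cnj (form (resolvent_fun w) x u)"
    by (simp add: M_form_upper[OF w(1)])
  also have "cnj (form (resolvent_fun w) x u) = form (\<lambda>t. cnj (resolvent_fun w t)) u x"
    by (rule form_cnj[OF adm, symmetric])
  also have "(\<lambda>t. cnj (resolvent_fun w t)) = resolvent_fun z"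
    by (simp add: resolvent_fun_def w(2) fun_eq_iff)
  finally show ?thesis using cinner_commute[of u x] by (simp add: w(2))
qed (rule M_form_upper)

lemma resolvent_value_form:
  assumes y: "y > 0" "y \<noteq> 1"
  shows "resolvent_value M y x = form (resolvent_fun (\<i> * of_real y)) x x"
proof -
  have "1 - y\<^sup>2 \<noteq> 0" using y by (simp add: power2_eq_1_iff)
  then have nz: "complex_of_real (1 - y\<^sup>2) \<noteq> 0" by (simp only: of_real_eq_0_iff not_False_eq_True)
  have eq: "1 + (\<i> * complex_of_real y)\<^sup>2 = of_real (1 - y\<^sup>2)" by (simp add: power_mult_distrib)
  have "Im (\<i> * complex_of_real y) \<noteq> 0" using y by simp
  from M_form[OF this, of x x] show ?thesis
    unfolding resolvent_value_def eq by (simp only: add_diff_cancel_left' nonzero_mult_div_cancel_left[OF nz])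
qed

text \<open>If V x had the image g, \<open>resolvent_domain_bound\<close> would keep the integrals
  of t^2/(1 + t^2) times y^2/(t^2 + y^2) below |g|^2. As y grows the integrand tends to t^2/(1 +
  t^2), whose integral is infinite.\<close>

lemma no_domain:
  assumes dom: "(\<gamma> \<i> x, g) \<in> mult_op" shows "x = 0"
proof (rule ccontr)
  assume x: "x \<noteq> 0"
  define y where "y n = real (n + 2)" for n
  have y: "y n > 1" for n by (simp add: y_def)
  have y2: "y n \<noteq> 0" "\<i> * of_real (y n) \<noteq> \<i>" for n using y[of n] by (auto simp: complex_eq_iff)
  define \<phi> where "\<phi> n t = (y n)\<^sup>2 * (1 / (1 + t\<^sup>2) - y n * (y n / ((t\<^sup>2 + (y n)\<^sup>2) * (1 + t\<^sup>2))))" for n t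
  have \<phi>_eq: "\<phi> n t = t\<^sup>2 / (1 + t\<^sup>2) * ((y n)\<^sup>2 / (t\<^sup>2 + (y n)\<^sup>2))" for n t
  proof -
    have split: "1 - y n * (y n / Q) = (Q - (y n)\<^sup>2) / Q" if "Q > 0" for Q
      using that by (simp add: diff_divide_distrib power2_eq_square)
    have "0 < t\<^sup>2 + (y n)\<^sup>2" using y2(1)[of n] by (simp add: add_nonneg_pos)
    from split[OF this] have q: "1 - y n * (y n / (t\<^sup>2 + (y n)\<^sup>2)) = t\<^sup>2 / (t\<^sup>2 + (y n)\<^sup>2)"
      by simp
    have "\<phi> n t = (y n)\<^sup>2 * ((1 - y n * (y n / (t\<^sup>2 + (y n)\<^sup>2))) / (1 + t\<^sup>2))"
      unfolding \<phi>_def by (simp add: diff_divide_distrib)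
    then show ?thesis unfolding q by (simp add: mult_ac)
  qed
  have "\<exists>n. (norm g)\<^sup>2 < (\<integral>t. \<phi> n t \<partial>\<mu> x)"
  proof (rule Fatou_unbounded[where \<psi> = "\<lambda>t. ennreal (t\<^sup>2 / (1 + t\<^sup>2))"])
    show "integrable (\<mu> x) (\<phi> n)" for n unfolding \<phi>_def
      by (intro integrable_mult_right Bochner_Integration.integrable_diff integrable_weight resolvent_integrals(3) y2)
    show "AE t in \<mu> x. 0 \<le> \<phi> n t" for n unfolding \<phi>_eq by (simp add: add_nonneg_nonneg)
    show "AE t in \<mu> x. ennreal (t\<^sup>2 / (1 + t\<^sup>2)) \<le> liminf (\<lambda>n. ennreal (\<phi> n t))"
    proof (rule AE_I2)
      fix t :: real
      have "(\<lambda>n. t\<^sup>2 / (1 + t\<^sup>2) * ((y n)\<^sup>2 / (t\<^sup>2 + (y n)\<^sup>2))) \<longlonglongrightarrow> t\<^sup>2 / (1 + t\<^sup>2) * 1"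
        unfolding y_def by (intro tendsto_mult tendsto_const) real_asymp
      then have "(\<lambda>n. ennreal (\<phi> n t)) \<longlonglongrightarrow> ennreal (t\<^sup>2 / (1 + t\<^sup>2))"
        unfolding \<phi>_eq by (intro tendsto_ennrealI) simp
      then show "ennreal (t\<^sup>2 / (1 + t\<^sup>2)) \<le> liminf (\<lambda>n. ennreal (\<phi> n t))"
        by (simp add: lim_imp_Liminf)
    qed
    show "(\<integral>\<^sup>+t. ennreal (t\<^sup>2 / (1 + t\<^sup>2)) \<partial>\<mu> x) = \<infinity>"
    proof (rule ccontr)
      assume fin: "(\<integral>\<^sup>+t. ennreal (t\<^sup>2 / (1 + t\<^sup>2)) \<partial>\<mu> x) \<noteq> \<infinity>"
      \<comment> \<open>The weight has finite integral, so its complement t^2/(1 + t^2) accounts for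
        the infinite mass.\<close>
      have "1 = ennreal (t\<^sup>2 / (1 + t\<^sup>2)) + ennreal (1 / (1 + t\<^sup>2))" for t :: real
      proof -
        have "0 < 1 + t\<^sup>2" by (simp add: add_pos_nonneg)
        then have "t\<^sup>2 / (1 + t\<^sup>2) + 1 / (1 + t\<^sup>2) = 1" by (simp add: add_divide_distrib[symmetric] add.commute)
        then show ?thesis by (simp add: add_nonneg_nonneg flip: ennreal_plus)
      qed
      then have "(\<integral>\<^sup>+t. 1 \<partial>\<mu> x) = (\<integral>\<^sup>+t. ennreal (t\<^sup>2 / (1 + t\<^sup>2)) + ennreal (1 / (1 + t\<^sup>2)) \<partial>\<mu> x)"
        by (intro nn_integral_cong) simp
      also have "\<dots> = (\<integral>\<^sup>+t. ennreal (t\<^sup>2 / (1 + t\<^sup>2)) \<partial>\<mu> x) + (\<integral>\<^sup>+t. ennreal (1 / (1 + t\<^sup>2)) \<partial>\<mu> x)"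
        by (rule nn_integral_add) simp_all
      also have "(\<integral>\<^sup>+t. ennreal (1 / (1 + t\<^sup>2)) \<partial>\<mu> x) = ennreal ((norm x)\<^sup>2)"
        unfolding integral_weight[symmetric]
        by (rule nn_integral_eq_integral[OF integrable_weight]) (simp add: add_nonneg_nonneg)
      finally have "(\<integral>\<^sup>+t. 1 \<partial>\<mu> x) \<noteq> \<infinity>" using fin by (simp add: ennreal_add_eq_top)
      then show False using rep x by (simp add: N0_representation_def)
    qed
  qed
  then obtain n where n: "(norm g)\<^sup>2 < (\<integral>t. \<phi> n t \<partial>\<mu> x)" by blast
  have "(\<integral>t. \<phi> n t \<partial>\<mu> x) = (y n)\<^sup>2 * ((\<integral>t. 1 / (1 + t\<^sup>2) \<partial>\<mu> x) - y n * (\<integral>t. y n / ((t\<^sup>2 + (y n)\<^sup>2) * (1 + t\<^sup>2)) \<partial>\<mu> x))"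
    by (simp only: \<phi>_def integral_mult_right_zero
        Bochner_Integration.integral_diff[OF integrable_weight integrable_mult_right[OF resolvent_integrals(3)[OF y2(1)]]])
  also have "\<dots> = (y n)\<^sup>2 * ((norm x)\<^sup>2 - y n * Im (form (resolvent_fun (\<i> * of_real (y n))) x x))"
    by (simp only: integral_weight resolvent_integrals(4)[OF y2(1)])
  finally have int: "(\<integral>t. \<phi> n t \<partial>\<mu> x) = (y n)\<^sup>2 * ((norm x)\<^sup>2 - y n * Im (form (resolvent_fun (\<i> * of_real (y n))) x x))" .
  obtain v w where vw: "(v, w) \<in> mult_op" "w - (\<i> * of_real (y n)) *\<^sub>C v = \<gamma> \<i> x"
    using self_adjoint_resolvent[OF mult_op_self_adjoint hilbert_S _ \<gamma>_in_S, of "\<i> * of_real (y n)" \<i> x] y2(1)[of n] by auto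
  have "norm (\<gamma> \<i> x) = norm x"
  proof -
    have "(norm (\<gamma> \<i> x))\<^sup>2 = (norm x)\<^sup>2" using \<gamma>_i_isometry[of x x] by (metis Re_cinner_self)
    then show ?thesis by (simp add: power2_eq_iff_nonneg)
  qed
  moreover have "cinner (\<gamma> \<i> x) v = form (resolvent_fun (\<i> * of_real (y n))) x x"
    by (rule resolvent_formula[OF _ y2(2) vw]) (use y2(1)[of n] in simp)
  ultimately have "(\<integral>t. \<phi> n t \<partial>\<mu> x) \<le> (norm g)\<^sup>2"
    using resolvent_domain_bound[OF mult_op_self_adjoint dom vw] by (simp only: int)
  then show False using n by simp
qed

sublocale realization space_S mult_op "\<gamma> \<i>"
proof
  show "clinear (\<gamma> \<i>)" by (simp add: clinear_def \<gamma>_add \<gamma>_scale)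
qed (auto intro: hilbert_S mult_op_self_adjoint \<gamma>_i_isometry \<gamma>_in_S no_domain)

lemma realization_M:
  assumes "z \<notin> \<real>"
  shows "M z = Herglotz_realization mult_op (deficiency_plus space_S Hdot) (\<gamma> \<i>) z"
proof (rule realization_eq)
  show z: "Im z \<noteq> 0" using assms complex_is_Real_iff by blast
  fix x f g u assume fg: "(f, g) \<in> mult_op" "g - z *\<^sub>C f = \<gamma> \<i> x"
  show "(1 + z\<^sup>2) * cinner (\<gamma> \<i> u) f = cinner u (M z x) - z * cinner u x"
  \<comment> \<open>At z = i the factor 1 + z^2 vanishes and both sides are 0.\<close>
  proof (cases "z = \<i>")
    case True
    then show ?thesis using M_form[OF z, of u x] by simp
  next
    case False
    then show ?thesis using M_form[OF z, of u x] resolvent_formula[OF z False fg, of u] by simp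
  qed
qed

text \<open>The negative half-line is covered by null intervals, and countably many of them are
  enough by the Lindelof property.\<close>

lemma support_null:
  assumes "povm_support \<Omega> \<subseteq> {0..}"
  shows "emeasure (\<mu> x) {..<0} = 0"
proof -
  define F where "F = {B :: real set. \<exists>t e. B = {t - e<..<t + e} \<and> \<Omega> B = (\<lambda>\<xi>. 0)}"
  have op: "open B" if "B \<in> F" for B using that by (auto simp: F_def)
  obtain F' where F': "F' \<subseteq> F" "countable F'" "\<Union>F' = \<Union>F"
    using Lindelof[of F] op by metis
  have "{..<0} \<subseteq> \<Union>F"
  proof
    fix t :: real assume "t \<in> {..<0}"
    then have "t \<notin> povm_support \<Omega>" using assms by auto
    then obtain e where "e > 0" "\<Omega> {t - e<..<t + e} = (\<lambda>\<xi>. 0)" by (auto simp: povm_support_def)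
    then show "t \<in> \<Union>F" unfolding F_def by (intro UnionI[of "{t - e<..<t + e}"]) auto
  qed
  moreover have "(\<Union>B\<in>F'. B) \<in> null_sets (\<mu> x)"
  proof (rule null_sets_UN'[OF F'(2)])
    fix B assume "B \<in> F'"
    then obtain t e where B: "B = {t - e<..<t + e}" "\<Omega> B = (\<lambda>\<xi>. 0)" using F'(1) by (auto simp: F_def)
    have b: "B \<in> sets borel" "bounded B" unfolding B(1) by auto
    have "emeasure (\<mu> x) B = 0" using emeasure_\<mu>_bounded[OF b, of x] B(2) by (simp add: cinner.zero_right)
    then show "B \<in> null_sets (\<mu> x)" using b(1) by auto
  qed
  ultimately have "{..<0} \<in> null_sets (\<mu> x)"
    using F'(3) by (intro null_sets_subset[of "\<Union>F'" "\<mu> x" "{..<0}"]) auto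
  then show ?thesis by auto
qed

lemma AE_nonneg:
  assumes "povm_support \<Omega> \<subseteq> {0..}" shows "AE t in \<mu> x. 0 \<le> t"
proof (rule AE_I[of _ _ "{..<0}"])
  show "emeasure (\<mu> x) {..<0} = 0" by (rule support_null[OF assms])
qed auto

lemma Friedrichs_condition_M:
  assumes supp: "povm_support \<Omega> \<subseteq> {0..}"
    and F: "\<And>x. x \<noteq> 0 \<Longrightarrow> \<exists>R>0. (\<integral>\<^sup>+t\<in>{R..}. inverse (ennreal t) \<partial>\<mu> x) = \<infinity>"
  shows "Friedrichs_condition M"
  unfolding Friedrichs_condition_def
proof (intro allI impI)
  fix x :: 'n and C :: real assume x: "x \<noteq> 0"
  obtain R where R: "R > 0" "(\<integral>\<^sup>+t\<in>{R..}. inverse (ennreal t) \<partial>\<mu> x) = \<infinity>" using F[OF x] by blast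
  \<comment> \<open>t^2/(1 + t^2) increases for t > 0, so t/(1 + t^2) >= c/t for t >= R.\<close>
  define c where "c = R\<^sup>2 / (1 + R\<^sup>2)"
  have c: "c > 0" using R by (simp add: c_def add_pos_nonneg)
  define y where "y n = real (n + 2)" for n
  have y: "y n > 1" for n by (simp add: y_def)
  define \<phi> where "\<phi> n t = (y n)\<^sup>2 * (t / ((t\<^sup>2 + (y n)\<^sup>2) * (1 + t\<^sup>2)))" for n t
  have "\<exists>n. C < (\<integral>t. \<phi> n t \<partial>\<mu> x)"
  proof (rule Fatou_unbounded[where \<psi> = "\<lambda>t. ennreal c * (inverse (ennreal t) * indicator {R..} t)"])
    show "integrable (\<mu> x) (\<phi> n)" for n unfolding \<phi>_def
      by (intro integrable_mult_right resolvent_integrals(1)) (use y[of n] in simp)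
    show "AE t in \<mu> x. 0 \<le> \<phi> n t" for n
      using AE_nonneg[OF supp] by eventually_elim (simp add: \<phi>_def add_nonneg_nonneg)
    show "AE t in \<mu> x. ennreal c * (inverse (ennreal t) * indicator {R..} t) \<le> liminf (\<lambda>n. ennreal (\<phi> n t))"
    proof (rule AE_I2)
      fix t :: real
      show "ennreal c * (inverse (ennreal t) * indicator {R..} t) \<le> liminf (\<lambda>n. ennreal (\<phi> n t))"
      proof (cases "t \<ge> R")
        case True
        then have t: "t > 0" using R by simp
        have "R\<^sup>2 \<le> t\<^sup>2" using True R by (intro power_mono) auto
        then have "R\<^sup>2 * (1 + t\<^sup>2) \<le> t\<^sup>2 * (1 + R\<^sup>2)" by (simp add: algebra_simps)
        then have "c * (1 + t\<^sup>2) \<le> t\<^sup>2" by (simp add: c_def divide_simps add_pos_nonneg)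
        then have "c * (1 / t) \<le> t / (1 + t\<^sup>2)"
          using t by (simp add: divide_simps add_pos_nonneg power2_eq_square mult_ac)
        moreover have "(\<lambda>n. t / (1 + t\<^sup>2) * ((y n)\<^sup>2 / (t\<^sup>2 + (y n)\<^sup>2))) \<longlonglongrightarrow> t / (1 + t\<^sup>2) * 1"
          unfolding y_def by (intro tendsto_mult tendsto_const) real_asymp
        then have "(\<lambda>n. ennreal (\<phi> n t)) \<longlonglongrightarrow> ennreal (t / (1 + t\<^sup>2))"
          unfolding \<phi>_def by (intro tendsto_ennrealI) (simp add: mult_ac)
        then have "liminf (\<lambda>n. ennreal (\<phi> n t)) = ennreal (t / (1 + t\<^sup>2))" by (simp add: lim_imp_Liminf)
        moreover have "ennreal c * (inverse (ennreal t) * indicator {R..} t) = ennreal (c * (1 / t))"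
          using True t c by (simp add: inverse_ennreal ennreal_mult[symmetric] inverse_eq_divide)
        ultimately show ?thesis by (simp add: ennreal_leI)
      qed simp
    qed
    show "(\<integral>\<^sup>+t. ennreal c * (inverse (ennreal t) * indicator {R..} t) \<partial>\<mu> x) = \<infinity>"
      using R(2) c by (subst nn_integral_cmult) (auto simp: ennreal_mult_top)
  qed
  then obtain n where n: "C < (\<integral>t. \<phi> n t \<partial>\<mu> x)" by blast
  have "(\<integral>t. \<phi> n t \<partial>\<mu> x) = (y n)\<^sup>2 * Re (resolvent_value M (y n) x)"
    unfolding \<phi>_def integral_mult_right_zero
    using y[of n] resolvent_integrals(2)[of "y n" x] resolvent_value_form[of "y n" x] by simp
  then show "\<exists>y>0. y \<noteq> 1 \<and> C < y\<^sup>2 * Re (resolvent_value M y x)" using n y[of n] by (intro exI[of _ "y n"]) simp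
qed

lemma Krein_condition_M:
  assumes supp: "povm_support \<Omega> \<subseteq> {0..}"
    and K: "\<And>x. x \<noteq> 0 \<Longrightarrow> \<exists>R>0. (\<integral>\<^sup>+t\<in>{0..R}. inverse (ennreal t) \<partial>\<mu> x) = \<infinity>"
  shows "Krein_condition M"
  unfolding Krein_condition_def
proof (intro allI impI)
  fix x :: 'n and C :: real assume x: "x \<noteq> 0"
  obtain R where R: "R > 0" "(\<integral>\<^sup>+t\<in>{0..R}. inverse (ennreal t) \<partial>\<mu> x) = \<infinity>" using K[OF x] by blast
  \<comment> \<open>The minimum of 1/(1 + t^2) on [0, R].\<close>
  define c where "c = 1 / (1 + R\<^sup>2)"
  have c: "c > 0" by (simp add: c_def add_pos_nonneg)
  define y where "y n = 1 / real (n + 2)" for n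
  have y: "0 < y n" "y n < 1" for n by (simp_all add: y_def)
  \<comment> \<open>The second summand takes care of an atom at 0: there the first one vanishes,
    while this one is 1/y and matches the value infinity of the inverse of 0.\<close>
  define \<phi> where "\<phi> n t = t / ((t\<^sup>2 + (y n)\<^sup>2) * (1 + t\<^sup>2)) + y n / ((t\<^sup>2 + (y n)\<^sup>2) * (1 + t\<^sup>2))" for n t
  have "\<exists>n. C < (\<integral>t. \<phi> n t \<partial>\<mu> x)"
  proof (rule Fatou_unbounded[where \<psi> = "\<lambda>t. ennreal c * (inverse (ennreal t) * indicator {0..R} t)"])
    show "integrable (\<mu> x) (\<phi> n)" for n unfolding \<phi>_def
      by (intro Bochner_Integration.integrable_add resolvent_integrals(1,3)) (use y(1)[of n] in simp_all)
    show "AE t in \<mu> x. 0 \<le> \<phi> n t" for n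
      using AE_nonneg[OF supp] by eventually_elim (use y(1)[of n] in \<open>simp add: \<phi>_def add_nonneg_nonneg\<close>)
    show "AE t in \<mu> x. ennreal c * (inverse (ennreal t) * indicator {0..R} t) \<le> liminf (\<lambda>n. ennreal (\<phi> n t))"
    proof (rule AE_I2)
      fix t :: real
      consider "t = 0" | "0 < t" "t \<le> R" | "t \<notin> {0..R}" by force
      then show "ennreal c * (inverse (ennreal t) * indicator {0..R} t) \<le> liminf (\<lambda>n. ennreal (\<phi> n t))"
      proof cases
        case 1
        have "ennreal (\<phi> n t) = of_nat (n + 2)" for n
          unfolding \<phi>_def y_def 1 ennreal_of_nat_eq_real_of_nat by (simp add: power2_eq_square del: of_nat_add)
        moreover have "(\<lambda>n. of_nat (n + 2) :: ennreal) \<longlonglongrightarrow> \<infinity>"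
          using LIMSEQ_ignore_initial_segment[OF of_nat_tendsto_top_ennreal, of 2] by simp
        ultimately have "liminf (\<lambda>n. ennreal (\<phi> n t)) = \<infinity>" by (simp add: lim_imp_Liminf)
        then show ?thesis by simp
      next
        case 2
        have "t\<^sup>2 \<le> R\<^sup>2" using 2 by (intro power_mono) auto
        then have "c \<le> 1 / (1 + t\<^sup>2)" unfolding c_def by (intro divide_left_mono) (auto simp: add_pos_nonneg)
        then have "c * (1 / t) \<le> 1 / (1 + t\<^sup>2) * (1 / t)" using 2 by (intro mult_right_mono) auto
        moreover have "(\<lambda>n. 1 / (1 + t\<^sup>2) * ((t + y n) / (t\<^sup>2 + (y n)\<^sup>2))) \<longlonglongrightarrow> 1 / (1 + t\<^sup>2) * ((t + 0) / (t\<^sup>2 + 0\<^sup>2))"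
        proof (intro tendsto_intros)
          show "y \<longlonglongrightarrow> 0" unfolding y_def by real_asymp
          then show "y \<longlonglongrightarrow> 0" .
          show "t\<^sup>2 + 0\<^sup>2 \<noteq> 0" using 2 by simp
        qed
        then have "(\<lambda>n. ennreal (\<phi> n t)) \<longlonglongrightarrow> ennreal (1 / (1 + t\<^sup>2) * (1 / t))"
          unfolding \<phi>_def using 2 by (intro tendsto_ennrealI) (simp add: add_divide_distrib distrib_left power2_eq_square mult_ac)
        then have "liminf (\<lambda>n. ennreal (\<phi> n t)) = ennreal (1 / (1 + t\<^sup>2) * (1 / t))" by (simp add: lim_imp_Liminf)
        moreover have "ennreal c * (inverse (ennreal t) * indicator {0..R} t) = ennreal (c * (1 / t))"
          using 2 c by (simp add: inverse_ennreal ennreal_mult[symmetric] inverse_eq_divide)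
        ultimately show ?thesis by (simp add: ennreal_leI)
      qed simp
    qed
    show "(\<integral>\<^sup>+t. ennreal c * (inverse (ennreal t) * indicator {0..R} t) \<partial>\<mu> x) = \<infinity>"
      using R(2) c by (subst nn_integral_cmult) (auto simp: ennreal_mult_top)
  qed
  then obtain n where n: "C < (\<integral>t. \<phi> n t \<partial>\<mu> x)" by blast
  have "(\<integral>t. \<phi> n t \<partial>\<mu> x) = Re (resolvent_value M (y n) x) + Im (resolvent_value M (y n) x)"
    using y[of n] resolvent_integrals[of "y n" x] resolvent_value_form[of "y n" x]
    by (simp add: \<phi>_def)
  then show "\<exists>y>0. y \<noteq> 1 \<and> C < Re (resolvent_value M y x) + Im (resolvent_value M y x)"
    using n y[of n] by (intro exI[of _ "y n"]) simp
qed

lemma resolvent_value_cinner: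
  assumes y: "y > 0" "y \<noteq> 1" and fg: "(f, g) \<in> mult_op" "g - (\<i> * of_real y) *\<^sub>C f = \<gamma> \<i> x"
  shows "cinner (\<gamma> \<i> x) f = resolvent_value M y x"
proof -
  have "\<i> * of_real y \<noteq> \<i>" using y by (simp add: complex_eq_iff)
  then show ?thesis
    using resolvent_formula[OF _ _ fg, of x] y by (simp add: resolvent_value_form)
qed

lemma Friedrichs_condition_mult_op: "Friedrichs_condition M \<Longrightarrow> form_condition"
  unfolding Friedrichs_condition_def form_condition_def by (metis resolvent_value_cinner)

lemma Krein_condition_mult_op: "Krein_condition M \<Longrightarrow> range_condition"
  unfolding Krein_condition_def range_condition_def by (metis resolvent_value_cinner)

lemma nonneg_realization:
  assumes "povm_support \<Omega> \<subseteq> {0..}"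
  shows "nonneg_realization space_S mult_op (\<gamma> \<i>)"
  using mult_op_nonneg[OF support_null[OF assms]]
  by (intro nonneg_realization.intro nonneg_realization_axioms.intro realization_axioms)

end

section \<open>The realizations for the four classes\<close>

lemma Herglotz_modelI:
  assumes "separable_set (UNIV :: 'n::chilbert_space set)" "M \<in> N0" "N0_representation \<Omega> (M :: complex \<Rightarrow> 'n \<Rightarrow> 'n)"
  shows "Herglotz_model \<Omega> M"
  using assms by unfold_locales (auto simp: N0_def N0_representation_def)

theorem theorem4p10:
  assumes "separable_set (UNIV :: 'n::chilbert_space set)"
  shows
    "(\<forall>M \<in> (N0 :: (complex \<Rightarrow> 'n \<Rightarrow> 'n) set).
      \<exists>(S :: ell2 set) Hdot H V.
        hilbert_subspace S \<and> separable_set S \<and> dd_closed_symmetric S Hdot \<and>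
        self_adjoint S H \<and> Hdot \<subseteq> H \<and>
        unitary_onto V (deficiency_plus S Hdot) \<and>
        (\<forall>z. z \<notin> \<real> \<longrightarrow> M z = Herglotz_realization H (deficiency_plus S Hdot) V z)) \<and>
    (\<forall>M \<in> (N0F :: (complex \<Rightarrow> 'n \<Rightarrow> 'n) set).
      \<exists>(S :: ell2 set) Hdot V.
        hilbert_subspace S \<and> separable_set S \<and> dd_closed_symmetric S Hdot \<and>
        nonneg_op Hdot \<and> nonneg_op (Friedrichs_extension S Hdot) \<and>
        unitary_onto V (deficiency_plus S Hdot) \<and>
        (\<forall>z. z \<notin> \<real> \<longrightarrow>
          M z = Herglotz_realization (Friedrichs_extension S Hdot) (deficiency_plus S Hdot) V z)) \<and>
    (\<forall>M \<in> (N0K :: (complex \<Rightarrow> 'n \<Rightarrow> 'n) set).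
      \<exists>(S :: ell2 set) Hdot V.
        hilbert_subspace S \<and> separable_set S \<and> dd_closed_symmetric S Hdot \<and>
        nonneg_op Hdot \<and> nonneg_op (Krein_extension S Hdot) \<and>
        unitary_onto V (deficiency_plus S Hdot) \<and>
        (\<forall>z. z \<notin> \<real> \<longrightarrow>
          M z = Herglotz_realization (Krein_extension S Hdot) (deficiency_plus S Hdot) V z)) \<and>
    (\<forall>M \<in> (N0FK :: (complex \<Rightarrow> 'n \<Rightarrow> 'n) set).
      \<exists>(S :: ell2 set) Hdot H V.
        hilbert_subspace S \<and> separable_set S \<and> dd_closed_symmetric S Hdot \<and>
        nonneg_op Hdot \<and> self_adjoint S H \<and> nonneg_op H \<and> Hdot \<subseteq> H \<and>
        (\<forall>H'. self_adjoint S H' \<and> nonneg_op H' \<and> Hdot \<subseteq> H' \<longrightarrow> H' = H) \<and>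
        unitary_onto V (deficiency_plus S Hdot) \<and>
        (\<forall>z. z \<notin> \<real> \<longrightarrow> M z = Herglotz_realization H (deficiency_plus S Hdot) V z))"
proof (intro conjI ballI)
  fix M :: "complex \<Rightarrow> 'n \<Rightarrow> 'n" assume M: "M \<in> N0"
  then obtain \<Omega> where \<Omega>: "N0_representation \<Omega> M" by (auto simp: N0_def)
  interpret Herglotz_model \<Omega> M by (rule Herglotz_modelI[OF assms M \<Omega>])
  show "\<exists>(S :: ell2 set) Hdot H V.
        hilbert_subspace S \<and> separable_set S \<and> dd_closed_symmetric S Hdot \<and>
        self_adjoint S H \<and> Hdot \<subseteq> H \<and>
        unitary_onto V (deficiency_plus S Hdot) \<and>
        (\<forall>z. z \<notin> \<real> \<longrightarrow> M z = Herglotz_realization H (deficiency_plus S Hdot) V z)"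
    by (intro exI[of _ space_S] exI[of _ Hdot] exI[of _ mult_op] exI[of _ "\<gamma> \<i>"] conjI allI impI)
      (rule hilbert_S separable_S Hdot_dd mult_op_self_adjoint Hdot_sub unitary realization_M; assumption?)+
next
  fix M :: "complex \<Rightarrow> 'n \<Rightarrow> 'n" assume M: "M \<in> N0F"
  then obtain \<Omega> where \<Omega>: "M \<in> N0" "N0_representation \<Omega> M" "povm_support \<Omega> \<subseteq> {0..}"
    and F: "\<And>x. x \<noteq> 0 \<Longrightarrow> \<exists>R>0. (\<integral>\<^sup>+t\<in>{R..}. inverse (ennreal t) \<partial>povm_scalar \<Omega> x) = \<infinity>"
    by (auto simp: N0F_def)
  interpret Herglotz_model \<Omega> M by (rule Herglotz_modelI[OF assms \<Omega>(1,2)])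
  interpret nonneg_realization space_S mult_op "\<gamma> \<i>" by (rule nonneg_realization[OF \<Omega>(3)])
  have eq: "Friedrichs_extension space_S Hdot = mult_op"
    by (rule Friedrichs_eq[OF Friedrichs_condition_mult_op[OF Friedrichs_condition_M[OF \<Omega>(3) F]]])
  show "\<exists>(S :: ell2 set) Hdot V.
        hilbert_subspace S \<and> separable_set S \<and> dd_closed_symmetric S Hdot \<and>
        nonneg_op Hdot \<and> nonneg_op (Friedrichs_extension S Hdot) \<and>
        unitary_onto V (deficiency_plus S Hdot) \<and>
        (\<forall>z. z \<notin> \<real> \<longrightarrow>
          M z = Herglotz_realization (Friedrichs_extension S Hdot) (deficiency_plus S Hdot) V z)"
    by (intro exI[of _ space_S] exI[of _ Hdot] exI[of _ "\<gamma> \<i>"] conjI allI impI, unfold eq)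
      (rule hilbert_S separable_S Hdot_dd Hdot_nonneg nn unitary realization_M; assumption?)+
next
  fix M :: "complex \<Rightarrow> 'n \<Rightarrow> 'n" assume M: "M \<in> N0K"
  then obtain \<Omega> where \<Omega>: "M \<in> N0" "N0_representation \<Omega> M" "povm_support \<Omega> \<subseteq> {0..}"
    and K: "\<And>x. x \<noteq> 0 \<Longrightarrow> \<exists>R>0. (\<integral>\<^sup>+t\<in>{0..R}. inverse (ennreal t) \<partial>povm_scalar \<Omega> x) = \<infinity>"
    by (auto simp: N0K_def)
  interpret Herglotz_model \<Omega> M by (rule Herglotz_modelI[OF assms \<Omega>(1,2)])
  interpret nonneg_realization space_S mult_op "\<gamma> \<i>" by (rule nonneg_realization[OF \<Omega>(3)])
  have eq: "Krein_extension space_S Hdot = mult_op"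
    by (rule Krein_eq[OF Krein_condition_mult_op[OF Krein_condition_M[OF \<Omega>(3) K]]])
  show "\<exists>(S :: ell2 set) Hdot V.
        hilbert_subspace S \<and> separable_set S \<and> dd_closed_symmetric S Hdot \<and>
        nonneg_op Hdot \<and> nonneg_op (Krein_extension S Hdot) \<and>
        unitary_onto V (deficiency_plus S Hdot) \<and>
        (\<forall>z. z \<notin> \<real> \<longrightarrow>
          M z = Herglotz_realization (Krein_extension S Hdot) (deficiency_plus S Hdot) V z)"
    by (intro exI[of _ space_S] exI[of _ Hdot] exI[of _ "\<gamma> \<i>"] conjI allI impI, unfold eq)
      (rule hilbert_S separable_S Hdot_dd Hdot_nonneg nn unitary realization_M; assumption?)+
next
  fix M :: "complex \<Rightarrow> 'n \<Rightarrow> 'n" assume "M \<in> N0FK"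
  then have M: "M \<in> N0F" "M \<in> N0K" by (auto simp: N0FK_def)
  from M(1) obtain \<Omega> where \<Omega>: "M \<in> N0" "N0_representation \<Omega> M" "povm_support \<Omega> \<subseteq> {0..}"
    and F: "\<And>x. x \<noteq> 0 \<Longrightarrow> \<exists>R>0. (\<integral>\<^sup>+t\<in>{R..}. inverse (ennreal t) \<partial>povm_scalar \<Omega> x) = \<infinity>"
    by (auto simp: N0F_def)
  from M(2) obtain \<Omega>' where \<Omega>': "N0_representation \<Omega>' M" "povm_support \<Omega>' \<subseteq> {0..}"
    and K: "\<And>x. x \<noteq> 0 \<Longrightarrow> \<exists>R>0. (\<integral>\<^sup>+t\<in>{0..R}. inverse (ennreal t) \<partial>povm_scalar \<Omega>' x) = \<infinity>"
    by (auto simp: N0K_def)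
  \<comment> \<open>Only a property of M leaves the model of \<open>\<Omega>'\<close>; it is applied
    below in the model of \<open>\<Omega>\<close>.\<close>
  have K': "Krein_condition M"
    by (rule Herglotz_model.Krein_condition_M[OF Herglotz_modelI[OF assms \<Omega>(1) \<Omega>'(1)] \<Omega>'(2) K])
  interpret Herglotz_model \<Omega> M by (rule Herglotz_modelI[OF assms \<Omega>(1,2)])
  interpret nonneg_realization space_S mult_op "\<gamma> \<i>" by (rule nonneg_realization[OF \<Omega>(3)])
  have unique: "H' = mult_op" if "self_adjoint space_S H' \<and> nonneg_op H' \<and> Hdot \<subseteq> H'" for H'
    using unique_extension[OF Friedrichs_condition_mult_op[OF Friedrichs_condition_M[OF \<Omega>(3) F]]
      Krein_condition_mult_op[OF K']] that by blast
  show "\<exists>(S :: ell2 set) Hdot H V.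
        hilbert_subspace S \<and> separable_set S \<and> dd_closed_symmetric S Hdot \<and>
        nonneg_op Hdot \<and> self_adjoint S H \<and> nonneg_op H \<and> Hdot \<subseteq> H \<and>
        (\<forall>H'. self_adjoint S H' \<and> nonneg_op H' \<and> Hdot \<subseteq> H' \<longrightarrow> H' = H) \<and>
        unitary_onto V (deficiency_plus S Hdot) \<and>
        (\<forall>z. z \<notin> \<real> \<longrightarrow> M z = Herglotz_realization H (deficiency_plus S Hdot) V z)"
    by (intro exI[of _ space_S] exI[of _ Hdot] exI[of _ mult_op] exI[of _ "\<gamma> \<i>"] conjI allI impI)
      (rule hilbert_S separable_S Hdot_dd Hdot_nonneg mult_op_self_adjoint nn Hdot_sub unique unitary realization_M; assumption?)+
qed

end
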